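(* Let $p$ be prime and $q$ a divisor of $p-1$. The subgroups of the $q$-hedral groups $\mathbb{Z}_q\ltimes\mathbb{Z}_p$ are information-theoretically reconstructible (as a family indexed by the pairs $(p,q)$). In particular, the subgroups of the affine groups $A_p=\mathbb{Z}_p^*\ltimes\mathbb{Z}_p$ are information-theoretically reconstructible.
   Context: For a prime $p$ and $q\mid p-1$, the $q$-hedral group $\mathbb{Z}_q\ltimes\mathbb{Z}_p$ is the following group: fix $a\in\mathbb{Z}_p^*$ of multiplicative order $q$; the elements are the pairs $(a^t,\beta)$ with $t\in\mathbb{Z}_q$, $\beta\in\mathbb{Z}_p$, and the multiplication is $(\alpha_1,\beta_1)(\alpha_2,\beta_2)=(\alpha_1\alpha_2,\ \beta_1+\alpha_1\beta_2)$. The affine group $A_p$ is the case $q=p-1$. Hidden Subgroup Problem (HSP) for $G$: given oracle access to a function $f:G\to S$ ($S$ a finite set of bit strings of length polynomial in $\log|G|$) which is constant on each left coset of an unknown subgroup $H\le G$ and distinct on distinct left cosets, determine $H$. Subgroups of a family of groups $\{G_i\}$ are information-theoretically reconstructible if the solution to the HSP for $G_i$ is determined information-theoretically by the fully measured result of a quantum circuit, with oracle access to $f$, of size polynomial in $\log|G_i|$. That is, there is such a circuit (which may make polynomially many queries to $f$ and intermediate measurements) together with a function, with no bound on its computational complexity and not depending on $f$, mapping the classical measurement outcomes to subgroups of $G_i$, such that for every admissible $f$ the result is the hidden subgroup $H$ with high probability (probability $1-o(1)$ as $|G_i|\to\infty$). An oracle query is the unitary $|g\rangle|y\rangle\mapsto|g\rangle|y\oplus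 f(g)\rangle$. *)

theory Defs
  imports
    "HOL-Analysis.Analysis"
    "HOL-Algebra.Coset"
    "HOL-Number_Theory.Number_Theory"
    "HOL-Computational_Algebra.Polynomial"
    "HOL-Library.Log_Nat"
begin

section \<open>The q-hedral and affine groups\<close>

text \<open>
  \<open>\<int>\<^sub>p\<close> is represented by the residues \<open>{..<p}\<close> and its unit group by \<open>totatives p\<close>. The common
  composition law is that of the maps \<open>x \<mapsto> \<alpha> * x + \<beta>\<close>, with \<open>\<alpha>\<close> restricted to \<open>A\<close>.
\<close>

definition affine_over :: "nat \<Rightarrow> nat set \<Rightarrow> (nat \<times> nat) monoid" where
  "affine_over p A =
    \<lparr>carrier = A \<times> {..<p},
     mult = (\<lambda>(\<alpha>1, \<beta>1) (\<alpha>2, \<beta>2). ((\<alpha>1 * \<alpha>2) mod p, (\<beta>1 + \<alpha>1 * \<beta>2) mod p)),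
     one = (1, 0)\<rparr>"

definition q_hedral_group :: "nat \<Rightarrow> nat \<Rightarrow> nat \<Rightarrow> (nat \<times> nat) monoid" where
  "q_hedral_group p q a = affine_over p ((\<lambda>t. a ^ t mod p) ` {..<q})"

definition affine_group :: "nat \<Rightarrow> (nat \<times> nat) monoid" where
  "affine_group p = affine_over p (totatives p)"

text \<open>
  Group elements are written in binary, least significant bit first, with the bit length of \<open>p\<close>
  for each of the two components.
\<close>

definition affine_code :: "nat \<Rightarrow> nat \<times> nat \<Rightarrow> bool list" where
  "affine_code p = (\<lambda>(\<alpha>, \<beta>). map (bit \<alpha>) [0..<floorlog 2 p] @ map (bit \<beta>) [0..<floorlog 2 p])"

definition affine_code_length :: "nat \<Rightarrow> nat" where
  "affine_code_length p = 2 * floorlog 2 p"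


section \<open>Quantum circuits with an oracle\<close>

text \<open>
  A state of \<open>n\<close> qubits is its family of amplitudes over the computational basis, whose elements
  are the bit lists of length \<open>n\<close>; values at other lists are irrelevant. States are not
  renormalized after a measurement.
\<close>

type_synonym state = "bool list \<Rightarrow> complex"

text \<open>
  Elementary gates are arbitrary unitaries on one or two qubits; the matrix entry \<open>U $ b $ c\<close> is
  the amplitude of the transition from basis state \<open>c\<close> to basis state \<open>b\<close>. In \<open>Query xs ys\<close> the
  wires \<open>xs\<close> carry the argument of the oracle, and its value is added bitwise to the wires \<open>ys\<close>.
\<close>

datatype instr =
    Gate1 nat "complex ^ bool ^ bool"
  | Gate2 nat nat "complex ^ (bool \<times> bool) ^ (bool \<times> bool)"
  | Query "nat list" "nat list"
  | is_Measure: Measure nat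

datatype circuit = Circuit (qubits: nat) (instrs: "instr list")

definition circuit_size :: "circuit \<Rightarrow> nat" where
  "circuit_size C = qubits C + length (instrs C)"

definition unitary :: "complex ^ 'n ^ 'n \<Rightarrow> bool" where
  "unitary U \<longleftrightarrow> transpose (map_matrix cnj U) ** U = mat 1 \<and> U ** transpose (map_matrix cnj U) = mat 1"

text \<open>Here \<open>n\<close> is the number of qubits, and the oracle maps \<open>l\<close> bits to \<open>m\<close> bits.\<close>

fun wf_instr :: "nat \<Rightarrow> nat \<Rightarrow> nat \<Rightarrow> instr \<Rightarrow> bool" where
  "wf_instr n l m (Gate1 i U) \<longleftrightarrow> i < n \<and> unitary U"
| "wf_instr n l m (Gate2 i j U) \<longleftrightarrow> i < n \<and> j < n \<and> i \<noteq> j \<and> unitary U"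
| "wf_instr n l m (Query xs ys) \<longleftrightarrow>
     length xs = l \<and> length ys = m \<and> distinct (xs @ ys) \<and> set (xs @ ys) \<subseteq> {..<n}"
| "wf_instr n l m (Measure i) \<longleftrightarrow> i < n"

definition wf_circuit :: "nat \<Rightarrow> nat \<Rightarrow> circuit \<Rightarrow> bool" where
  "wf_circuit l m C \<longleftrightarrow> (\<forall>c \<in> set (instrs C). wf_instr (qubits C) l m c)"

definition xor_wires :: "nat list \<Rightarrow> bool list \<Rightarrow> bool list \<Rightarrow> bool list" where
  "xor_wires ys bs x = fold (\<lambda>(y, b) z. z[y := (z ! y \<noteq> b)]) (zip ys bs) x"

definition initial_state :: "nat \<Rightarrow> state" where
  "initial_state n = (\<lambda>x. if x = replicate n False then 1 else 0)"

text \<open>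
  \<open>run F cs w \<psi>\<close> is the unnormalized state on the branch in which the intermediate measurements
  return the bits \<open>w\<close>, in order; it vanishes if \<open>w\<close> does not have one bit per measurement.
  A query permutes the basis by an involution, as its argument and value wires are disjoint, so the
  amplitude of \<open>x\<close> after the query is that of the image of \<open>x\<close> before it.
\<close>

fun run :: "(bool list \<Rightarrow> bool list) \<Rightarrow> instr list \<Rightarrow> bool list \<Rightarrow> state \<Rightarrow> state" where
  "run F [] [] \<psi> = \<psi>"
| "run F [] (b # w) \<psi> = (\<lambda>x. 0)"
| "run F (Gate1 i U # cs) w \<psi> =
     run F cs w (\<lambda>x. \<Sum>b\<in>UNIV. U $ (x ! i) $ b * \<psi> (x[i := b]))"
| "run F (Gate2 i j U # cs) w \<psi> =
     run F cs w (\<lambda>x. \<Sum>(b, c)\<in>UNIV. U $ (x ! i, x ! j) $ (b, c) * \<psi> (x[i := b, j := c]))"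
| "run F (Query xs ys # cs) w \<psi> =
     run F cs w (\<lambda>x. \<psi> (xor_wires ys (F (map ((!) x) xs)) x))"
| "run F (Measure i # cs) [] \<psi> = (\<lambda>x. 0)"
| "run F (Measure i # cs) (b # w) \<psi> =
     run F cs w (\<lambda>x. if x ! i = b then \<psi> x else 0)"

text \<open>
  At the end all qubits are measured. An outcome consists of the results of the intermediate
  measurements and of the final one.
\<close>

type_synonym outcome = "bool list \<times> bool list"

definition outcomes :: "circuit \<Rightarrow> outcome set" where
  "outcomes C =
    {w. length w = length (filter is_Measure (instrs C))} \<times> {x. length x = qubits C}"

definition outcome_prob :: "circuit \<Rightarrow> (bool list \<Rightarrow> bool list) \<Rightarrow> outcome \<Rightarrow> real" where
  "outcome_prob C F = (\<lambda>(w, x). (cmod (run F (instrs C) w (initial_state (qubits C)) x))\<^sup>2)"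

definition event_prob :: "circuit \<Rightarrow> (bool list \<Rightarrow> bool list) \<Rightarrow> (outcome \<Rightarrow> bool) \<Rightarrow> real" where
  "event_prob C F E = (\<Sum>r | r \<in> outcomes C \<and> E r. outcome_prob C F r)"


section \<open>Information-theoretic reconstructibility\<close>

definition hides :: "('g, 'b) monoid_scheme \<Rightarrow> nat \<Rightarrow> ('g \<Rightarrow> bool list) \<Rightarrow> 'g set \<Rightarrow> bool" where
  "hides G m f H \<longleftrightarrow>
    subgroup H G \<and>
    (\<forall>x \<in> carrier G. length (f x) = m) \<and>
    (\<forall>x \<in> carrier G. \<forall>y \<in> carrier G. f x = f y \<longleftrightarrow> x <#\<^bsub>G\<^esub> H = y <#\<^bsub>G\<^esub> H)"

text \<open>
  The oracle unitary is specified by \<open>f\<close> only on codewords of group elements. A circuit must work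
  for every extension of it to the remaining bit strings.
\<close>

definition implements ::
  "('g, 'b) monoid_scheme \<Rightarrow> ('g \<Rightarrow> bool list) \<Rightarrow> nat \<Rightarrow> nat \<Rightarrow>
   (bool list \<Rightarrow> bool list) \<Rightarrow> ('g \<Rightarrow> bool list) \<Rightarrow> bool" where
  "implements G code l m F f \<longleftrightarrow>
    (\<forall>x \<in> carrier G. F (code x) = f x) \<and> (\<forall>s. length s = l \<longrightarrow> length (F s) = m)"

definition polylog_bounded ::
  "'i set \<Rightarrow> ('i \<Rightarrow> ('g, 'b) monoid_scheme) \<Rightarrow> ('i \<Rightarrow> nat) \<Rightarrow> bool" where
  "polylog_bounded I G s \<longleftrightarrow>
    (\<exists>P :: real poly. \<forall>i \<in> I. real (s i) \<le> poly P (log 2 (card (carrier (G i)))))"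

text \<open>
  The family \<open>G\<close> is indexed by \<open>I\<close>; elements of \<open>G i\<close> are given to the oracle as the bit strings
  \<open>code i\<close>, of length \<open>l i\<close>. The length \<open>m\<close> of the values of the hiding functions belongs to the
  problem, so the circuits \<open>C\<close>, the maps \<open>R\<close> from outcomes to subgroups and the rate \<open>\<epsilon>\<close> may depend
  on it, but not on the hiding function.
\<close>

definition info_reconstructible ::
  "'i set \<Rightarrow> ('i \<Rightarrow> ('g, 'b) monoid_scheme) \<Rightarrow> ('i \<Rightarrow> 'g \<Rightarrow> bool list) \<Rightarrow> ('i \<Rightarrow> nat) \<Rightarrow> bool" where
  "info_reconstructible I G code l \<longleftrightarrow>
    (\<forall>m. polylog_bounded I G m \<longrightarrow>
      (\<exists>(C :: 'i \<Rightarrow> circuit) (R :: 'i \<Rightarrow> outcome \<Rightarrow> 'g set) (\<epsilon> :: nat \<Rightarrow> real).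
         polylog_bounded I G (\<lambda>i. circuit_size (C i)) \<and>
         \<epsilon> \<longlonglongrightarrow> 0 \<and>
         (\<forall>i \<in> I.
            wf_circuit (l i) (m i) (C i) \<and>
            (\<forall>r. subgroup (R i r) (G i)) \<and>
            (\<forall>H f F. hides (G i) (m i) f H \<and> implements (G i) (code i) (l i) (m i) F f \<longrightarrow>
               event_prob (C i) F (\<lambda>r. R i r = H) \<ge> 1 - \<epsilon> (card (carrier (G i)))))))"

end

theory Submission
  imports Defs
begin

text \<open>
  The subgroup \<open>N\<close> of translations has prime order, so a subgroup \<open>H\<close> either contains \<open>N\<close> or meets
  each fibre \<open>{\<alpha>} \<times> \<int>\<^sub>p\<close> in at most one point \<open>(\<alpha>, s)\<close>. Either way \<open>H\<close> is determined by its fibres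
  over one element \<open>\<alpha>\<close> of each prime power order dividing \<open>q\<close>, which are polylogarithmically many.

  For fixed \<open>\<alpha>\<close>, finding the fibre is a hidden shift problem: \<open>f (1, b) = f (\<alpha>, b')\<close> iff
  \<open>b' - b\<close> lies in the fibre over \<open>\<alpha>\<close>. Query \<open>f\<close> on a superposition of the points \<open>(1, b)\<close> and \<open>(\<alpha>, b)\<close>
  with \<open>b\<close> in an interval \<open>{..<L}\<close>, Fourier transform \<open>b\<close> over a cyclic group of order \<open>N \<ge> 2 p\<close>, a
  power of 2, and measure the control qubit in a rotated basis. If \<open>N\<close> is not contained in \<open>H\<close>, the
  frequency \<open>y\<close> is uniform and the bias of the control bit is a combination of the waves
  \<open>cos (2 \<pi> y D / N + \<pi> / 4)\<close> with \<open>D = s\<close> and \<open>D = s - p\<close>. No two frequencies coincide mod \<open>N\<close>,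
  and \<open>L > 2 p / 3\<close> gives one of the waves a constant weight, so different fibres yield distributions
  whose fidelity is at most a constant below 1. If \<open>N\<close> is contained in \<open>H\<close>, this shows at \<open>y = 0\<close>.

  Fidelities multiply over independent repetitions, and maximum likelihood estimation errs with
  probability at most the number of subgroups times the largest fidelity.
\<close>

section \<open>Circuits on disjoint registers\<close>

text \<open>The oracle is specified only on codewords of group elements, so the superposed
  \<open>b\<close> must stay below \<open>p\<close>. An interval of length
  \<open>K * 2 ^ (n - 2)\<close> with \<open>K\<close> equal to 2 or 3 can be prepared exactly by
  Hadamard gates and one two-qubit gate, and one of these lengths lies between
  \<open>2 * p / 3\<close> and \<open>p\<close>. A power of 2 as the order of the Fourier transform
  likewise allows an exact circuit. The price is that the shift by \<open>s\<close> modulo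
  \<open>p\<close> shows up as two integer differences. The shift by \<open>p - s\<close> has the
  negated differences, and plain cosines could not tell it from \<open>s\<close>; hence the rotated
  basis.

  The values of \<open>f\<close> are arbitrary strings, but once they are measured and ignored only
  their coincidences matter. The outcome distribution for each candidate subgroup is therefore known
  without \<open>f\<close>, which makes the estimate a fixed function of the outcomes.

  Testing every \<open>\<alpha>\<close> could take \<open>q\<close> tests, too many. The restriction
  to prime power orders also bounds the number of subgroups by
  \<open>(p + 2) ^ card generators\<close>, so that polylogarithmically many repetitions
  suffice.\<close>

lemma length_xor_wires [simp]: "length (xor_wires ys bs x) = length x"
  unfolding xor_wires_def
  by (induction ys arbitrary: bs x) (auto simp: zip_Cons1 split: list.splits)

lemma xor_wires_Nil [simp]: "xor_wires [] bs x = x" "xor_wires ys [] x = x"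
  by (simp_all add: xor_wires_def)

lemma xor_wires_Cons [simp]:
  "xor_wires (y # ys) (b # bs) x = xor_wires ys bs (x[y := (x ! y \<noteq> b)])"
  by (simp add: xor_wires_def)

lemma nth_xor_wires_upt:
  assumes "s + length bs \<le> length x"
  shows "xor_wires [s..<s + length bs] bs x ! i =
    (if s \<le> i \<and> i < s + length bs then x ! i \<noteq> bs ! (i - s) else x ! i)"
  using assms
proof (induction bs arbitrary: s x)
  case (Cons b bs)
  have "[s..<s + length (b # bs)] = s # [Suc s..<Suc s + length bs]"
    using upt_conv_Cons[of s "s + length (b # bs)"] by simp
  then show ?case
    using Cons.IH[of "Suc s" "x[s := (x ! s \<noteq> b)]"] Cons.prems
    by (cases "i = s"; cases "i < s") (simp_all add: nth_Cons')
qed auto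

lemma take_xor_wires:
  "set ys \<subseteq> {..<n} \<Longrightarrow> take n (xor_wires ys bs x) = xor_wires ys bs (take n x)"
proof (induction ys arbitrary: bs x)
  case (Cons y ys)
  then show ?case by (cases bs) (auto simp: take_update_swap)
qed simp

lemma drop_xor_wires:
  "set ys \<subseteq> {..<n} \<Longrightarrow> drop n (xor_wires ys bs x) = drop n x"
proof (induction ys arbitrary: bs x)
  case (Cons y ys)
  then show ?case by (cases bs) auto
qed simp

lemma take_xor_wires_shift:
  "take n (xor_wires (map ((+) n) ys) bs x) = take n x"
proof (induction ys arbitrary: bs x)
  case (Cons y ys)
  then show ?case by (cases bs) auto
qed simp

lemma drop_xor_wires_shift:
  "n \<le> length x \<Longrightarrow> drop n (xor_wires (map ((+) n) ys) bs x) = xor_wires ys bs (drop n x)"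
proof (induction ys arbitrary: bs x)
  case (Cons y ys)
  then show ?case by (cases bs) (auto simp: drop_update_swap)
qed simp

definition coherent :: "instr list \<Rightarrow> bool" where
  "coherent cs \<longleftrightarrow> (\<forall>c \<in> set cs. \<not> is_Measure c)"

lemma coherent_simps [simp]:
  "coherent []" "coherent (Gate1 i U # cs) = coherent cs" "coherent (Gate2 i j V # cs) = coherent cs"
  "coherent (Query xs ys # cs) = coherent cs" "\<not> coherent (Measure i # cs)"
  "coherent (cs @ ds) = (coherent cs \<and> coherent ds)"
  by (auto simp: coherent_def)

text \<open>A coherent prefix consumes no measurement bits, so the whole of \<open>w\<close> is left
  for \<open>ds\<close>.\<close>

lemma run_append: "coherent cs \<Longrightarrow> run F (cs @ ds) w \<psi> = run F ds w (run F cs [] \<psi>)"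
proof (induction cs arbitrary: \<psi>)
  case (Cons c cs)
  then show ?case by (cases c) auto
qed simp

text \<open>Every instruction preserves the length of the list, so amplitudes at lists of other
  lengths never mix in. States may thus be rewritten under an assumption on the length.\<close>

lemma run_cong:
  assumes "\<And>x. length x = k \<Longrightarrow> \<psi> x = \<psi>' x" "length x = k"
  shows "run F cs w \<psi> x = run F cs w \<psi>' x"
  using assms
proof (induction cs arbitrary: \<psi> \<psi>' w)
  case Nil
  then show ?case by (cases w) auto
next
  case (Cons c cs)
  have IH: "run F cs w \<phi> x = run F cs w \<phi>' x" if "\<And>x. length x = k \<Longrightarrow> \<phi> x = \<phi>' x" for \<phi> \<phi>' w
    by (rule Cons.IH[OF that Cons.prems(2)])
  show ?case
  proof (cases c)
    case (Measure i)
    then show ?thesis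
      by (cases w) (auto intro!: IH simp: Cons.prems(1))
  qed (auto intro!: IH sum.cong simp: Cons.prems(1))
qed

section \<open>Tensor products of circuits\<close>

fun shift_instr :: "nat \<Rightarrow> instr \<Rightarrow> instr" where
  "shift_instr n (Gate1 i U) = Gate1 (n + i) U"
| "shift_instr n (Gate2 i j U) = Gate2 (n + i) (n + j) U"
| "shift_instr n (Query xs ys) = Query (map ((+) n) xs) (map ((+) n) ys)"
| "shift_instr n (Measure i) = Measure (n + i)"

lemma run_left_factor:
  assumes "\<forall>c \<in> set cs. wf_instr n l m c" "coherent cs"
  shows "run F cs [] (\<lambda>x. \<phi> (take n x) * \<eta> (drop n x)) =
    (\<lambda>x. run F cs [] \<phi> (take n x) * \<eta> (drop n x))"
  using assms
proof (induction cs arbitrary: \<phi>)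
  case (Cons c cs)
  show ?case
  proof (cases c)
    case (Gate1 i U)
    have "(\<lambda>x. \<Sum>b\<in>UNIV. U $ (x ! i) $ b * (\<phi> (take n (x[i := b])) * \<eta> (drop n (x[i := b])))) =
      (\<lambda>x. (\<lambda>x. \<Sum>b\<in>UNIV. U $ (x ! i) $ b * \<phi> (x[i := b])) (take n x) * \<eta> (drop n x))"
      using Cons.prems Gate1
      by (auto simp: take_update_swap sum_distrib_right mult.assoc)
    moreover have "\<forall>c \<in> set cs. wf_instr n l m c" "coherent cs"
      using Cons.prems Gate1 by auto
    ultimately show ?thesis
      unfolding Gate1 run.simps by (simp only: Cons.IH[of "\<lambda>x. \<Sum>b\<in>UNIV. U $ (x ! i) $ b * \<phi> (x[i := b])"])
  next
    case (Gate2 i j U)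
    have "(\<lambda>x. \<Sum>(b, c)\<in>UNIV. U $ (x ! i, x ! j) $ (b, c) *
        (\<phi> (take n (x[i := b, j := c])) * \<eta> (drop n (x[i := b, j := c])))) =
      (\<lambda>x. (\<lambda>x. \<Sum>(b, c)\<in>UNIV. U $ (x ! i, x ! j) $ (b, c) * \<phi> (x[i := b, j := c])) (take n x)
        * \<eta> (drop n x))"
      using Cons.prems Gate2
      by (auto simp: take_update_swap sum_distrib_right mult.assoc case_prod_unfold)
    moreover have "\<forall>c \<in> set cs. wf_instr n l m c" "coherent cs"
      using Cons.prems Gate2 by auto
    ultimately show ?thesis
      unfolding Gate2 run.simps by (simp only: Cons.IH[of "\<lambda>x. \<Sum>(b, c)\<in>UNIV. U $ (x ! i, x ! j) $ (b, c) * \<phi> (x[i := b, j := c])"])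
  next
    case (Query xs ys)
    have wf: "set xs \<subseteq> {..<n}" "set ys \<subseteq> {..<n}"
      using Cons.prems Query by auto
    have "map ((!) (take n x)) xs = map ((!) x) xs" for x :: "bool list"
      using wf(1) by auto
    then have "(\<lambda>x. \<phi> (take n (xor_wires ys (F (map ((!) x) xs)) x)) *
         \<eta> (drop n (xor_wires ys (F (map ((!) x) xs)) x))) =
      (\<lambda>x. (\<lambda>x. \<phi> (xor_wires ys (F (map ((!) x) xs)) x)) (take n x) * \<eta> (drop n x))"
      by (simp only: take_xor_wires[OF wf(2)] drop_xor_wires[OF wf(2)])
    moreover have "\<forall>c \<in> set cs. wf_instr n l m c" "coherent cs"
      using Cons.prems Query by auto
    ultimately show ?thesis
      unfolding Query run.simps by (simp only: Cons.IH[of "\<lambda>x. \<phi> (xor_wires ys (F (map ((!) x) xs)) x)"])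
  next
    case (Measure i)
    then show ?thesis
      using Cons.prems by simp
  qed
qed simp

text \<open>Restricted to lists of length at least \<open>n\<close>, since only there is wire
  \<open>n + i\<close> of \<open>x\<close> the same as wire \<open>i\<close> of
  \<open>drop n x\<close>.\<close>

lemma run_right_factor:
  assumes "coherent cs" "n \<le> length x"
  shows "run F (map (shift_instr n) cs) [] (\<lambda>x. \<phi> (take n x) * \<eta> (drop n x)) x =
    \<phi> (take n x) * run F cs [] \<eta> (drop n x)"
  using assms
proof (induction cs arbitrary: \<eta>)
  case (Cons c cs)
  have *: "run F (map (shift_instr n) cs) [] \<psi> x = \<phi> (take n x) * run F cs [] \<eta> (drop n x)"
    if "\<And>x. n \<le> length x \<Longrightarrow> \<psi> x = \<phi> (take n x) * \<eta> (drop n x)" for \<psi> \<eta>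
  proof -
    have "run F (map (shift_instr n) cs) [] \<psi> x =
      run F (map (shift_instr n) cs) [] (\<lambda>x. \<phi> (take n x) * \<eta> (drop n x)) x"
      using that Cons.prems(2) by (intro run_cong[where k = "length x"]) auto
    also have "\<dots> = \<phi> (take n x) * run F cs [] \<eta> (drop n x)"
      by (rule Cons.IH) (use Cons.prems in \<open>cases c; simp\<close>)+
    finally show ?thesis .
  qed
  show ?case
  proof (cases c)
    case (Gate1 i U)
    show ?thesis
      unfolding Gate1 list.map shift_instr.simps run.simps
      by (rule *) (simp add: drop_update_swap sum_distrib_left mult.left_commute)
  next
    case (Gate2 i j U)
    show ?thesis
      unfolding Gate2 list.map shift_instr.simps run.simps
      by (rule *) (simp add: drop_update_swap sum_distrib_left mult.left_commute case_prod_unfold)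
  next
    case (Query xs ys)
    have "map ((!) x) (map ((+) n) xs) = map ((!) (drop n x)) xs" if "n \<le> length x" for x :: "bool list"
      using that by auto
    then show ?thesis
      unfolding Query list.map(2) shift_instr.simps run.simps
      by (intro *) (simp add: drop_xor_wires_shift take_xor_wires_shift del: map_map)
  next
    case (Measure i)
    then show ?thesis
      using Cons.prems by simp
  qed
qed simp

fun parallel :: "nat \<Rightarrow> instr list list \<Rightarrow> instr list" where
  "parallel n [] = []"
| "parallel n (cs # css) = cs @ map (shift_instr n) (parallel n css)"

lemma coherent_shift [simp]: "coherent (map (shift_instr n) cs) = coherent cs"
  unfolding coherent_def by (simp, rule ball_cong[OF refl], rename_tac c, case_tac c, auto)

lemma coherent_parallel: "\<forall>cs \<in> set css. coherent cs \<Longrightarrow> coherent (parallel n css)"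
  by (induction css) auto

lemma wf_instr_mono: "wf_instr n l m c \<Longrightarrow> n \<le> n' \<Longrightarrow> wf_instr n' l m c"
  by (cases c) force+

lemma wf_shift_instr: "wf_instr n' l m c \<Longrightarrow> wf_instr (n + n') l m (shift_instr n c)"
proof (cases c)
  case (Query xs ys)
  moreover assume "wf_instr n' l m c"
  ultimately show ?thesis
    by (auto simp: distinct_map)
qed auto

lemma wf_parallel:
  "\<forall>cs \<in> set css. \<forall>c \<in> set cs. wf_instr n l m c \<Longrightarrow>
   \<forall>c \<in> set (parallel n css). wf_instr (length css * n) l m c"
proof (induction css)
  case (Cons cs css)
  then show ?case
    by (auto intro: wf_shift_instr wf_instr_mono[of n])
qed simp

lemma length_parallel: "\<forall>cs \<in> set css. length cs \<le> k \<Longrightarrow> length (parallel n css) \<le> length css * k"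
  by (induction css) auto

lemma initial_state_add:
  "length x = n + n' \<Longrightarrow>
   initial_state (n + n') x = initial_state n (take n x) * initial_state n' (drop n x)"
proof -
  assume x: "length x = n + n'"
  have "x = replicate (n + n') False \<longleftrightarrow>
    take n x = replicate n False \<and> drop n x = replicate n' False"
    unfolding replicate_add using x
    by (metis append_eq_append_conv append_take_drop_id length_replicate length_take min.absorb2 le_add1)
  then show ?thesis
    by (simp add: initial_state_def)
qed

text \<open>The all-zero state is a product state, so the first block and the shifted rest act on
  separate tensor factors, and the amplitude splits off block by block.\<close>

lemma run_parallel:
  assumes "\<forall>cs \<in> set css. \<forall>c \<in> set cs. wf_instr n l m c" "\<forall>cs \<in> set css. coherent cs"
    and "length x = length css * n"
  shows "run F (parallel n css) [] (initial_state (length css * n)) x =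
    (\<Prod>j<length css. run F (css ! j) [] (initial_state n) (take n (drop (j * n) x)))"
  using assms
proof (induction css arbitrary: x)
  case Nil
  then show ?case by (simp add: initial_state_def)
next
  case (Cons cs css)
  let ?N = "length css * n"
  have "run F (parallel n (cs # css)) [] (initial_state (n + ?N)) x =
    run F (parallel n (cs # css)) [] (\<lambda>x. initial_state n (take n x) * initial_state ?N (drop n x)) x"
    using Cons.prems(3) by (intro run_cong[where k = "n + ?N"]) (auto intro: initial_state_add)
  also have "\<dots> = run F cs [] (initial_state n) (take n x) * run F (parallel n css) [] (initial_state ?N) (drop n x)"
    using Cons.prems
    by (simp add: run_append run_left_factor[of _ n l m] run_right_factor coherent_parallel)
  also have "\<dots> = (\<Prod>j<Suc (length css).
      run F ((cs # css) ! j) [] (initial_state n) (take n (drop (j * n) x)))"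
    using Cons.prems by (subst Cons.IH) (auto simp: prod.lessThan_Suc_shift add.commute simp del: prod.lessThan_Suc)
  finally show ?case by simp
qed

text \<open>Independence of the blocks: cutting off the first \<open>n\<close> bits is a bijection,
  so the sum factorizes one block at a time.\<close>

lemma sum_prod_chunks:
  fixes g :: "nat \<Rightarrow> bool list \<Rightarrow> real"
  shows "(\<Sum>x | length x = T * n. \<Prod>j<T. g j (take n (drop (j * n) x))) =
    (\<Prod>j<T. \<Sum>x | length x = n. g j x)"
proof (induction T arbitrary: g)
  case (Suc T)
  have "(\<Sum>x | length x = Suc T * n. \<Prod>j<Suc T. g j (take n (drop (j * n) x))) =
    (\<Sum>(y, z) \<in> {y. length y = n} \<times> {z. length z = T * n}. g 0 y * (\<Prod>j<T. g (Suc j) (take n (drop (j * n) z))))"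
    by (rule sum.reindex_bij_witness[of _ "\<lambda>(y, z). y @ z" "\<lambda>x. (take n x, drop n x)"])
      (auto simp: prod.lessThan_Suc_shift add.commute simp del: prod.lessThan_Suc)
  also have "\<dots> = (\<Sum>y | length y = n. g 0 y) * (\<Prod>j<T. \<Sum>x | length x = n. g (Suc j) x)"
    by (simp add: sum_product sum.cartesian_product Suc.IH[symmetric])
  finally show ?case
    by (simp add: prod.lessThan_Suc_shift del: prod.lessThan_Suc)
qed (simp)


section \<open>Gates and the quantum Fourier transform\<close>

text \<open>The Hadamard gate applied after the phase \<open>cis \<theta>\<close> on the basis state
  1; a nonzero angle thus yields a measurement in a rotated basis.\<close>

definition hadamard :: "real \<Rightarrow> complex ^ bool ^ bool" where
  "hadamard \<theta> = (\<chi> z c. (if c then (if z then - 1 else 1) * cis \<theta> else 1) / sqrt 2)"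

definition cphase :: "real \<Rightarrow> complex ^ (bool \<times> bool) ^ (bool \<times> bool)" where
  "cphase \<theta> = (\<chi> r s. if r = s then (if fst r \<and> snd r then cis \<theta> else 1) else 0)"

text \<open>For the four functions \<open>g\<close> these are the identity, NOT on the target, and
  the controlled NOTs with positive and with negated control.\<close>

definition cflip :: "(bool \<Rightarrow> bool) \<Rightarrow> complex ^ (bool \<times> bool) ^ (bool \<times> bool)" where
  "cflip g = (\<chi> r s. if s = (fst r, snd r \<noteq> g (fst r)) then 1 else 0)"

lemma sum_UNIV_bool: "(\<Sum>b\<in>UNIV. f b) = f False + f True"
  for f :: "bool \<Rightarrow> 'a :: comm_monoid_add"
  by (simp add: UNIV_bool)

lemma sum_UNIV_bool_bool: "(\<Sum>b\<in>UNIV. f b) =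
    f (False, False) + f (False, True) + f (True, False) + f (True, True)"
  for f :: "bool \<times> bool \<Rightarrow> 'a :: comm_monoid_add"
  by (simp flip: UNIV_Times_UNIV sum.cartesian_product' add: UNIV_bool add.assoc)

lemmas unitary_simps = unitary_def vec_eq_iff matrix_matrix_mult_def transpose_def map_matrix_def
  mat_def

lemma unitaryI: "transpose (map_matrix cnj U) ** U = mat 1 \<Longrightarrow> unitary U"
  using matrix_left_right_inverse unitary_def by blast

lemma cis_cnj_mult [simp]: "cnj (cis t) * cis t = 1" "cis t * cnj (cis t) = 1"
  by (simp_all add: cis_cnj flip: cis_inverse)

lemma of_real_sqrt_mult_self: "0 \<le> a \<Longrightarrow> complex_of_real (sqrt a) * complex_of_real (sqrt a) = of_real a"
  by (simp flip: of_real_mult)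

lemma unitary_hadamard: "unitary (hadamard \<theta>)"
  by (rule unitaryI)
    (simp add: unitary_simps sum_UNIV_bool hadamard_def all_bool_eq of_real_sqrt_mult_self)

lemma unitary_cphase: "unitary (cphase \<theta>)"
  by (rule unitaryI)
    (simp add: unitary_simps sum_UNIV_bool_bool cphase_def all_bool_eq split_paired_All)

lemma unitary_cflip: "unitary (cflip g)"
  by (rule unitaryI)
    (simp add: unitary_simps sum_UNIV_bool_bool cflip_def all_bool_eq split_paired_All)

text \<open>The gate will act on blank wires, so only its first column matters: it spreads the two
  leading bits evenly over the numbers below \<open>K\<close>. The other columns merely complete an
  orthonormal basis.\<close>

lemma ex_unitary_uniform_column:
  assumes "K = 2 \<or> K = 3"
  shows "\<exists>U. unitary U \<and> (\<forall>h l. U $ (h, l) $ (False, False) =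
    (if 2 * of_bool h + of_bool l < (K::nat) then 1 / sqrt K else 0))"
proof (cases "K = 2")
  case True
  let ?U = "(\<chi> r s. if fst r = fst s then hadamard 0 $ snd r $ snd s else 0)
    :: complex ^ (bool \<times> bool) ^ (bool \<times> bool)"
  have "unitary ?U"
    by (rule unitaryI)
      (simp add: unitary_simps sum_UNIV_bool_bool hadamard_def all_bool_eq split_paired_All of_real_sqrt_mult_self)
  moreover have "\<forall>h l. ?U $ (h, l) $ (False, False) =
      (if 2 * of_bool h + of_bool l < (K::nat) then 1 / sqrt K else 0)"
    using True by (simp add: all_bool_eq hadamard_def)
  ultimately show ?thesis by blast
next
  case False
  \<comment> \<open>The columns are \<open>(1, 1, 1, 0) / sqrt 3\<close>,
    \<open>(1, - 1, 0, 0) / sqrt 2\<close>, \<open>(1, 1, - 2, 0) / sqrt 6\<close> and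
    \<open>(0, 0, 0, 1)\<close>, in the order 00, 01, 10, 11.\<close>
  define V :: "bool \<times> bool \<Rightarrow> bool \<times> bool \<Rightarrow> complex" where
    "V = (\<lambda>(h, l) (h', l').
      if h \<and> l then (if h' \<and> l' then 1 else 0)
      else if h' \<and> l' then 0
      else if h' then (if h then - 2 else 1) / sqrt 6
      else if l' then (if h then 0 else if l then - 1 else 1) / sqrt 2
      else 1 / sqrt 3)"
  let ?U = "(\<chi> r s. V r s) :: complex ^ (bool \<times> bool) ^ (bool \<times> bool)"
  have "unitary ?U"
    by (rule unitaryI)
      (simp add: unitary_simps sum_UNIV_bool_bool V_def all_bool_eq split_paired_All of_real_sqrt_mult_self)
  moreover have "\<forall>h l. ?U $ (h, l) $ (False, False) =
      (if 2 * of_bool h + of_bool l < (K::nat) then 1 / sqrt K else 0)"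
    using assms False by (simp add: all_bool_eq V_def)
  ultimately show ?thesis by blast
qed

text \<open>\<open>S\<close> holds the wires that are already in uniform superposition; each gate
  adds one wire to it and divides the common amplitude by \<open>sqrt 2\<close>.\<close>

lemma run_hadamards:
  assumes "distinct ws" "set ws \<subseteq> {..<k}" "S \<inter> set ws = {}" "length x = k"
  shows "run F (map (\<lambda>i. Gate1 i (hadamard 0)) ws) [] (\<lambda>x. if \<forall>i<k. i \<notin> S \<longrightarrow> \<not> x ! i then \<kappa> else 0) x =
    (if \<forall>i<k. i \<notin> S \<union> set ws \<longrightarrow> \<not> x ! i then \<kappa> / sqrt 2 ^ length ws else 0)"
  using assms
proof (induction ws arbitrary: S \<kappa>)
  case (Cons w ws)
  let ?s = "\<lambda>S x. \<forall>i<k. i \<notin> S \<longrightarrow> \<not> x ! i"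
  have "(\<Sum>b\<in>UNIV. hadamard 0 $ (x ! w) $ b * (if ?s S (x[w := b]) then \<kappa> else 0)) =
      (if ?s (insert w S) x then \<kappa> / sqrt 2 else 0)" if "length x = k" for x
  proof -
    have "?s S (x[w := False]) = ?s (insert w S) x"
      using that Cons.prems by (auto simp: nth_list_update split: if_splits)
    then have "(if ?s S (x[w := False]) then \<kappa> else 0) = (if ?s (insert w S) x then \<kappa> else 0)"
      by (simp only:)
    moreover have "(if ?s S (x[w := True]) then \<kappa> else 0) = 0"
      using that Cons.prems by auto
    ultimately show ?thesis
      unfolding sum_UNIV_bool by (simp only: hadamard_def) auto
  qed
  then have "run F (map (\<lambda>i. Gate1 i (hadamard 0)) (w # ws)) [] (\<lambda>x. if ?s S x then \<kappa> else 0) x =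
    run F (map (\<lambda>i. Gate1 i (hadamard 0)) ws) [] (\<lambda>x. if ?s (insert w S) x then \<kappa> / sqrt 2 else 0) x"
    unfolding list.map run.simps using Cons.prems(4) by (intro run_cong[where k = k])
  also have "\<dots> = (if ?s (insert w S \<union> set ws) x then \<kappa> / sqrt 2 / sqrt 2 ^ length ws else 0)"
    using Cons.prems by (intro Cons.IH) auto
  also have "insert w S \<union> set ws = S \<union> set (w # ws)"
    by auto
  also have "\<kappa> / sqrt 2 / sqrt 2 ^ length ws = \<kappa> / sqrt 2 ^ length (w # ws)"
    by simp
  finally show ?case .
qed auto

definition load :: "nat \<Rightarrow> nat \<Rightarrow> (bool \<Rightarrow> nat) \<Rightarrow> instr list" where
  "load n c A = map (\<lambda>i. Gate2 c i (cflip (\<lambda>b. bit (A b) i))) [0..<n]"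

definition load_bits :: "nat \<Rightarrow> nat \<Rightarrow> (bool \<Rightarrow> nat) \<Rightarrow> bool list \<Rightarrow> bool list" where
  "load_bits n c A x = map (\<lambda>i. if i < n then x ! i \<noteq> bit (A (x ! c)) i else x ! i) [0..<length x]"

lemma length_load_bits [simp]: "length (load_bits n c A x) = length x"
  by (simp add: load_bits_def)

lemma nth_load_bits:
  "i < length x \<Longrightarrow> load_bits n c A x ! i = (if i < n then x ! i \<noteq> bit (A (x ! c)) i else x ! i)"
  by (simp add: load_bits_def)

lemma coherent_load [simp]: "coherent (load n c A)"
  by (auto simp: coherent_def load_def)

text \<open>Each gate permutes the basis by an involution, so the amplitude at \<open>x\<close> is
  the old one at the image of \<open>x\<close>. The control wire is not among the flipped ones, so
  all gates see the same control bit.\<close>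

lemma run_load:
  assumes "n \<le> c" "c < length x"
  shows "run F (load n c A) [] \<psi> x = \<psi> (load_bits n c A x)"
  using assms
proof (induction n arbitrary: x)
  case 0
  then show ?case by (simp add: load_def load_bits_def map_nth)
next
  case (Suc n)
  let ?x = "x[n := (x ! n \<noteq> bit (A (x ! c)) n)]"
  have upd: "x ! c \<Longrightarrow> x[c := True] = x" "\<not> x ! c \<Longrightarrow> x[c := False] = x"
    by (metis list_update_id)+
  have "run F (load (Suc n) c A) [] \<psi> x = run F (load n c A) [] \<psi> ?x"
    using Suc.prems
    by (simp add: load_def run_append coherent_def sum_UNIV_bool_bool cflip_def)
      (cases "x ! c"; cases "x ! n"; cases "bit (A (x ! c)) n";
        simp add: upd)
  also have "\<dots> = \<psi> (load_bits n c A ?x)"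
    using Suc.prems by (intro Suc.IH) auto
  also have "load_bits n c A ?x = load_bits (Suc n) c A x"
    using Suc.prems by (intro nth_equalityI) (auto simp: nth_load_bits nth_list_update less_Suc_eq)
  finally show ?case .
qed

section \<open>Quantum Fourier transform of order a power of 2\<close>

fun qft :: "nat \<Rightarrow> nat \<Rightarrow> instr list" where
  "qft s 0 = []"
| "qft s (Suc j) = Gate1 (s + j) (hadamard 0) #
     map (\<lambda>k. Gate2 (s + j) (s + k) (cphase (pi / 2 ^ (j - k)))) [0..<j] @ qft s j"

definition set_bits :: "nat \<Rightarrow> nat \<Rightarrow> nat \<Rightarrow> bool list \<Rightarrow> bool list" where
  "set_bits s j b x = map (\<lambda>i. if s \<le> i \<and> i < s + j then bit b (i - s) else x ! i) [0..<length x]"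

lemma length_set_bits [simp]: "length (set_bits s j b x) = length x"
  by (simp add: set_bits_def)

lemma nth_set_bits:
  "i < length x \<Longrightarrow> set_bits s j b x ! i = (if s \<le> i \<and> i < s + j then bit b (i - s) else x ! i)"
  by (simp add: set_bits_def)

lemma run_cphases:
  "run F (map (\<lambda>k. Gate2 (s + j) (s + k) (cphase (\<theta> k))) ks) [] \<psi> x =
   (\<Prod>k\<leftarrow>ks. if x ! (s + j) \<and> x ! (s + k) then cis (\<theta> k) else 1) * \<psi> x"
proof (induction ks arbitrary: \<psi>)
  case (Cons k ks)
  have "(\<lambda>x. \<Sum>(b, c)\<in>UNIV. cphase (\<theta> k) $ (x ! (s + j), x ! (s + k)) $ (b, c) * \<psi> (x[s + j := b, s + k := c])) =
    (\<lambda>x. (if x ! (s + j) \<and> x ! (s + k) then cis (\<theta> k) else 1) * \<psi> x)" (is "?l = ?r")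
  proof
    fix x :: "bool list"
    have "?l x = (\<Sum>r\<in>UNIV. if r = (x ! (s + j), x ! (s + k)) then ?r x else 0)"
      by (rule sum.cong) (auto simp: cphase_def split_paired_all split: if_splits)
    then show "?l x = ?r x"
      by simp
  qed
  then show ?case
    using Cons.IH by simp
qed simp

lemma sum_bits: "c < 2 ^ j \<Longrightarrow> (\<Sum>k<j. of_bool (bit c k) * 2 ^ k) = (of_nat c :: 'a :: comm_semiring_1)"
proof -
  assume "c < 2 ^ j"
  then have "c = horner_sum of_bool 2 (map (bit c) [0..<j])"
    by (simp add: horner_sum_bit_eq_take_bit take_bit_nat_eq_self)
  also have "\<dots> = (\<Sum>k<j. of_bool (bit c k) * 2 ^ k)"
    by (simp add: horner_sum_eq_sum atLeast0LessThan)
  finally have "of_nat c = (of_nat (\<Sum>k<j. of_bool (bit c k) * 2 ^ k) :: 'a)"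
    by simp
  then show ?thesis
    by simp
qed

lemma prod_cis: "(\<Prod>k\<in>A. cis (f k)) = cis (\<Sum>k\<in>A. f k)"
  by (induction A rule: infinite_finite_induct) (auto simp: cis_mult)

lemma coherent_qft [simp]: "coherent (qft s j)"
  by (induction j) (auto simp: coherent_def)

lemma sum_lessThan_double:
  "(\<Sum>c<2 ^ Suc j. f c) = (\<Sum>c<2 ^ j. f c + f (c + 2 ^ j))" for f :: "nat \<Rightarrow> 'a :: comm_monoid_add"
proof -
  have "(\<Sum>c<2 ^ Suc j. f c) = (\<Sum>c = 0..<2 ^ j. f c) + (\<Sum>c = 0 + 2 ^ j..<2 ^ j + 2 ^ j. f c)"
    by (simp add: mult_2 sum.atLeastLessThan_concat flip: atLeast0LessThan)
  then show ?thesis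
    by (simp only: sum.shift_bounds_nat_ivl atLeast0LessThan sum.distrib)
qed

lemma bit_add_power:
  fixes c :: nat
  assumes "c < 2 ^ j"
  shows "\<not> bit c j" "bit (c + 2 ^ j) j" "i < j \<Longrightarrow> bit (c + 2 ^ j) i = bit c i"
proof -
  show "\<not> bit c j" "bit (c + 2 ^ j) j"
    using assms by (auto simp: bit_iff_odd)
  assume "i < j"
  then obtain d where d: "j = i + Suc d"
    using less_iff_Suc_add by auto
  have "(c + 2 ^ j) div 2 ^ i = c div 2 ^ i + 2 ^ Suc d"
    using div_mult_self2[of "2 ^ i" c "2 ^ Suc d"] by (simp add: d power_add mult_ac)
  then show "bit (c + 2 ^ j) i = bit c i"
    by (simp add: bit_iff_odd)
qed

text \<open>This is the usual circuit without the final reversal of the wires, so output wire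
  \<open>i\<close> has weight \<open>1 / 2 ^ Suc i\<close>. The top wire becomes the output that
  sees all of \<open>c\<close>: its Hadamard gate accounts for the top bit of \<open>c\<close>, the
  controlled phases for the lower bits. The other outputs do not see the top bit, so the induction
  can remove it.\<close>

lemma run_qft:
  assumes "s + j \<le> length x"
  shows "run F (qft s j) [] \<psi> x = (1 / sqrt 2) ^ j * (\<Sum>c<2 ^ j.
    (\<Prod>i<j. cis (2 * pi * of_bool (x ! (s + i)) * c / 2 ^ Suc i)) * \<psi> (set_bits s j c x))"
  using assms
proof (induction j arbitrary: \<psi> x)
  case 0
  then show ?case by (simp add: set_bits_def map_nth)
next
  case (Suc j)
  let ?e = "\<lambda>j c. \<Prod>i<j. cis (2 * pi * of_bool (x ! (s + i)) * real c / 2 ^ Suc i)"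
  let ?X = "x ! (s + j)"
  define \<phi> where "\<phi> = (\<lambda>x. (\<Prod>k\<leftarrow>[0..<j]. if x ! (s + j) \<and> x ! (s + k) then cis (pi / 2 ^ (j - k)) else 1) *
    (\<Sum>b\<in>UNIV. hadamard 0 $ (x ! (s + j)) $ b * \<psi> (x[s + j := b])))"
  have "run F (qft s (Suc j)) [] \<psi> x = run F (qft s j) [] \<phi> x"
    by (simp add: run_append coherent_def run_cphases[abs_def] \<phi>_def)
  also have "\<dots> = (1 / sqrt 2) ^ j * (\<Sum>c<2 ^ j. ?e j c * \<phi> (set_bits s j c x))"
    using Suc by simp
  also have "\<dots> = (1 / sqrt 2) ^ j * (\<Sum>c<2 ^ j. 1 / sqrt 2 *
    (?e (Suc j) c * \<psi> (set_bits s (Suc j) c x) +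
     ?e (Suc j) (c + 2 ^ j) * \<psi> (set_bits s (Suc j) (c + 2 ^ j) x)))"
  proof (intro arg_cong[where f = "(*) _"] sum.cong refl)
    fix c :: nat assume "c \<in> {..<2 ^ j}"
    then have c: "c < 2 ^ j" by simp
    let ?y = "set_bits s j c x"
    have bits: "\<not> bit c j" "bit (c + 2 ^ j) j" "i < j \<Longrightarrow> bit (c + 2 ^ j) i = bit c i" for i
      using bit_add_power[OF c] by auto
    have y: "?y ! (s + j) = ?X" "k < j \<Longrightarrow> ?y ! (s + k) = bit c k" for k
      using Suc.prems by (auto simp: nth_set_bits)
    have upd: "?y[s + j := False] = set_bits s (Suc j) c x"
      "?y[s + j := True] = set_bits s (Suc j) (c + 2 ^ j) x"
      using Suc.prems bits by (auto intro!: nth_equalityI simp: nth_set_bits nth_list_update less_Suc_eq)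
    have "(\<Prod>k\<leftarrow>[0..<j]. if ?y ! (s + j) \<and> ?y ! (s + k) then cis (pi / 2 ^ (j - k)) else 1) =
      (\<Prod>k<j. cis (of_bool ?X * pi / 2 ^ j * (of_bool (bit c k) * 2 ^ k)))"
      unfolding prod.distinct_set_conv_list[OF distinct_upt, symmetric]
      by (rule prod.cong) (auto simp: y power_diff)
    also have "\<dots> = cis (\<Sum>k<j. of_bool ?X * pi / 2 ^ j * (of_bool (bit c k) * 2 ^ k))"
      by (rule prod_cis)
    also have "(\<Sum>k<j. of_bool ?X * pi / 2 ^ j * (of_bool (bit c k) * 2 ^ k)) = 2 * pi * of_bool ?X * c / 2 ^ Suc j"
      unfolding sum_distrib_left[symmetric] sum_bits[OF c] by simp
    finally have ph: "(\<Prod>k\<leftarrow>[0..<j]. if ?y ! (s + j) \<and> ?y ! (s + k) then cis (pi / 2 ^ (j - k)) else 1) =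
      cis (2 * pi * of_bool ?X * c / 2 ^ Suc j)" .
    \<comment> \<open>For the lower outputs the top input bit contributes whole turns.\<close>
    have "cis (2 * pi * of_bool (x ! (s + i)) * real (c + 2 ^ j) / 2 ^ Suc i) =
      cis (2 * pi * of_bool (x ! (s + i)) * c / 2 ^ Suc i)" if "i < j" for i
    proof -
      obtain d where d: "j = Suc i + d"
        using \<open>i < j\<close> less_iff_Suc_add by auto
      have "cis (2 * pi * of_bool (x ! (s + i)) * real (c + 2 ^ j) / 2 ^ Suc i) =
        cis (2 * pi * of_bool (x ! (s + i)) * c / 2 ^ Suc i + 2 * pi * of_int (of_bool (x ! (s + i)) * 2 ^ d))"
        by (rule arg_cong[where f = cis]) (simp add: d power_add field_simps)
      also have "\<dots> = cis (2 * pi * of_bool (x ! (s + i)) * c / 2 ^ Suc i)"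
        by (simp only: cis_multiple_2pi flip: cis_mult) simp
      finally show ?thesis .
    qed
    then have e: "?e j (c + 2 ^ j) = ?e j c"
      by (intro prod.cong) auto
    \<comment> \<open>For the top output it contributes half a turn, which is the sign in the
      Hadamard matrix.\<close>
    have cisX: "cis (2 * pi * of_bool ?X * real (c + 2 ^ j) / 2 ^ Suc j) =
      cis (2 * pi * of_bool ?X * c / 2 ^ Suc j) * (if ?X then - 1 else 1)"
      by (simp add: add_divide_distrib distrib_left flip: cis_mult)
    show "?e j c * \<phi> ?y = 1 / sqrt 2 *
      (?e (Suc j) c * \<psi> (set_bits s (Suc j) c x) +
       ?e (Suc j) (c + 2 ^ j) * \<psi> (set_bits s (Suc j) (c + 2 ^ j) x))"
      unfolding \<phi>_def ph
      unfolding sum_UNIV_bool upd prod.lessThan_Suc e cisX y(1)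
      by (cases ?X) (simp_all add: hadamard_def field_simps)
  qed
  also have "\<dots> = (1 / sqrt 2) ^ Suc j * (\<Sum>c<2 ^ Suc j. ?e (Suc j) c * \<psi> (set_bits s (Suc j) c x))"
    unfolding sum_lessThan_double by (simp add: sum_distrib_left mult_ac)
  finally show ?case .
qed


section \<open>The coset test\<close>

definition enc :: "nat \<Rightarrow> nat \<Rightarrow> nat \<Rightarrow> bool list" where
  "enc n a b = map (bit a) [0..<n] @ map (bit b) [0..<n]"

text \<open>With \<open>U\<close> spreading over \<open>K\<close> numbers, the second component runs
  through \<open>{..<K * 2 ^ (n - 2)}\<close>: Hadamard gates act on its \<open>n - 2\<close> low
  bits, \<open>U\<close> on the two leading ones. Wire \<open>2 * n\<close> stays 0 and pads
  \<open>b\<close> for the longer Fourier transform.\<close>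

definition prep :: "nat \<Rightarrow> complex ^ (bool \<times> bool) ^ (bool \<times> bool) \<Rightarrow> instr list" where
  "prep n U = map (\<lambda>i. Gate1 i (hadamard 0)) ((2 * n + 1) # [n..<2 * n - 2]) @
    [Gate2 (2 * n - 1) (2 * n - 2) U]"

lemma coherent_prep [simp]: "coherent (prep n U)"
  by (auto simp: coherent_def prep_def)

text \<open>
  The argument of the oracle is on the wires below \<open>2 * n\<close>, its second component extended by the wire
  \<open>2 * n\<close> for the Fourier transform. Wire \<open>2 * n + 1\<close> selects between the cosets, and the value of
  the oracle is on the remaining wires. The second \<open>load\<close> erases the first component again, without
  which the two values of the selecting wire would not interfere.
\<close>

definition coset_test :: "nat \<Rightarrow> nat \<Rightarrow> complex ^ (bool \<times> bool) ^ (bool \<times> bool) \<Rightarrow> (bool \<Rightarrow> nat) \<Rightarrow> instr list" where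
  "coset_test n m U A = prep n U @ load n (2 * n + 1) A @
    [Query [0..<2 * n] [2 * n + 2..<2 * n + 2 + m]] @ load n (2 * n + 1) A @
    qft n (Suc n) @ [Gate1 (2 * n + 1) (hadamard (pi / 4))]"

lemma initial_state_conv_all: "length x = k \<Longrightarrow> initial_state k x = (if \<forall>i<k. i \<notin> {} \<longrightarrow> \<not> x ! i then 1 else 0)"
  unfolding initial_state_def by (auto simp: list_eq_iff_nth_eq)

lemma run_prep:
  assumes "2 \<le> n" "length x = k" "2 * n + 1 < k" "0 < K"
    and U: "\<And>h l. U $ (h, l) $ (False, False) =
      (if 2 * of_bool h + of_bool l < (K::nat) then 1 / sqrt K else 0)"
  shows "run F (prep n U) [] (initial_state k) x =
    (if (\<forall>i<k. i \<notin> insert (2 * n + 1) {n..<2 * n} \<longrightarrow> \<not> x ! i) \<and>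
        2 * of_bool (x ! (2 * n - 1)) + of_bool (x ! (2 * n - 2)) < K
     then 1 / sqrt (2 * real (K * 2 ^ (n - 2))) else (0 :: complex))"
proof -
  let ?ws = "(2 * n + 1) # [n..<2 * n - 2]"
  let ?s = "\<lambda>S x. \<forall>i<k. i \<notin> S \<longrightarrow> \<not> x ! i"
  let ?\<psi> = "\<lambda>x. if ?s (set ?ws) x then (1 :: complex) / sqrt 2 ^ length ?ws else 0 :: complex"
  have 1: "run F (map (\<lambda>i. Gate1 i (hadamard 0)) ?ws) [] (initial_state k) x = ?\<psi> x" if "length x = k" for x
  proof -
    have "run F (map (\<lambda>i. Gate1 i (hadamard 0)) ?ws) [] (initial_state k) x =
      run F (map (\<lambda>i. Gate1 i (hadamard 0)) ?ws) [] (\<lambda>x. if ?s {} x then 1 else 0) x"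
      using that by (intro run_cong[where k = k]) (simp_all add: initial_state_conv_all)
    also have "\<dots> = (if ?s ({} \<union> set ?ws) x then (1 :: complex) / sqrt 2 ^ length ?ws else (0 :: complex))"
      using assms that by (intro run_hadamards) auto
    finally show ?thesis
      by simp
  qed
  have "run F (prep n U) [] (initial_state k) x =
    run F [Gate2 (2 * n - 1) (2 * n - 2) U] [] ?\<psi> x"
    unfolding prep_def using 1 assms
    by (subst run_append) (auto simp: coherent_def intro: run_cong[where k = k])
  also have "\<dots> = U $ (x ! (2 * n - 1), x ! (2 * n - 2)) $ (False, False) * ?\<psi> (x[2 * n - 1 := False, 2 * n - 2 := False])"
  proof -
    have "?\<psi> (x[2 * n - 1 := b, 2 * n - 2 := c]) = 0" if "b \<or> c" for b c
    proof -
      have "x[2 * n - 1 := b, 2 * n - 2 := c] ! (2 * n - 1) = b"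
        "x[2 * n - 1 := b, 2 * n - 2 := c] ! (2 * n - 2) = c"
        using assms by (auto simp: nth_list_update)
      moreover have "2 * n - 1 \<notin> set ?ws" "2 * n - 2 \<notin> set ?ws" "2 * n - 1 < k" "2 * n - 2 < k"
        using assms by auto
      ultimately have "\<not> ?s (set ?ws) (x[2 * n - 1 := b, 2 * n - 2 := c])"
        using that by blast
      then show ?thesis
        by (simp only: if_False)
    qed
    then show ?thesis
      by (simp only: run.simps sum_UNIV_bool_bool prod.case) simp
  qed
  also have "?s (set ?ws) (x[2 * n - 1 := False, 2 * n - 2 := False]) = ?s (insert (2 * n + 1) {n..<2 * n}) x"
    using assms by (auto simp: nth_list_update)
  also have "length ?ws = n - 1"
    using assms by simp
  also have "U $ (x ! (2 * n - 1), x ! (2 * n - 2)) $ (False, False) *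
      (if ?s (insert (2 * n + 1) {n..<2 * n}) x then (1 :: complex) / sqrt 2 ^ (n - 1) else (0 :: complex)) =
    (if ?s (insert (2 * n + 1) {n..<2 * n}) x \<and> 2 * of_bool (x ! (2 * n - 1)) + of_bool (x ! (2 * n - 2)) < K
     then 1 / (sqrt K * sqrt 2 ^ (n - 1)) else (0 :: complex))"
    unfolding U by auto
  also have "sqrt K * sqrt 2 ^ (n - 1) = sqrt (2 * real (K * 2 ^ (n - 2)))"
  proof -
    have "n - 1 = Suc (n - 2)"
      using assms by simp
    then show ?thesis
      by (simp add: real_sqrt_mult real_sqrt_power)
  qed
  finally show ?thesis .
qed

lemma top_bits_less:
  assumes "2 \<le> n" "b < 2 ^ Suc n" "K \<le> 4"
  shows "\<not> bit b n \<and> 2 * of_bool (bit b (n - 1)) + of_bool (bit b (n - 2)) < (K::nat) \<longleftrightarrow> b < K * 2 ^ (n - 2)"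
proof -
  obtain k where n: "n = k + 2"
    using assms le_Suc_ex[of 2 n] by (auto simp: add.commute)
  define t where "t = b div 2 ^ k"
  have "t < 8"
    using assms(2) unfolding t_def n by (simp add: less_mult_imp_div_less)
  moreover have "b < K * 2 ^ k \<longleftrightarrow> t < K"
    unfolding t_def by (simp add: div_less_iff_less_mult)
  moreover have "bit b n = odd (t div 4)" "bit b (n - 1) = odd (t div 2)" "bit b (n - 2) = odd t"
    unfolding t_def n bit_iff_odd by (simp_all add: power_add mult.commute flip: div_mult2_eq)
  moreover have "t = 0 \<or> t = 1 \<or> t = 2 \<or> t = 3 \<or> t = 4 \<or> t = 5 \<or> t = 6 \<or> t = 7"
    using \<open>t < 8\<close> by linarith
  ultimately show ?thesis
    using assms(3) n by auto
qed

text \<open>The Fourier transform returns the bits of the frequency in reverse order.\<close>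

definition readout :: "nat \<Rightarrow> bool list \<Rightarrow> nat" where
  "readout n x = (\<Sum>i<Suc n. of_bool (x ! (n + i)) * 2 ^ (n - i))"

text \<open>Up to normalization, the amplitude with which the pair \<open>(c, b)\<close> ends up at
  control bit \<open>z\<close> and frequency \<open>y\<close>.\<close>

definition test_phase :: "nat \<Rightarrow> bool \<Rightarrow> nat \<Rightarrow> bool \<times> nat \<Rightarrow> complex" where
  "test_phase n z y = (\<lambda>(c, b).
    (if c then (if z then - 1 else 1) * cis (pi / 4) else 1) * cis (2 * pi * b * y / 2 ^ Suc n))"

lemma prod_cis_readout:
  "(\<Prod>i<Suc n. cis (2 * pi * of_bool (x ! (n + i)) * real b / 2 ^ Suc i)) = cis (2 * pi * b * readout n x / 2 ^ Suc n)"
proof -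
  have "(\<Sum>i<Suc n. 2 * pi * of_bool (x ! (n + i)) * real b / 2 ^ Suc i) =
    (\<Sum>i<Suc n. 2 * pi * b / 2 ^ Suc n * (of_bool (x ! (n + i)) * 2 ^ (n - i)))"
    by (rule sum.cong) (auto simp: power_diff field_simps less_Suc_eq_le)
  also have "\<dots> = 2 * pi * b * readout n x / 2 ^ Suc n"
    unfolding readout_def sum_distrib_left[symmetric] by simp
  finally show ?thesis
    by (simp only: prod_cis)
qed

text \<open>The final string fixes an oracle value, and only the pairs with this value contribute.
  Under the root, the preparation accounts for \<open>2 * K * 2 ^ (n - 2)\<close>, the last Hadamard
  gate for 2 and the Fourier transform for \<open>2 ^ Suc n\<close>.\<close>

lemma run_coset_test:
  assumes n: "2 \<le> n" and x: "length x = 2 * n + 2 + m" and K: "0 < K" "K \<le> 4"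
    and U: "\<And>h l. U $ (h, l) $ (False, False) =
      (if 2 * of_bool h + of_bool l < (K::nat) then 1 / sqrt K else 0)"
    and F: "\<And>s. length s = 2 * n \<Longrightarrow> length (F s) = m"
  shows "run F (coset_test n m U A) [] (initial_state (2 * n + 2 + m)) x =
    (if \<exists>i<n. x ! i then 0 else
      (\<Sum>s\<in>UNIV \<times> {..<K * 2 ^ (n - 2)}.
         if F (enc n (A (fst s)) (snd s)) = drop (2 * n + 2) x
         then test_phase n (x ! (2 * n + 1)) (readout n x) s else 0)
      / sqrt (4 * real (K * 2 ^ (n - 2)) * 2 ^ Suc n))"
proof -
  let ?B = "2 * n + 2 + m"
  let ?L = "K * 2 ^ (n - 2)"
  let ?\<kappa> = "1 / sqrt (2 * real ?L) :: complex"
  define \<psi>0 where "\<psi>0 = run F (prep n U) [] (initial_state ?B)"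
  define \<psi>3 where "\<psi>3 = run F (load n (2 * n + 1) A @
    [Query [0..<2 * n] [2 * n + 2..<2 * n + 2 + m]] @ load n (2 * n + 1) A) [] \<psi>0"
  have key: "\<psi>3 (set_bits n (Suc n) b (x[2 * n + 1 := c])) =
    (if (\<forall>i<n. \<not> x ! i) \<and> b < ?L \<and> F (enc n (A c) b) = drop (2 * n + 2) x then ?\<kappa> else 0)"
    if b: "b < 2 ^ Suc n" for b c
  proof -
    \<comment> \<open>Loading, query and erasure are involutions on the basis, so the amplitude at
      \<open>y\<close> is found by tracing back: \<open>y2\<close> before the erasure,
      \<open>y1\<close> before the query, \<open>y0\<close> before the loading.\<close>
    define y where "y = set_bits n (Suc n) b (x[2 * n + 1 := c])"
    define y2 where "y2 = load_bits n (2 * n + 1) A y"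
    define v where "v = F (map ((!) y2) [0..<2 * n])"
    define y1 where "y1 = xor_wires [2 * n + 2..<2 * n + 2 + m] v y2"
    define y0 where "y0 = load_bits n (2 * n + 1) A y1"
    have len: "length y = ?B" "length y2 = ?B" "length y1 = ?B" "length y0 = ?B" "length v = m"
      by (simp_all add: y_def y2_def y1_def y0_def v_def F x)
    have "\<psi>3 y = \<psi>0 y0"
    proof -
      have "\<psi>3 y = run F [Query [0..<2 * n] [2 * n + 2..<2 * n + 2 + m]] []
          (run F (load n (2 * n + 1) A) [] \<psi>0) y2"
        using len unfolding \<psi>3_def y2_def by (simp only: run_append coherent_load coherent_simps) (subst run_load; simp)
      also have "\<dots> = run F (load n (2 * n + 1) A) [] \<psi>0 y1"
        by (simp only: run.simps y1_def v_def)
      also have "\<dots> = \<psi>0 y0"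
        using len unfolding y0_def by (subst run_load) simp_all
      finally show ?thesis .
    qed
    have y: "y ! i = (if n \<le> i \<and> i \<le> 2 * n then bit b (i - n) else if i = 2 * n + 1 then c else x ! i)"
      if "i < ?B" for i
      using that x unfolding y_def by (auto simp: nth_set_bits nth_list_update)
    have y2: "y2 ! i = (if i < n then x ! i \<noteq> bit (A c) i else y ! i)" if "i < ?B" for i
      using that y len unfolding y2_def by (auto simp: nth_load_bits)
    have y1: "y1 ! i = (if i < 2 * n + 2 then y2 ! i else x ! i \<noteq> v ! (i - (2 * n + 2)))" if "i < ?B" for i
      using nth_xor_wires_upt[of "2 * n + 2" v y2 i] len that y y2 unfolding y1_def by auto
    have y0: "y0 ! i = (if i < n then x ! i else y1 ! i)" if "i < ?B" for i
      using that y y1 y2 len unfolding y0_def by (auto simp: nth_load_bits)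
    \<comment> \<open>The prepared state lives on strings with blank value wires; that
      \<open>y0\<close> is blank there says exactly that the query produced the value seen in
      \<open>x\<close>.\<close>
    have A: "(\<forall>i<?B. i \<notin> insert (2 * n + 1) {n..<2 * n} \<longrightarrow> \<not> y0 ! i) \<longleftrightarrow>
      (\<forall>i<n. \<not> x ! i) \<and> \<not> bit b n \<and> v = drop (2 * n + 2) x" (is "?l \<longleftrightarrow> ?r")
    proof
      assume l: ?l
      have "\<not> x ! i" if "i < n" for i
        using l y0[of i] that by auto
      moreover have "\<not> bit b n"
        using l y0[of "2 * n"] y1[of "2 * n"] y2[of "2 * n"] y[of "2 * n"] by auto
      moreover have "v ! i = x ! (2 * n + 2 + i)" if "i < m" for i
        using l y0[of "2 * n + 2 + i"] y1[of "2 * n + 2 + i"] that by auto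
      ultimately show ?r
        using x len by (auto intro!: nth_equalityI)
    next
      assume r: ?r
      then have v: "v ! (i - (2 * n + 2)) = x ! i" if "2 * n + 2 \<le> i" "i < ?B" for i
      proof -
        obtain j where "i = 2 * n + 2 + j"
          using \<open>2 * n + 2 \<le> i\<close> le_Suc_ex by blast
        then show ?thesis
          using r x that by simp
      qed
      show ?l
      proof (intro allI impI)
        fix i assume i: "i < ?B" "i \<notin> insert (2 * n + 1) {n..<2 * n}"
        then consider "i < n" | "i = 2 * n" | "2 * n + 2 \<le> i"
          by force
        then show "\<not> y0 ! i"
          using r v i by cases (auto simp: y0 y1 y2 y)
      qed
    qed
    have "2 * n - 1 < ?B" "2 * n - 2 < ?B" "2 * n - 1 - n = n - 1" "2 * n - 2 - n = n - 2"
      using n by auto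
    then have B: "y0 ! (2 * n - 1) = bit b (n - 1)" "y0 ! (2 * n - 2) = bit b (n - 2)"
      using n by (auto simp: y0 y1 y2 y)
    have C: "v = F (enc n (A c) b)" if "\<forall>i<n. \<not> x ! i"
    proof -
      have "map ((!) y2) [0..<2 * n] = enc n (A c) b"
        using that by (intro nth_equalityI) (auto simp: enc_def nth_append y2 y)
      then show ?thesis
        by (simp add: v_def)
    qed
    have "\<psi>0 y0 = (if ((\<forall>i<n. \<not> x ! i) \<and> \<not> bit b n \<and> v = drop (2 * n + 2) x) \<and>
        2 * of_bool (bit b (n - 1)) + of_bool (bit b (n - 2)) < K then ?\<kappa> else 0)"
      unfolding \<psi>0_def A[symmetric] B[symmetric] using len n K U by (intro run_prep) auto
    then show ?thesis
      using top_bits_less[OF n b K(2)] C \<open>\<psi>3 y = \<psi>0 y0\<close> unfolding y_def by auto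
  qed
  have less: "?L \<le> 2 ^ Suc n"
  proof -
    obtain k where k: "n = k + 2"
      using n le_Suc_ex[of 2 n] by (auto simp: add.commute)
    have "K * 2 ^ k \<le> 4 * 2 ^ k"
      using K by simp
    then show ?thesis
      by (simp add: k)
  qed
  let ?z = "x ! (2 * n + 1)"
  let ?X = "\<forall>i<n. \<not> x ! i"
  let ?v = "drop (2 * n + 2) x"
  let ?h = "\<lambda>c. hadamard (pi / 4) $ ?z $ c"
  let ?e = "\<lambda>b. cis (2 * pi * b * readout n x / 2 ^ Suc n)"
  have ro: "readout n (x[2 * n + 1 := c]) = readout n x" for c
    unfolding readout_def by (rule sum.cong) auto
  have "run F (coset_test n m U A) [] (initial_state ?B) x =
    run F [Gate1 (2 * n + 1) (hadamard (pi / 4))] [] (run F (qft n (Suc n)) [] \<psi>3) x"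
    unfolding coset_test_def \<psi>3_def \<psi>0_def
    by (simp only: run_append coherent_simps coherent_load coherent_qft coherent_prep)
  also have "\<dots> = (\<Sum>c\<in>UNIV. ?h c * run F (qft n (Suc n)) [] \<psi>3 (x[2 * n + 1 := c]))"
    by simp
  also have "\<dots> = (\<Sum>c\<in>UNIV. ?h c * ((1 / sqrt 2) ^ Suc n *
      (\<Sum>b<2 ^ Suc n. ?e b * (if ?X \<and> b < ?L \<and> F (enc n (A c) b) = ?v then ?\<kappa> else 0))))"
  proof (rule sum.cong[OF refl])
    fix c
    have "run F (qft n (Suc n)) [] \<psi>3 (x[2 * n + 1 := c]) = (1 / sqrt 2) ^ Suc n *
      (\<Sum>b<2 ^ Suc n. ?e b * (if ?X \<and> b < ?L \<and> F (enc n (A c) b) = ?v then ?\<kappa> else 0))"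
    proof -
      have "run F (qft n (Suc n)) [] \<psi>3 (x[2 * n + 1 := c]) = (1 / sqrt 2) ^ Suc n *
        (\<Sum>b<2 ^ Suc n. ?e b * \<psi>3 (set_bits n (Suc n) b (x[2 * n + 1 := c])))"
        using run_qft[of n "Suc n" "x[2 * n + 1 := c]" F \<psi>3] x
        unfolding prod_cis_readout ro by simp
      also have "(\<Sum>b<2 ^ Suc n. ?e b * \<psi>3 (set_bits n (Suc n) b (x[2 * n + 1 := c]))) =
        (\<Sum>b<2 ^ Suc n. ?e b * (if ?X \<and> b < ?L \<and> F (enc n (A c) b) = ?v then ?\<kappa> else 0))"
        by (intro sum.cong refl) (simp only: key lessThan_iff)
      finally show ?thesis .
    qed
    then show "?h c * run F (qft n (Suc n)) [] \<psi>3 (x[2 * n + 1 := c]) = ?h c * ((1 / sqrt 2) ^ Suc n *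
      (\<Sum>b<2 ^ Suc n. ?e b * (if ?X \<and> b < ?L \<and> F (enc n (A c) b) = ?v then ?\<kappa> else 0)))"
      by (simp only:)
  qed
  also have "\<dots> = (if ?X then \<Sum>c\<in>UNIV. \<Sum>b<?L. if F (enc n (A c) b) = ?v
      then ?h c * ((1 / sqrt 2) ^ Suc n * (?e b * ?\<kappa>)) else 0 else 0)"
  proof (cases ?X)
    case True
    have "(\<Sum>b<2 ^ Suc n. ?e b * (if ?X \<and> b < ?L \<and> F (enc n (A c) b) = ?v then ?\<kappa> else 0)) =
      (\<Sum>b<?L. ?e b * (if F (enc n (A c) b) = ?v then ?\<kappa> else 0))" for c
      using less True by (intro sum.mono_neutral_cong_right) auto
    then have "(\<Sum>c\<in>UNIV. ?h c * ((1 / sqrt 2) ^ Suc n *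
        (\<Sum>b<2 ^ Suc n. ?e b * (if ?X \<and> b < ?L \<and> F (enc n (A c) b) = ?v then ?\<kappa> else 0)))) =
      (\<Sum>c\<in>UNIV. \<Sum>b<?L. ?h c * ((1 / sqrt 2) ^ Suc n * (?e b * (if F (enc n (A c) b) = ?v then ?\<kappa> else 0))))"
      by (simp only: sum_distrib_left)
    also have "\<dots> = (\<Sum>c\<in>UNIV. \<Sum>b<?L. if F (enc n (A c) b) = ?v
      then ?h c * ((1 / sqrt 2) ^ Suc n * (?e b * ?\<kappa>)) else 0)"
      by (intro sum.cong refl) simp
    finally show ?thesis
      unfolding if_P[OF True] .
  next
    case False
    have "(\<Sum>b<2 ^ Suc n. ?e b * (if ?X \<and> b < ?L \<and> F (enc n (A c) b) = ?v then ?\<kappa> else 0)) = 0" for c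
      using False by (intro sum.neutral) auto
    then show ?thesis
      using False by (simp only: if_False mult_zero_right sum.neutral_const)
  qed
  also have "\<dots> = (if ?X then \<Sum>c\<in>UNIV. \<Sum>b<?L. (if F (enc n (A c) b) = ?v
      then test_phase n ?z (readout n x) (c, b) else 0) / sqrt (4 * real ?L * 2 ^ Suc n) else 0)"
  proof -
    have s: "sqrt (4 * real ?L * 2 ^ Suc n) = sqrt 2 * sqrt 2 ^ Suc n * sqrt (2 * real ?L)"
    proof -
      have "4 * real ?L * 2 ^ Suc n = 2 * 2 ^ Suc n * (2 * real ?L)"
        by simp
      then show ?thesis
        by (simp only: real_sqrt_mult real_sqrt_power)
    qed
    have "?h c * ((1 / sqrt 2) ^ Suc n * (?e b * ?\<kappa>)) =
      test_phase n ?z (readout n x) (c, b) / sqrt (4 * real ?L * 2 ^ Suc n)" for c b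
      unfolding s by (simp add: hadamard_def test_phase_def power_divide power_one_over)
    then have "(if F (enc n (A c) b) = ?v then ?h c * ((1 / sqrt 2) ^ Suc n * (?e b * ?\<kappa>)) else 0) =
      (if F (enc n (A c) b) = ?v
      then test_phase n ?z (readout n x) (c, b) else 0) / sqrt (4 * real ?L * 2 ^ Suc n)" for c b
      by simp
    then show ?thesis
      by (simp only:)
  qed
  finally show ?thesis
    by (auto simp: sum.cartesian_product sum_divide_distrib case_prod_unfold cong: if_cong)
qed

section \<open>Marginal distribution of control bit and frequency\<close>

lemma readout_eq_horner_sum:
  "readout n x = horner_sum of_bool 2 (map (\<lambda>k. x ! (n + (n - k))) [0..<Suc n])"
proof -
  have "readout n x = (\<Sum>i<Suc n. (\<lambda>k. of_bool (x ! (n + (n - k))) * 2 ^ k) (Suc n - Suc i))"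
    unfolding readout_def by (rule sum.cong) auto
  also have "\<dots> = (\<Sum>k<Suc n. of_bool (x ! (n + (n - k))) * 2 ^ k)"
    by (rule sum.nat_diff_reindex)
  finally show ?thesis
    by (simp add: horner_sum_eq_sum atLeast0LessThan nth_append del: upt_Suc sum.lessThan_Suc)
qed

lemma readout_less: "readout n x < 2 ^ Suc n"
  unfolding readout_eq_horner_sum
  using horner_sum_of_bool_2_less[of "map (\<lambda>k. x ! (n + (n - k))) [0..<Suc n]", where 'a = nat] by simp

lemma bit_readout: "k \<le> n \<Longrightarrow> bit (readout n x) k = x ! (n + (n - k))"
  unfolding readout_eq_horner_sum by (simp add: bit_horner_sum_bit_iff del: upt_Suc)

lemma readout_eq_iff:
  assumes "y < 2 ^ Suc n"
  shows "readout n x = y \<longleftrightarrow> (\<forall>i\<le>n. x ! (n + i) = bit y (n - i))"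
proof
  assume "readout n x = y"
  then show "\<forall>i\<le>n. x ! (n + i) = bit y (n - i)"
    using bit_readout[of "n - i" n x for i] by auto
next
  assume r: "\<forall>i\<le>n. x ! (n + i) = bit y (n - i)"
  have "bit (readout n x) k = bit y k" for k
  proof (cases "k \<le> n")
    case True
    then show ?thesis
      using r[rule_format, of "n - k"] by (simp add: bit_readout)
  next
    case False
    then have "k = Suc n + (k - Suc n)"
      by simp
    then have "bit a k = bit (a div 2 ^ Suc n) (k - Suc n)" for a :: nat
      by (metis bit_drop_bit_eq drop_bit_eq_div comp_apply)
    then show ?thesis
      using readout_less[of n x] assms by simp
  qed
  then show "readout n x = y"
    by (simp add: bit_eq_iff)
qed

text \<open>Summing out the value register: the square expands into pairs \<open>s\<close>,
  \<open>t\<close>, and a pair survives exactly when both have the same value. The values themselves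
  disappear.\<close>

lemma sum_cmod_square_fibres:
  fixes e :: "'s \<Rightarrow> complex"
  assumes "finite S" "finite V" "f ` S \<subseteq> V"
  shows "(\<Sum>v\<in>V. (cmod (\<Sum>s\<in>S. if f s = v then e s else 0))\<^sup>2) =
    (\<Sum>s\<in>S. \<Sum>t\<in>S. if f s = f t then Re (e s * cnj (e t)) else 0)"
proof -
  have "(\<Sum>v\<in>V. (cmod (\<Sum>s\<in>S. if f s = v then e s else 0))\<^sup>2) =
    (\<Sum>v\<in>V. Re ((\<Sum>s\<in>S. if f s = v then e s else 0) * cnj (\<Sum>s\<in>S. if f s = v then e s else 0)))"
    by (rule sum.cong[OF refl]) (metis Re_complex_of_real complex_norm_square)
  also have "\<dots> = (\<Sum>v\<in>V. \<Sum>s\<in>S. \<Sum>t\<in>S. if v = f s then if f s = f t then Re (e s * cnj (e t)) else 0 else 0)"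
    unfolding cnj_sum sum_product Re_sum by (intro sum.cong refl) auto
  also have "\<dots> = (\<Sum>s\<in>S. \<Sum>t\<in>S. \<Sum>v\<in>V. if v = f s then if f s = f t then Re (e s * cnj (e t)) else 0 else 0)"
    by (subst sum.swap, rule sum.cong[OF refl], subst sum.swap, rule refl)
  also have "\<dots> = (\<Sum>s\<in>S. \<Sum>t\<in>S. if f s = f t then Re (e s * cnj (e t)) else 0)"
    using assms by (intro sum.cong refl) (subst sum.delta, auto)
  finally show ?thesis .
qed

text \<open>The oracle enters only through the relation \<open>coll\<close>, so this makes sense for
  a merely hypothetical subgroup.\<close>

definition test_dist ::
  "nat \<Rightarrow> nat \<Rightarrow> (bool \<times> nat \<Rightarrow> bool \<times> nat \<Rightarrow> bool) \<Rightarrow> bool \<times> nat \<Rightarrow> real" where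
  "test_dist n L coll = (\<lambda>(z, y).
    (\<Sum>s\<in>UNIV \<times> {..<L}. \<Sum>t\<in>UNIV \<times> {..<L}.
      if coll s t then Re (test_phase n z y s * cnj (test_phase n z y t)) else 0)
    / (4 * real L * 2 ^ Suc n))"

definition test_result :: "nat \<Rightarrow> bool list \<Rightarrow> bool \<times> nat" where
  "test_result n x = (x ! (2 * n + 1), readout n x)"

lemma finite_bool_lists: "finite {x :: bool list. length x = k}"
  using finite_lists_length_eq[of "UNIV :: bool set" k] by simp

lemma coset_test_marginal:
  assumes n: "2 \<le> n" and K: "0 < K" "K \<le> 4"
    and U: "\<And>h l. U $ (h, l) $ (False, False) =
      (if 2 * of_bool h + of_bool l < (K::nat) then 1 / sqrt K else 0)"
    and F: "\<And>s. length s = 2 * n \<Longrightarrow> length (F s) = m"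
    and r: "snd r < 2 ^ Suc n"
  shows "(\<Sum>x | length x = 2 * n + 2 + m \<and> test_result n x = r.
      (cmod (run F (coset_test n m U A) [] (initial_state (2 * n + 2 + m)) x))\<^sup>2) =
    test_dist n (K * 2 ^ (n - 2))
      (\<lambda>s t. F (enc n (A (fst s)) (snd s)) = F (enc n (A (fst t)) (snd t))) r"
proof -
  obtain z y where [simp]: "r = (z, y)" and y: "y < 2 ^ Suc n"
    using r by (cases r) auto
  let ?B = "2 * n + 2 + m"
  let ?L = "K * 2 ^ (n - 2)"
  let ?D = "4 * real ?L * 2 ^ Suc n"
  let ?f = "\<lambda>s. F (enc n (A (fst s)) (snd s))"
  let ?P = "\<lambda>x. (cmod (run F (coset_test n m U A) [] (initial_state ?B) x))\<^sup>2"
  let ?Q = "\<lambda>v. (cmod (\<Sum>s\<in>UNIV \<times> {..<?L}. if ?f s = v then test_phase n z y s else 0))\<^sup>2 / ?D"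
  \<comment> \<open>The only string with blank first register, result \<open>r\<close> and value
    \<open>v\<close>; the frequency bits stand in reverse order.\<close>
  let ?w = "\<lambda>v. replicate n False @ map (\<lambda>i. bit y (n - i)) [0..<Suc n] @ [z] @ v"
  have P: "?P x = (if \<exists>i<n. x ! i then 0 else ?Q (drop (2 * n + 2) x))"
    if "length x = ?B" "test_result n x = r" for x
  proof -
    have *: "x ! (2 * n + 1) = z" "readout n x = y"
      using that(2) by (simp_all add: test_result_def)
    have D: "0 \<le> ?D"
      by simp
    have "run F (coset_test n m U A) [] (initial_state ?B) x = (if \<exists>i<n. x ! i then 0 else
      (\<Sum>s\<in>UNIV \<times> {..<?L}. if ?f s = drop (2 * n + 2) x then test_phase n z y s else 0) / sqrt ?D)"
      unfolding *[symmetric] using n that K U F by (intro run_coset_test) auto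
    then show ?thesis
      using real_sqrt_pow2[OF D] by (simp only:) (auto simp: norm_divide power_divide)
  qed
  have w: "x = ?w (drop (2 * n + 2) x)"
    if "length x = ?B" "test_result n x = r" "\<forall>i<n. \<not> x ! i" for x
  proof (rule nth_equalityI)
    fix i assume i: "i < length x"
    have x: "x ! (n + i) = bit y (n - i)" if "i \<le> n" for i
      using readout_eq_iff[OF y, of x] that \<open>test_result n x = r\<close> by (simp add: test_result_def)
    consider "i < n" | "n \<le> i" "i \<le> 2 * n" | "i = 2 * n + 1" | "2 * n + 2 \<le> i"
      by linarith
    then show "x ! i = ?w (drop (2 * n + 2) x) ! i"
    proof cases
      case 2
      then have "i - n < Suc n"
        by simp
      with 2 show ?thesis
        using x[of "i - n"] by (simp add: nth_append del: upt_Suc)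
    next
      case 4
      then obtain j where "i = 2 * n + 2 + j"
        using le_Suc_ex by blast
      then show ?thesis
        using that(1) i by (simp add: nth_append del: upt_Suc)
    qed (use that i in \<open>auto simp: nth_append test_result_def simp del: upt_Suc\<close>)
  qed (use that in simp)
  have res: "test_result n (?w v) = r" for v
    using readout_eq_iff[OF y, of "?w v"]
    by (auto simp: test_result_def nth_append simp del: upt_Suc)
  have "(\<Sum>x | length x = ?B \<and> test_result n x = r. ?P x) =
    (\<Sum>x | length x = ?B \<and> test_result n x = r \<and> (\<forall>i<n. \<not> x ! i). ?Q (drop (2 * n + 2) x))"
    by (rule sum.mono_neutral_cong_right)
      (use finite_bool_lists[of ?B] P in \<open>auto simp: conj_ac elim: rev_finite_subset\<close>)
  also have "\<dots> = (\<Sum>v | length v = m. ?Q v)"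
    by (rule sum.reindex_bij_witness[of _ ?w "drop (2 * n + 2)"])
      (use w res in \<open>auto simp: nth_append simp del: upt_Suc\<close>)
  also have "\<dots> = test_dist n ?L (\<lambda>s t. ?f s = ?f t) r"
    unfolding sum_divide_distrib[symmetric]
    by (subst sum_cmod_square_fibres)
      (use finite_bool_lists[of m] in \<open>auto simp: test_dist_def F enc_def\<close>)
  finally show ?thesis .
qed


section \<open>Distinguishing the outcome distributions of the coset test\<close>

lemma sum_cis_roots:
  fixes k :: int
  assumes "0 < N"
  shows "(\<Sum>y<N. cis (2 * pi * real y * k / N)) = (if int N dvd k then N else 0)"
proof -
  let ?w = "cis (2 * pi * k / N)"
  have pow: "cis (2 * pi * real y * k / N) = ?w ^ y" for y
    by (simp add: Complex.DeMoivre mult_ac)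
  have w1: "?w = 1 \<longleftrightarrow> int N dvd k"
  proof
    assume "?w = 1"
    then have "cos (2 * pi * k / N) = 1"
      by (metis cis.sel(1) one_complex.sel(1))
    then obtain j :: int where "2 * pi * k / N = of_int j * 2 * pi"
      by (auto simp: cos_one_2pi_int)
    then have "real_of_int k = of_int (j * int N)"
      using assms by (simp add: field_simps)
    then have "k = j * int N"
      by (simp only: of_int_eq_iff)
    then show "int N dvd k"
      by simp
  next
    assume "int N dvd k"
    then obtain j where "k = int N * j"
      by auto
    then have "2 * pi * k / N = 2 * pi * of_int j"
      using assms by simp
    then show "?w = 1"
      by simp
  qed
  have "?w ^ N = cis (2 * pi * of_int k)"
    using assms by (simp add: Complex.DeMoivre)
  then have wN: "?w ^ N = 1"
    by simp
  show ?thesis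
  proof (cases "int N dvd k")
    case True
    then show ?thesis
      using w1 by (simp add: pow)
  next
    case False
    then show ?thesis
      using w1 wN geometric_sum[of ?w N] by (simp add: pow)
  qed
qed

lemma sum_cos_roots:
  "0 < N \<Longrightarrow> (\<Sum>y<N. cos (2 * pi * real y * of_int k / N)) = (if int N dvd k then N else 0)"
  using arg_cong[OF sum_cis_roots[of N k], of Re] by (simp split: if_splits)

lemma sum_sin_roots:
  "0 < N \<Longrightarrow> (\<Sum>y<N. sin (2 * pi * real y * of_int k / N)) = 0"
  using arg_cong[OF sum_cis_roots[of N k], of Im] by (simp split: if_splits)

definition wave :: "nat \<Rightarrow> nat \<Rightarrow> int \<Rightarrow> real" where
  "wave N y D = cos (2 * pi * real y * of_int D / N + pi / 4)"

text \<open>The offset \<open>pi / 4\<close> makes frequencies of opposite sign orthogonal, too.\<close>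

lemma wave_orthogonal:
  assumes "0 < N" "\<bar>D - D'\<bar> < int N"
  shows "(\<Sum>y<N. wave N y D * wave N y D') = (if D = D' then N / 2 else 0)"
proof -
  have "wave N y D * wave N y D' =
    (cos (2 * pi * real y * of_int (D - D') / N) - sin (2 * pi * real y * of_int (D + D') / N)) / 2" for y
  proof -
    have "2 * pi * real y * of_int (D - D') / N = 2 * pi * real y * of_int D / N - 2 * pi * real y * of_int D' / N"
      "2 * pi * real y * of_int (D + D') / N = 2 * pi * real y * of_int D / N + 2 * pi * real y * of_int D' / N"
      by (simp_all add: algebra_simps diff_divide_distrib add_divide_distrib)
    \<comment> \<open>The two offsets add up to a quarter turn, which makes the cosine of
      \<open>a + b\<close> a sine; sines sum to 0 over all \<open>y\<close>, even at frequency
      0.\<close>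
    moreover have "cos (a + pi / 4) * cos (b + pi / 4) = (cos (a - b) - sin (a + b)) / 2" for a b :: real
    proof -
      have "cos (a + pi / 4) * cos (b + pi / 4) =
        (cos ((a + pi / 4) - (b + pi / 4)) + cos ((a + pi / 4) + (b + pi / 4))) / 2"
        by (rule cos_times_cos)
      moreover have "(a + pi / 4) + (b + pi / 4) = (a + b) + pi / 2" "(a + pi / 4) - (b + pi / 4) = a - b"
        by simp_all
      ultimately show ?thesis
        by (simp add: cos_add)
    qed
    ultimately show ?thesis
      unfolding wave_def by (simp only:)
  qed
  then have "(\<Sum>y<N. wave N y D * wave N y D') =
    ((\<Sum>y<N. cos (2 * pi * real y * of_int (D - D') / N)) - (\<Sum>y<N. sin (2 * pi * real y * of_int (D + D') / N))) / 2"
    by (simp only: sum_subtractf flip: sum_divide_distrib)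
  moreover have "int N dvd D - D' \<longleftrightarrow> D = D'"
    using assms zdvd_imp_le[of "int N" "D - D'"] zdvd_imp_le[of "int N" "D' - D"] dvd_diff_commute[of "int N" D D']
    by (cases D D' rule: linorder_cases) auto
  ultimately show ?thesis
    using assms by (simp only: sum_cos_roots sum_sin_roots) simp
qed

text \<open>
  \<open>X\<close> is the fibre of the hidden subgroup over \<open>\<alpha>\<close>, and \<open>full\<close> says that it contains all translations.
  The pairs \<open>(False, b)\<close> and \<open>(True, b)\<close> stand for the group elements \<open>(1, b)\<close> and \<open>(\<alpha>, b)\<close>.
\<close>

definition coset_collision :: "nat \<Rightarrow> bool \<Rightarrow> nat set \<Rightarrow> bool \<times> nat \<Rightarrow> bool \<times> nat \<Rightarrow> bool" where
  "coset_collision p full X = (\<lambda>(c, b) (c', b').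
    if c = c' then b = b' \<or> full
    else if c' then \<exists>s\<in>X. b' = (b + s) mod p
    else \<exists>s\<in>X. b = (b' + s) mod p)"

definition shifted_pairs :: "nat \<Rightarrow> nat \<Rightarrow> nat set \<Rightarrow> (nat \<times> nat) set" where
  "shifted_pairs p L X = {(b, b'). b < L \<and> b' < L \<and> (\<exists>s\<in>X. b' = (b + s) mod p)}"

definition pair_wave :: "nat \<Rightarrow> nat \<Rightarrow> nat \<Rightarrow> nat set \<Rightarrow> nat \<Rightarrow> real" where
  "pair_wave N p L X y = (\<Sum>(b, b')\<in>shifted_pairs p L X. wave N y (int b' - int b))"

definition same_wave :: "nat \<Rightarrow> nat \<Rightarrow> bool \<Rightarrow> nat \<Rightarrow> real" where
  "same_wave N L full y = (\<Sum>b<L. \<Sum>b'<L.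
    if b = b' \<or> full then cos (2 * pi * real y * of_int (int b - int b') / N) else 0)"

lemma shifted_pairs_finite: "finite (shifted_pairs p L X)"
  by (rule finite_subset[of _ "{..<L} \<times> {..<L}"]) (auto simp: shifted_pairs_def)

lemma pair_wave_alt:
  "pair_wave N p L X y = (\<Sum>b<L. \<Sum>b'<L.
    if \<exists>s\<in>X. b' = (b + s) mod p then wave N y (int b' - int b) else 0)"
proof -
  have "pair_wave N p L X y = (\<Sum>r\<in>{..<L} \<times> {..<L}.
      if \<exists>s\<in>X. snd r = (fst r + s) mod p then wave N y (int (snd r) - int (fst r)) else 0)"
    unfolding pair_wave_def
    by (rule sum.mono_neutral_cong_left) (auto simp: shifted_pairs_def)
  then show ?thesis
    by (simp add: sum.cartesian_product case_prod_unfold cong: if_cong)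
qed

text \<open>The pairs \<open>s\<close>, \<open>t\<close> split by their control bits. Equal bits
  give \<open>same_wave\<close> twice. The two kinds of opposite bits are complex conjugates of each
  other and give \<open>pair_wave\<close> twice, with the sign of the last Hadamard gate.\<close>

lemma test_dist_formula:
  "test_dist n L (coset_collision p full X) (z, y) =
    (2 * same_wave (2 ^ Suc n) L full y + 2 * (if z then - 1 else 1) * pair_wave (2 ^ Suc n) p L X y)
    / (4 * real L * 2 ^ Suc n)"
proof -
  let ?N = "2 ^ Suc n :: nat"
  let ?\<sigma> = "if z then - 1 else 1 :: real"
  let ?R = "\<lambda>s t. Re (test_phase n z y s * cnj (test_phase n z y t))"
  have ph: "test_phase n z y (c, b) = (if c then of_real ?\<sigma> * cis (pi / 4) else 1) * cis (2 * pi * real y * b / ?N)" for c b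
    by (simp add: test_phase_def mult_ac)
  have d: "2 * pi * real y * of_int (int b - int b') / ?N = 2 * pi * real y * b / ?N - 2 * pi * real y * b' / ?N" for b b'
    by (simp add: algebra_simps diff_divide_distrib)
  have same: "?R (c, b) (c, b') = cos (2 * pi * real y * of_int (int b - int b') / ?N)" for c b b'
  proof -
    have "test_phase n z y (c, b) * cnj (test_phase n z y (c, b')) =
      (if c then of_real (?\<sigma> * ?\<sigma>) * (cis (pi / 4) * cis (- (pi / 4))) else 1) *
      (cis (2 * pi * real y * b / ?N) * cis (- (2 * pi * real y * b' / ?N)))"
      unfolding ph by (simp add: cis_cnj del: cis_cnj_mult)
    also have "\<dots> = cis (2 * pi * real y * of_int (int b - int b') / ?N)"
      unfolding d cis_mult by simp
    finally show ?thesis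
      by (simp only: cis.sel)
  qed
  have up: "?R (False, b) (True, b') = ?\<sigma> * wave ?N y (int b' - int b)" for b b'
  proof -
    have "test_phase n z y (False, b) * cnj (test_phase n z y (True, b')) =
      of_real ?\<sigma> * (cis (2 * pi * real y * b / ?N) * cis (- (pi / 4)) * cis (- (2 * pi * real y * b' / ?N)))"
      unfolding ph by (simp add: cis_cnj)
    also have "\<dots> = of_real ?\<sigma> * cis (- (2 * pi * real y * of_int (int b' - int b) / ?N + pi / 4))"
      unfolding d cis_mult by (simp add: algebra_simps)
    moreover have "Re (of_real r * cis (- a)) = r * cos a" for r a
      by simp
    ultimately show ?thesis
      unfolding wave_def by (simp only:)
  qed
  have down: "?R (True, b) (False, b') = ?\<sigma> * wave ?N y (int b - int b')" for b b'
  proof -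
    have "?R (True, b) (False, b') = Re (cnj (test_phase n z y (False, b') * cnj (test_phase n z y (True, b))))"
      by (simp add: mult.commute)
    also have "\<dots> = ?R (False, b') (True, b)"
      by (simp only: cnj.sel)
    finally show ?thesis
      by (simp only: up)
  qed
  have "(\<Sum>s\<in>UNIV \<times> {..<L}. \<Sum>t\<in>UNIV \<times> {..<L}. if coset_collision p full X s t then ?R s t else 0) =
    (\<Sum>c\<in>UNIV. \<Sum>c'\<in>UNIV. \<Sum>b<L. \<Sum>b'<L. if coset_collision p full X (c, b) (c', b') then ?R (c, b) (c', b') else 0)"
    by (simp only: sum.cartesian_product' sum.swap[of _ UNIV "{..<L}"])
  also have "\<dots> = (\<Sum>b<L. \<Sum>b'<L. if b = b' \<or> full then cos (2 * pi * real y * of_int (int b - int b') / ?N) else 0) +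
     (\<Sum>b<L. \<Sum>b'<L. if \<exists>s\<in>X. b' = (b + s) mod p then ?\<sigma> * wave ?N y (int b' - int b) else 0) +
     ((\<Sum>b<L. \<Sum>b'<L. if \<exists>s\<in>X. b = (b' + s) mod p then ?\<sigma> * wave ?N y (int b - int b') else 0) +
     (\<Sum>b<L. \<Sum>b'<L. if b = b' \<or> full then cos (2 * pi * real y * of_int (int b - int b') / ?N) else 0))"
    unfolding sum_UNIV_bool same up down by (simp only: coset_collision_def prod.case refl if_True simp_thms if_False)
  also have "(\<Sum>b<L. \<Sum>b'<L. if \<exists>s\<in>X. b = (b' + s) mod p then ?\<sigma> * wave ?N y (int b - int b') else 0) =
    (\<Sum>b<L. \<Sum>b'<L. if \<exists>s\<in>X. b' = (b + s) mod p then ?\<sigma> * wave ?N y (int b' - int b) else 0)"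
    by (rule sum.swap)
  also have "(\<Sum>b<L. \<Sum>b'<L. if \<exists>s\<in>X. b' = (b + s) mod p then ?\<sigma> * wave ?N y (int b' - int b) else 0) =
    ?\<sigma> * pair_wave ?N p L X y"
    unfolding pair_wave_alt sum_distrib_left by (intro sum.cong refl) simp
  also have "(\<Sum>b<L. \<Sum>b'<L. if b = b' \<or> full then cos (2 * pi * real y * of_int (int b - int b') / ?N) else 0) =
    same_wave ?N L full y"
    by (simp only: same_wave_def)
  finally show ?thesis
    by (simp add: test_dist_def)
qed

text \<open>The double sum may have terms of either sign; grouped by the value of \<open>f\<close>
  it is a sum of squared moduli.\<close>

lemma test_dist_nonneg: "0 \<le> test_dist n L (\<lambda>s t. f s = f t) r"
proof -
  obtain z y where r: "r = (z, y)"
    by (cases r)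
  let ?S = "UNIV \<times> {..<L} :: (bool \<times> nat) set"
  have "0 \<le> (\<Sum>v\<in>f ` ?S. (cmod (\<Sum>s\<in>?S. if f s = v then test_phase n z y s else 0))\<^sup>2)"
    by (intro sum_nonneg) simp
  then show ?thesis
    by (subst (asm) sum_cmod_square_fibres) (simp_all add: test_dist_def r)
qed

lemma test_dist_sum_over_bit:
  assumes "0 < L"
  shows "(\<Sum>z\<in>UNIV. test_dist n L (coset_collision p full X) (z, y)) =
    same_wave (2 ^ Suc n) L full y / (real L * 2 ^ Suc n)"
  using assms by (simp add: sum_UNIV_bool test_dist_formula field_simps)

text \<open>Summing over \<open>z\<close> cancels the \<open>pair_wave\<close> terms. Summing over
  \<open>y\<close> then kills the pairs \<open>b \<noteq> b'\<close>, which stay distinct modulo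
  \<open>2 ^ Suc n\<close>.\<close>

lemma test_dist_total:
  assumes "0 < L" "L \<le> 2 ^ Suc n"
  shows "(\<Sum>r\<in>UNIV \<times> {..<2 ^ Suc n}. test_dist n L (coset_collision p full X) r) = 1"
proof -
  let ?N = "2 ^ Suc n :: nat"
  have LN: "int L \<le> int ?N"
    using assms(2) by (simp only: of_nat_le_iff)
  have dvd: "int ?N dvd int b - int b' \<longleftrightarrow> b = b'" if "b < L" "b' < L" for b b'
    using that LN zdvd_imp_le[of "int ?N" "int b - int b'"] zdvd_imp_le[of "int ?N" "int b' - int b"]
      dvd_diff_commute[of "int ?N" "int b" "int b'"]
    by (cases b b' rule: linorder_cases) auto
  have "(\<Sum>y<?N. same_wave ?N L full y) = (\<Sum>b<L. \<Sum>b'<L. \<Sum>y<?N.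
      if b = b' \<or> full then cos (2 * pi * real y * of_int (int b - int b') / ?N) else 0)"
    unfolding same_wave_def by (subst sum.swap, rule sum.cong[OF refl], rule sum.swap)
  also have "\<dots> = (\<Sum>b<L. \<Sum>b'<L. if b' = b then real ?N else 0)"
  proof (intro sum.cong refl)
    fix b b' assume b: "b \<in> {..<L}" "b' \<in> {..<L}"
    have "0 < ?N"
      by simp
    then show "(\<Sum>y<?N. if b = b' \<or> full then cos (2 * pi * real y * of_int (int b - int b') / ?N) else 0) =
        (if b' = b then real ?N else 0)"
      using sum_cos_roots[of ?N "int b - int b'"] dvd[of b b'] b by (cases "b = b' \<or> full") (simp_all only: if_True if_False sum.neutral_const, auto)
  qed
  also have "\<dots> = real L * ?N"
    by simp
  finally have total: "(\<Sum>y<?N. same_wave ?N L full y) = real L * ?N" .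
  have "(\<Sum>r\<in>UNIV \<times> {..<?N}. test_dist n L (coset_collision p full X) r) =
    (\<Sum>y<?N. \<Sum>z\<in>UNIV. test_dist n L (coset_collision p full X) (z, y))"
    by (subst sum.swap) (simp only: sum.cartesian_product')
  also have "\<dots> = (\<Sum>y<?N. same_wave ?N L full y) / (real L * ?N)"
    unfolding test_dist_sum_over_bit[OF assms(1)] sum_divide_distrib by simp
  finally show ?thesis
    using assms by (simp only: total) simp
qed

text \<open>With \<open>u = sqrt a\<close> and \<open>v = sqrt b\<close>, the mean exceeds
  \<open>u * v\<close> by \<open>(u - v) ^ 2 / 2\<close>, while
  \<open>(a - b) ^ 2 = (u - v) ^ 2 * (u + v) ^ 2\<close> and
  \<open>u + v \<le> 2 * sqrt M\<close>.\<close>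

lemma sqrt_mult_le_mean:
  fixes a b M :: real
  assumes "0 \<le> a" "a \<le> M" "0 \<le> b" "b \<le> M" "0 < M"
  shows "sqrt (a * b) \<le> (a + b) / 2 - (a - b)\<^sup>2 / (8 * M)"
proof -
  define u v where "u = sqrt a" and "v = sqrt b"
  have uv: "0 \<le> u" "0 \<le> v" "u \<le> sqrt M" "v \<le> sqrt M" "a = u\<^sup>2" "b = v\<^sup>2"
    using assms by (auto simp: u_def v_def)
  have "(u + v)\<^sup>2 \<le> (2 * sqrt M)\<^sup>2"
    using uv by (intro power_mono) auto
  then have "(u + v)\<^sup>2 \<le> 4 * M"
    using assms by (simp add: power_mult_distrib)
  then have *: "(u - v)\<^sup>2 * (u + v)\<^sup>2 \<le> (u - v)\<^sup>2 * (4 * M)"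
    by (intro mult_left_mono) auto
  define w where "w = (u\<^sup>2 - v\<^sup>2)\<^sup>2 / (8 * M)"
  have "w \<le> (u - v)\<^sup>2 / 2"
    unfolding w_def using *  assms by (simp add: field_simps flip: power_mult_distrib) (simp add: power2_eq_square algebra_simps)
  moreover have "sqrt (a * b) = u * v"
    by (simp add: u_def v_def real_sqrt_mult)
  moreover have "(u - v)\<^sup>2 = a + b - 2 * (u * v)"
    by (simp add: uv(5,6) power2_diff)
  ultimately have "sqrt (a * b) \<le> (a + b) / 2 - w"
    by (simp add: field_simps)
  then show ?thesis
    by (simp add: w_def uv(5,6))
qed

text \<open>The bound \<open>M\<close> lets a small squared distance count: for distributions spread
  over \<open>N\<close> points both can be of order \<open>1 / N\<close>, and the quotient stays
  constant.\<close>

lemma sum_sqrt_mult_le: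
  fixes P Q :: "'r \<Rightarrow> real"
  assumes "0 < M" "(\<Sum>r\<in>A. P r) = 1" "(\<Sum>r\<in>A. Q r) = 1"
    and "\<And>r. r \<in> A \<Longrightarrow> 0 \<le> P r \<and> P r \<le> M" "\<And>r. r \<in> A \<Longrightarrow> 0 \<le> Q r \<and> Q r \<le> M"
  shows "(\<Sum>r\<in>A. sqrt (P r * Q r)) \<le> 1 - (\<Sum>r\<in>A. (P r - Q r)\<^sup>2) / (8 * M)"
proof -
  have "(\<Sum>r\<in>A. sqrt (P r * Q r)) \<le> (\<Sum>r\<in>A. (P r + Q r) / 2 - (P r - Q r)\<^sup>2 / (8 * M))"
    using assms by (intro sum_mono sqrt_mult_le_mean) auto
  also have "\<dots> = ((\<Sum>r\<in>A. P r) + (\<Sum>r\<in>A. Q r)) / 2 - (\<Sum>r\<in>A. (P r - Q r)\<^sup>2) / (8 * M)"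
    by (simp add: sum_subtractf sum.distrib flip: sum_divide_distrib)
  finally show ?thesis
    using assms by simp
qed

text \<open>The constant is \<open>16 ^ 2 * 8 = 2048\<close>: a single outcome contributes
  \<open>(1 / 16) ^ 2\<close>, and probabilities are at most 1.\<close>

lemma sum_sqrt_mult_le_of_ge:
  fixes P Q :: "'r \<Rightarrow> real"
  assumes "finite A" "(\<Sum>r\<in>A. P r) = 1" "(\<Sum>r\<in>A. Q r) = 1"
    and "\<And>r. r \<in> A \<Longrightarrow> 0 \<le> P r" "\<And>r. r \<in> A \<Longrightarrow> 0 \<le> Q r"
    and "r \<in> A" "1 / 16 \<le> \<bar>P r - Q r\<bar>"
  shows "(\<Sum>r\<in>A. sqrt (P r * Q r)) \<le> 1 - 1 / 2048"
proof -
  have "P r \<le> 1" "Q r \<le> 1" if "r \<in> A" for r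
    using that assms member_le_sum[of r A P] member_le_sum[of r A Q] by auto
  then have "(\<Sum>r\<in>A. sqrt (P r * Q r)) \<le> 1 - (\<Sum>r\<in>A. (P r - Q r)\<^sup>2) / (8 * 1)"
    using assms by (intro sum_sqrt_mult_le) auto
  moreover have "(P r - Q r)\<^sup>2 \<le> (\<Sum>r\<in>A. (P r - Q r)\<^sup>2)"
    using assms by (intro member_le_sum) auto
  moreover have "(1 / 16)\<^sup>2 \<le> (P r - Q r)\<^sup>2"
    using power_mono[OF assms(7), of 2] by simp
  ultimately show ?thesis
    by (simp add: power2_eq_square)
qed

text \<open>The shift by \<open>s\<close> occurs as difference \<open>s\<close> on
  \<open>L - s\<close> pairs and as \<open>s - p\<close> on \<open>L - (p - s)\<close> pairs. If
  \<open>s > 3 * L / 4\<close>, then \<open>p < 3 * L / 2\<close> gives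
  \<open>p - s < 3 * L / 4\<close>, so one of the two has at least \<open>L / 4\<close>
  pairs.\<close>

lemma card_shifted_pairs_difference:
  assumes "s < p" "L \<le> p" "p < 2 * L" "2 * p < 3 * L"
  obtains D where "\<bar>D\<bar> < int p" "D mod int p = int s"
    "L \<le> 4 * card {(b, b') \<in> shifted_pairs p L {s}. int b' - int b = D}"
proof (cases "4 * s \<le> 3 * L")
  case True
  have "s \<le> L"
    using True by simp
  have "(\<lambda>b. (b, b + s)) ` {..<L - s} \<subseteq> {(b, b') \<in> shifted_pairs p L {s}. int b' - int b = int s}"
    using assms by (auto simp: shifted_pairs_def)
  then have "card ((\<lambda>b. (b, b + s)) ` {..<L - s}) \<le> card {(b, b') \<in> shifted_pairs p L {s}. int b' - int b = int s}"
    by (rule card_mono[rotated]) (rule finite_subset[OF _ shifted_pairs_finite[of p L "{s}"]], auto)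
  moreover have "card ((\<lambda>b. (b, b + s)) ` {..<L - s}) = L - s"
    by (subst card_image) (auto simp: inj_on_def)
  ultimately show ?thesis
    using assms True \<open>s \<le> L\<close> by (intro that[of "int s"]) auto
next
  case False
  let ?t = "p - s"
  have "(\<lambda>b. (b + ?t, b)) ` {..<L - ?t} \<subseteq> {(b, b') \<in> shifted_pairs p L {s}. int b' - int b = int s - int p}"
    using assms by (auto simp: shifted_pairs_def)
  then have "card ((\<lambda>b. (b + ?t, b)) ` {..<L - ?t}) \<le> card {(b, b') \<in> shifted_pairs p L {s}. int b' - int b = int s - int p}"
    by (rule card_mono[rotated]) (rule finite_subset[OF _ shifted_pairs_finite[of p L "{s}"]], auto)
  moreover have "card ((\<lambda>b. (b + ?t, b)) ` {..<L - ?t}) = L - ?t"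
    by (subst card_image) (auto simp: inj_on_def)
  moreover have "(int s - int p) mod int p = int s"
    using assms by (simp add: minus_mod_self2)
  ultimately show ?thesis
    using assms False by (intro that[of "int s - int p"]) auto
qed

lemma shifted_pairs_mod:
  assumes "(b, b') \<in> shifted_pairs p L {s}" "s < p" "L \<le> p"
  shows "(int b' - int b) mod int p = int s"
proof -
  have "(int b' - int b) mod int p = (int ((b + s) mod p) - int b) mod int p"
    using assms by (simp add: shifted_pairs_def)
  also have "\<dots> = int s mod int p"
    by (simp add: of_nat_mod mod_diff_left_eq)
  finally show ?thesis
    using assms by simp
qed

text \<open>Differences of pairs lie strictly between \<open>- p\<close> and \<open>p\<close>, so
  with \<open>2 * p \<le> N\<close> distinct ones stay distinct modulo \<open>N\<close>. The scalar
  product with one wave thus counts the pairs with that difference.\<close>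

lemma sum_pair_wave_wave:
  assumes "2 * p \<le> N" "0 < N" "L \<le> p" "\<bar>D\<bar> < int p"
  shows "(\<Sum>y<N. pair_wave N p L X y * wave N y D) =
    N / 2 * card {(b, b') \<in> shifted_pairs p L X. int b' - int b = D}"
proof -
  have "(\<Sum>y<N. pair_wave N p L X y * wave N y D) =
    (\<Sum>r\<in>shifted_pairs p L X. \<Sum>y<N. wave N y (int (snd r) - int (fst r)) * wave N y D)"
    unfolding pair_wave_def sum_distrib_right case_prod_unfold by (rule sum.swap)
  also have "\<dots> = (\<Sum>r\<in>shifted_pairs p L X. if int (snd r) - int (fst r) = D then N / 2 else 0)"
    using assms by (intro sum.cong refl wave_orthogonal) (auto simp: shifted_pairs_def)
  also have "\<dots> = (\<Sum>r\<in>{(b, b') \<in> shifted_pairs p L X. int b' - int b = D}. N / 2)"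
    by (rule sum.mono_neutral_cong_right) (auto intro: shifted_pairs_finite)
  finally show ?thesis
    by simp
qed

text \<open>Bessel's inequality at a single frequency \<open>D\<close>: it has weight at least
  \<open>L / 4\<close> for \<open>s\<close> and weight 0 for \<open>X'\<close>, because a difference
  determines its shift modulo \<open>p\<close>.\<close>

lemma pair_wave_distance:
  assumes "2 * p \<le> N" "L \<le> p" "p < 2 * L" "2 * p < 3 * L"
    and X: "s < p" and X': "X' = {} \<or> (\<exists>s'<p. X' = {s'})" "s \<notin> X'"
  shows "N * (real L)\<^sup>2 / 32 \<le> (\<Sum>y<N. (pair_wave N p L {s} y - pair_wave N p L X' y)\<^sup>2)"
proof -
  obtain D where D: "\<bar>D\<bar> < int p" "D mod int p = int s"
    "L \<le> 4 * card {(b, b') \<in> shifted_pairs p L {s}. int b' - int b = D}"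
    by (rule card_shifted_pairs_difference[OF X assms(2-4)])
  let ?d = "\<lambda>y. pair_wave N p L {s} y - pair_wave N p L X' y"
  let ?t = "real L / 4"
  have N: "0 < N"
    using assms by auto
  have "int b' - int b \<noteq> D" if "(b, b') \<in> shifted_pairs p L X'" for b b'
    using X' that shifted_pairs_mod[of b b' p L] assms(2) D(2) by (auto simp: shifted_pairs_def)
  then have "{(b, b') \<in> shifted_pairs p L X'. int b' - int b = D} = {}"
    by auto
  then have 0: "(\<Sum>y<N. pair_wave N p L X' y * wave N y D) = 0"
    using sum_pair_wave_wave[OF assms(1) N assms(2) D(1), of X'] by (simp only:) simp
  have "N * ?t / 2 \<le> (\<Sum>y<N. pair_wave N p L {s} y * wave N y D)"
  proof -
    have "?t \<le> card {(b, b') \<in> shifted_pairs p L {s}. int b' - int b = D}"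
      using D(3) by linarith
    then have "N / 2 * ?t \<le> N / 2 * card {(b, b') \<in> shifted_pairs p L {s}. int b' - int b = D}"
      by (intro mult_left_mono) auto
    then show ?thesis
      unfolding sum_pair_wave_wave[OF assms(1) N assms(2) D(1)] by simp
  qed
  then have 1: "N * ?t / 2 \<le> (\<Sum>y<N. ?d y * wave N y D)"
    by (simp only: left_diff_distrib sum_subtractf 0 diff_zero)
  have 2: "(\<Sum>y<N. (wave N y D)\<^sup>2) = N / 2"
    using wave_orthogonal[OF N, of D D] N by (simp add: power2_eq_square)
  \<comment> \<open>Expanding this square gives Bessel's inequality, with the lower bound
    \<open>?t\<close> in place of the exact coefficient.\<close>
  have "0 \<le> (\<Sum>y<N. (?d y - ?t * wave N y D)\<^sup>2)"
    by (intro sum_nonneg) simp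
  also have "\<dots> = (\<Sum>y<N. (?d y)\<^sup>2 - 2 * ?t * (?d y * wave N y D) + ?t\<^sup>2 * (wave N y D)\<^sup>2)"
    by (rule sum.cong) (auto simp: power2_eq_square algebra_simps)
  also have "\<dots> = (\<Sum>y<N. (?d y)\<^sup>2) - 2 * ?t * (\<Sum>y<N. ?d y * wave N y D) + ?t\<^sup>2 * (N / 2)"
    unfolding sum.distrib sum_subtractf sum_distrib_left[symmetric] 2 ..
  finally have "2 * ?t * (\<Sum>y<N. ?d y * wave N y D) - ?t\<^sup>2 * (N / 2) \<le> (\<Sum>y<N. (?d y)\<^sup>2)"
    by linarith
  moreover have "2 * ?t * (N * ?t / 2) \<le> 2 * ?t * (\<Sum>y<N. ?d y * wave N y D)"
    using 1 by (intro mult_left_mono) auto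
  moreover have "2 * ?t * (N * ?t / 2) - ?t\<^sup>2 * (N / 2) = N * (real L)\<^sup>2 / 32"
    by (simp add: power2_eq_square field_simps)
  ultimately show ?thesis
    by linarith
qed

definition fibre_data :: "nat \<Rightarrow> bool \<Rightarrow> nat set \<Rightarrow> bool" where
  "fibre_data p full X \<longleftrightarrow> (if full then X = {} \<or> X = {..<p} else X = {} \<or> (\<exists>s<p. X = {s}))"

text \<open>Different values of \<open>full\<close> show at frequency 0, and so does an empty fibre
  against a whole one; a single outcome tells them apart. If neither side is full, every outcome has
  probability at most \<open>1 / 2 ^ Suc n\<close>, and the squared distance over all frequencies
  has to be set against this bound.\<close>

lemma test_dist_separation:
  fixes n p L :: nat
  assumes n: "2 \<le> n" and L: "L \<le> p" "2 * p < 3 * L" "p < 2 ^ n" "2 ^ n \<le> 2 * L"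
    and X: "fibre_data p full X" "fibre_data p full' X'" "(full, X) \<noteq> (full', X')"
    and P: "P = test_dist n L (coset_collision p full X)" "\<And>r. 0 \<le> P r"
    and Q: "Q = test_dist n L (coset_collision p full' X')" "\<And>r. 0 \<le> Q r"
  shows "(\<Sum>r\<in>UNIV \<times> {..<2 ^ Suc n}. sqrt (P r * Q r)) \<le> 1 - 1 / 2048"
proof -
  let ?N = "2 ^ Suc n :: nat"
  have L0: "0 < L" "L \<le> ?N"
    using L by auto
  have N8: "8 \<le> ?N"
    using power_increasing[of 3 "Suc n" "2 :: nat"] n by simp
  have LN: "1 / 4 \<le> real L / ?N"
    using L(4) by (simp add: field_simps flip: of_nat_le_iff[where 'a = real])
  have tot: "(\<Sum>r\<in>UNIV \<times> {..<?N}. P r) = 1" "(\<Sum>r\<in>UNIV \<times> {..<?N}. Q r) = 1"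
    unfolding P(1) Q(1) by (rule test_dist_total[OF L0])+
  have pos: "0 \<le> P r" "0 \<le> Q r" for r
    using P(2) Q(2) by auto
  have same_full: "same_wave ?N L True 0 = (real L)\<^sup>2"
    by (simp add: same_wave_def power2_eq_square)
  have same_diag: "same_wave N L False y = L" for N y
    by (simp add: same_wave_def)
  show ?thesis
  proof (cases "full = full'")
    case False
    \<comment> \<open>Frequency 0 has probability \<open>L / ?N \<ge> 1 / 4\<close> in the full case
      and \<open>1 / ?N \<le> 1 / 8\<close> otherwise; at least half of the gap falls to one value
      of \<open>z\<close>.\<close>
    have *: "\<exists>z. 1 / 16 \<le> \<bar>R (z, 0) - S (z, 0)\<bar>"
      if "R = test_dist n L (coset_collision p True Y)" "S = test_dist n L (coset_collision p False Z)" for R S Y Z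
    proof -
      have "(\<Sum>z\<in>UNIV. R (z, 0)) = real L / ?N" "(\<Sum>z\<in>UNIV. S (z, 0)) = 1 / ?N"
        unfolding that test_dist_sum_over_bit[OF L0(1)] same_full same_diag
        using L0 by (simp_all add: power2_eq_square)
      moreover have "1 / ?N \<le> (1 / 8 :: real)"
        using N8 by (simp add: field_simps flip: of_nat_le_iff[where 'a = real])
      ultimately have "1 / 8 \<le> (R (False, 0) - S (False, 0)) + (R (True, 0) - S (True, 0))"
        unfolding sum_UNIV_bool using LN by linarith
      then have "1 / 16 \<le> R (False, 0) - S (False, 0) \<or> 1 / 16 \<le> R (True, 0) - S (True, 0)"
        by linarith
      then show ?thesis
        by (meson abs_ge_self order_trans)
    qed
    have "\<exists>z. 1 / 16 \<le> \<bar>P (z, 0) - Q (z, 0)\<bar>"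
    proof (cases full)
      case True
      then show ?thesis
        using False * P Q by auto
    next
      case f: False
      then show ?thesis
        using False *[of Q X' P X] P(1) Q(1) by (simp add: abs_minus_commute)
    qed
    then obtain z where "1 / 16 \<le> \<bar>P (z, 0) - Q (z, 0)\<bar>" ..
    then show ?thesis
      using tot pos by (intro sum_sqrt_mult_le_of_ge[where r = "(z, 0)"]) auto
  next
    case same: True
    show ?thesis
    proof (cases full)
      case True
      have full: "pair_wave ?N p L {..<p} 0 = (real L)\<^sup>2 * (sqrt 2 / 2)"
      proof -
        have "\<exists>s\<in>{..<p}. b' = (b + s) mod p" if "b < L" "b' < L" for b b'
          using that L by (intro bexI[of _ "(b' + (p - b)) mod p"]) (auto simp: mod_add_right_eq)
        then have "shifted_pairs p L {..<p} = {..<L} \<times> {..<L}"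
          by (auto simp: shifted_pairs_def)
        then show ?thesis
          by (simp add: pair_wave_def wave_def cos_45 power2_eq_square)
      qed
      have empty: "pair_wave ?N p L {} 0 = 0"
        by (simp add: pair_wave_def shifted_pairs_def)
      have "X \<noteq> X'" "X = {} \<or> X = {..<p}" "X' = {} \<or> X' = {..<p}"
        using X True same by (auto simp: fibre_data_def)
      then have "\<bar>P (False, 0) - Q (False, 0)\<bar> = 2 * ((real L)\<^sup>2 * (sqrt 2 / 2)) / (4 * real L * ?N)"
        unfolding P(1) Q(1) test_dist_formula
        by (auto simp: full empty True simp del: power_Suc simp flip: same diff_divide_distrib)
      also have "\<dots> = (real L / ?N) * (sqrt 2 / 4)"
        using L0 by (simp add: power2_eq_square)
      finally have "\<bar>P (False, 0) - Q (False, 0)\<bar> = (real L / ?N) * (sqrt 2 / 4)" .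
      moreover have "(1 / 4) * (1 / 4) \<le> (real L / ?N) * (sqrt 2 / 4)"
        using LN by (intro mult_mono) auto
      ultimately show ?thesis
        using tot pos by (intro sum_sqrt_mult_le_of_ge[where r = "(False, 0)"]) auto
    next
      case False
      have val: "P (z, y) = (1 + (if z then - 1 else 1) * pair_wave ?N p L X y / L) / (2 * ?N)"
        "Q (z, y) = (1 + (if z then - 1 else 1) * pair_wave ?N p L X' y / L) / (2 * ?N)" for z y
        unfolding P(1) Q(1) test_dist_formula
        using L0 False by (simp_all add: same_diag field_simps flip: same)
      \<comment> \<open>The two control bits share the probability \<open>1 / ?N\<close> of a
        frequency, whatever the fibre.\<close>
      have bound: "P r \<le> 1 / ?N" "Q r \<le> 1 / ?N" for r
      proof -
        obtain z y where r: "r = (z, y)"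
          by (cases r)
        have "P (z, y) + P (\<not> z, y) = 1 / ?N" "Q (z, y) + Q (\<not> z, y) = 1 / ?N"
          unfolding val by (simp_all add: field_simps)
        then show "P r \<le> 1 / ?N" "Q r \<le> 1 / ?N"
          using pos[of "(\<not> z, y)"] unfolding r by linarith+
      qed
      let ?d = "\<lambda>y. pair_wave ?N p L X y - pair_wave ?N p L X' y"
      have XX: "X = {} \<or> (\<exists>s<p. X = {s})" "X' = {} \<or> (\<exists>s<p. X' = {s})" "X \<noteq> X'"
        using X False same by (auto simp: fibre_data_def)
      have pN: "2 * p \<le> ?N" "p < 2 * L"
        using L by auto
      have dist: "?N * (real L)\<^sup>2 / 32 \<le> (\<Sum>y<?N. (?d y)\<^sup>2)"
      proof (cases "X = {}")
        case True
        then obtain s where "s < p" "X' = {s}"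
          using XX by auto
        then show ?thesis
          unfolding power2_commute[of "pair_wave ?N p L X _"]
          using pair_wave_distance[OF pN(1) L(1) pN(2) L(2), of s X] True by (simp only:) simp
      next
        case False
        then obtain s where "s < p" "X = {s}"
          using XX by auto
        then show ?thesis
          using pair_wave_distance[OF pN(1) L(1) pN(2) L(2), of s X'] XX by (simp only:) auto
      qed
      have "(\<Sum>r\<in>UNIV \<times> {..<?N}. (P r - Q r)\<^sup>2) = (\<Sum>z\<in>UNIV. \<Sum>y<?N. (P (z, y) - Q (z, y))\<^sup>2)"
        by (simp only: sum.cartesian_product')
      also have "\<dots> = (\<Sum>z\<in>(UNIV :: bool set). \<Sum>y<?N. (?d y)\<^sup>2 / (2 * L * ?N)\<^sup>2)"
      proof (intro sum.cong refl)
        fix z y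
        have "P (z, y) - Q (z, y) = (if z then - 1 else 1) * (?d y / (2 * L * ?N))"
          unfolding val using L0 by (simp add: field_simps)
        then show "(P (z, y) - Q (z, y))\<^sup>2 = (?d y)\<^sup>2 / (2 * L * ?N)\<^sup>2"
          by (simp only: power_mult_distrib power_divide) (simp add: power_mult_distrib)
      qed
      also have "\<dots> = 2 * (\<Sum>y<?N. (?d y)\<^sup>2) / (2 * L * ?N)\<^sup>2"
        by (simp add: sum_UNIV_bool flip: sum_divide_distrib)
      also have "\<dots> \<ge> 2 * (?N * (real L)\<^sup>2 / 32) / (2 * L * ?N)\<^sup>2"
        using dist by (intro divide_right_mono mult_left_mono) auto
      also have "2 * (?N * (real L)\<^sup>2 / 32) / (2 * L * ?N)\<^sup>2 = 1 / (64 * ?N)"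
        using L0 by (simp add: power2_eq_square field_simps)
      finally have d: "1 / (64 * ?N) \<le> (\<Sum>r\<in>UNIV \<times> {..<?N}. (P r - Q r)\<^sup>2)" .
      have "(\<Sum>r\<in>UNIV \<times> {..<?N}. sqrt (P r * Q r)) \<le>
        1 - (\<Sum>r\<in>UNIV \<times> {..<?N}. (P r - Q r)\<^sup>2) / (8 * (1 / ?N))"
        using tot pos bound by (intro sum_sqrt_mult_le) auto
      moreover have "1 / (64 * ?N) / (8 * (1 / ?N)) \<le> (\<Sum>r\<in>UNIV \<times> {..<?N}. (P r - Q r)\<^sup>2) / (8 * (1 / ?N))"
        using d by (intro divide_right_mono) auto
      moreover have "1 / (64 * ?N) / (8 * (1 / ?N)) = (1 / 512 :: real)"
        by simp
      ultimately show ?thesis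
        by linarith
    qed
  qed
qed


section \<open>Cosets and fibres of subgroups of the q-hedral group\<close>

locale q_hedral =
  fixes p q a n :: nat
  assumes p: "prime p" and q: "q dvd p - 1" and a: "a \<in> totatives p" and ord_a: "ord p a = q"
    and p_less: "p < 2 ^ n"
begin

abbreviation G :: "(nat \<times> nat) monoid" where "G \<equiv> q_hedral_group p q a"

text \<open>Exponents range over all naturals, not only those below \<open>q\<close>, so that sums
  of exponents need no reduction.\<close>

definition pw :: "nat \<Rightarrow> nat" where "pw t = a ^ t mod p"

lemma p_gt_1: "1 < p"
  using p prime_gt_1_nat by blast

lemma q_pos: "0 < q"
  using q p_gt_1 by (intro Nat.gr0I) auto

lemma coprime_pa: "coprime p a"
  using a by (simp add: totatives_def coprime_commute)

lemma pw_eq_iff: "pw t = pw u \<longleftrightarrow> [t = u] (mod q)"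
  using order_divides_expdiff[OF coprime_pa, of t u] by (simp add: pw_def cong_def ord_a)

lemma pw_add: "pw t * pw u mod p = pw (t + u)"
  by (simp add: pw_def power_add mod_mult_eq)

lemma pw_0: "pw 0 = 1"
  using p_gt_1 by (simp add: pw_def)

lemma pw_less: "pw t < p"
  using p_gt_1 by (simp add: pw_def)

lemma pw_q: "pw q = 1"
  using pw_eq_iff[of q 0] pw_0 by (simp add: cong_def)

lemma carrier_G: "carrier G = range pw \<times> {..<p}"
proof -
  have "pw t \<in> pw ` {..<q}" for t
    using pw_eq_iff[of t "t mod q"] q_pos by (intro rev_image_eqI[of "t mod q"]) auto
  then have "pw ` {..<q} = range pw"
    by auto
  then show ?thesis
    by (simp add: q_hedral_group_def affine_over_def pw_def[abs_def])
qed

lemma mult_G: "(\<alpha>, \<beta>) \<otimes>\<^bsub>G\<^esub> (\<gamma>, \<delta>) = (\<alpha> * \<gamma> mod p, (\<beta> + \<alpha> * \<delta>) mod p)"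
  by (simp add: q_hedral_group_def affine_over_def)

lemma one_G: "\<one>\<^bsub>G\<^esub> = (1, 0)"
  by (simp add: q_hedral_group_def affine_over_def)

lemma one_in_range_pw [simp]: "1 \<in> range pw" "Suc 0 \<in> range pw"
  using pw_0 by (metis One_nat_def rangeI)+

lemma group_G: "group G"
proof (rule groupI)
  fix x y assume "x \<in> carrier G" "y \<in> carrier G"
  then show "x \<otimes>\<^bsub>G\<^esub> y \<in> carrier G"
    using p_gt_1 by (auto simp: carrier_G mult_G pw_add)
next
  show "\<one>\<^bsub>G\<^esub> \<in> carrier G"
    using p_gt_1 by (simp add: carrier_G one_G)
next
  fix x y z
  assume "x \<in> carrier G" "y \<in> carrier G" "z \<in> carrier G"
  moreover obtain \<alpha> \<beta> \<gamma> \<delta> \<epsilon> \<zeta> where "x = (\<alpha>, \<beta>)" "y = (\<gamma>, \<delta>)" "z = (\<epsilon>, \<zeta>)"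
    by (metis surj_pair)
  moreover have "(\<beta> + \<alpha> * \<delta> + \<alpha> * \<gamma> mod p * \<zeta>) mod p = (\<beta> + \<alpha> * ((\<delta> + \<gamma> * \<zeta>) mod p)) mod p"
  proof -
    have "(\<beta> + \<alpha> * \<delta> + \<alpha> * \<gamma> mod p * \<zeta>) mod p = (\<beta> + \<alpha> * \<delta> + \<alpha> * \<gamma> * \<zeta>) mod p"
      by (metis mod_add_right_eq mod_mult_left_eq)
    also have "\<dots> = (\<beta> + \<alpha> * (\<delta> + \<gamma> * \<zeta>)) mod p"
      by (simp add: algebra_simps)
    also have "\<dots> = (\<beta> + \<alpha> * ((\<delta> + \<gamma> * \<zeta>) mod p)) mod p"
      by (metis mod_add_right_eq mod_mult_right_eq)
    finally show ?thesis .
  qed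
  ultimately show "x \<otimes>\<^bsub>G\<^esub> y \<otimes>\<^bsub>G\<^esub> z = x \<otimes>\<^bsub>G\<^esub> (y \<otimes>\<^bsub>G\<^esub> z)"
    by (simp add: mult_G mod_simps mult.assoc)
next
  fix x assume "x \<in> carrier G"
  then show "\<one>\<^bsub>G\<^esub> \<otimes>\<^bsub>G\<^esub> x = x"
    by (auto simp: carrier_G mult_G one_G pw_less)
next
  fix x assume "x \<in> carrier G"
  then obtain t \<beta> where x: "x = (pw t, \<beta>)" "\<beta> < p"
    by (auto simp: carrier_G)
  \<comment> \<open>This serves as the exponent \<open>- t\<close> modulo \<open>q\<close>; the
    second component of the inverse is then \<open>- pw ?u * \<beta>\<close> modulo
    \<open>p\<close>.\<close>
  let ?u = "t * (q - 1)"
  let ?y = "(pw ?u, (p - pw ?u * \<beta> mod p) mod p)"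
  have "?u + t = t * q"
    using q_pos by (simp add: algebra_simps)
  then have 1: "pw ?u * pw t mod p = 1"
    using pw_eq_iff[of "?u + t" 0] pw_0 by (simp add: pw_add cong_def)
  have "((p - pw ?u * \<beta> mod p) mod p + pw ?u * \<beta>) mod p = ((p - pw ?u * \<beta> mod p) + pw ?u * \<beta> mod p) mod p"
    by (simp add: mod_simps)
  also have "\<dots> = p mod p"
    using p_gt_1 by (simp add: less_imp_le)
  finally have "?y \<otimes>\<^bsub>G\<^esub> x = \<one>\<^bsub>G\<^esub>"
    using 1 by (simp add: x one_G mult_G)
  moreover have "?y \<in> carrier G"
    using p_gt_1 by (simp add: carrier_G)
  ultimately show "\<exists>y\<in>carrier G. y \<otimes>\<^bsub>G\<^esub> x = \<one>\<^bsub>G\<^esub>"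
    by blast
qed

section \<open>Equality of cosets in terms of fibres\<close>

definition fibre :: "(nat \<times> nat) set \<Rightarrow> nat \<Rightarrow> nat set" where
  "fibre H \<alpha> = {s. (\<alpha>, s) \<in> H}"

definition full :: "(nat \<times> nat) set \<Rightarrow> bool" where
  "full H \<longleftrightarrow> fibre H 1 \<noteq> {0}"

lemma pw_inverse: "\<exists>u. pw u * pw t mod p = 1"
proof -
  have "t * (q - 1) + t = t * q"
    using q_pos by (simp add: algebra_simps)
  then have "pw (t * (q - 1)) * pw t mod p = 1"
    using pw_eq_iff[of "t * (q - 1) + t" 0] pw_0 by (simp add: pw_add cong_def)
  then show ?thesis ..
qed

lemma pw_mult_cancel:
  assumes "(\<beta> + pw t * s) mod p = (\<beta> + pw t * s') mod p" "s < p" "s' < p"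
  shows "s = s'"
proof -
  have "coprime a p"
    using coprime_pa by (simp add: coprime_commute)
  then have "coprime (pw t) p"
    using p_gt_1 by (simp add: pw_def)
  moreover have "[pw t * s = pw t * s'] (mod p)"
    using assms(1) by (metis cong_add_lcancel_nat cong_def)
  ultimately have "[s = s'] (mod p)"
    using cong_mult_lcancel_nat by blast
  then show ?thesis
    using assms by (simp add: cong_def)
qed

context
  fixes H assumes H: "subgroup H G"
begin

lemma H_sub: "(\<alpha>, s) \<in> H \<Longrightarrow> \<alpha> \<in> range pw \<and> s < p"
  using subgroup.subset[OF H] carrier_G by auto

lemma H_mult: "(\<alpha>, s) \<in> H \<Longrightarrow> (\<gamma>, t) \<in> H \<Longrightarrow> (\<alpha> * \<gamma> mod p, (s + \<alpha> * t) mod p) \<in> H"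
  using subgroup.m_closed[OF H] by (metis mult_G)

lemma H_one: "(1, 0) \<in> H"
  using subgroup.one_closed[OF H] by (simp add: one_G)

text \<open>A translation by \<open>s \<noteq> 0\<close> generates all of them, since
  \<open>s\<close> is invertible modulo the prime \<open>p\<close>.\<close>

lemma full_iff: "full H \<longleftrightarrow> fibre H 1 = {..<p}"
proof
  assume "fibre H 1 = {..<p}"
  then show "full H"
    using p_gt_1 by (auto simp: full_def set_eq_iff)
next
  assume "full H"
  then obtain s where s: "(1, s) \<in> H" "s \<noteq> 0"
    using H_one by (auto simp: full_def fibre_def)
  have mult: "(1, k * s mod p) \<in> H" for k
  proof (induction k)
    case 0
    then show ?case using H_one by simp
  next
    case (Suc k)
    then show ?case
      using H_mult[OF s(1) Suc] p_gt_1 by (simp add: mod_simps)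
  qed
  have "s < p"
    using H_sub s by blast
  then have "coprime s p"
    using s p by (metis coprime_commute dvd_imp_le gr0I leD prime_imp_coprime_nat)
  then obtain k where k: "[s * k = 1] (mod p)"
    using cong_solve_coprime_nat by auto
  have "t \<in> fibre H 1" if "t < p" for t
  proof -
    have "(t * k) * s mod p = t"
      using k that p_gt_1 by (metis cong_def mod_less mod_mult_right_eq mult.assoc mult.commute mult.right_neutral)
    then show ?thesis
      using mult[of "t * k"] by (simp add: fibre_def)
  qed
  then show "fibre H 1 = {..<p}"
    using H_sub by (auto simp: fibre_def)
qed

lemma fibre_shift: "s \<in> fibre H \<alpha> \<Longrightarrow> t \<in> fibre H 1 \<Longrightarrow> (t + s) mod p \<in> fibre H \<alpha>"
  using H_mult[of 1 t \<alpha> s] H_sub[of \<alpha> s] pw_less by (auto simp: fibre_def)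

lemma coset_eq_iff:
  assumes "x \<in> carrier G" "y \<in> carrier G"
  shows "x <#\<^bsub>G\<^esub> H = y <#\<^bsub>G\<^esub> H \<longleftrightarrow> (\<exists>h\<in>H. y = x \<otimes>\<^bsub>G\<^esub> h)"
proof -
  interpret group G by (rule group_G)
  have "y \<in> y <#\<^bsub>G\<^esub> H"
    using subgroup.one_closed[OF H] assms(2) unfolding l_coset_def by force
  then have "x <#\<^bsub>G\<^esub> H = y <#\<^bsub>G\<^esub> H \<longleftrightarrow> y \<in> x <#\<^bsub>G\<^esub> H"
    using l_repr_independence[OF _ assms(1) H] by blast
  then show ?thesis
    by (auto simp: l_coset_def)
qed

lemma coset_eq_one_iff:
  assumes "\<alpha> \<in> range pw" "b < p" "b' < p"
  shows "(1, b) <#\<^bsub>G\<^esub> H = (\<alpha>, b') <#\<^bsub>G\<^esub> H \<longleftrightarrow> (\<exists>s\<in>fibre H \<alpha>. b' = (b + s) mod p)"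
proof -
  have "(\<exists>h\<in>H. (\<alpha>, b') = (1, b) \<otimes>\<^bsub>G\<^esub> h) \<longleftrightarrow> (\<exists>s\<in>fibre H \<alpha>. b' = (b + s) mod p)"
  proof
    assume "\<exists>h\<in>H. (\<alpha>, b') = (1, b) \<otimes>\<^bsub>G\<^esub> h"
    then obtain \<gamma> s where h: "(\<gamma>, s) \<in> H" "\<alpha> = \<gamma> mod p" "b' = (b + s) mod p"
      by (auto simp: mult_G)
    then have "\<alpha> = \<gamma>"
      using H_sub[OF h(1)] pw_less by auto
    then show "\<exists>s\<in>fibre H \<alpha>. b' = (b + s) mod p"
      using h by (auto simp: fibre_def)
  next
    assume "\<exists>s\<in>fibre H \<alpha>. b' = (b + s) mod p"
    then obtain s where s: "(\<alpha>, s) \<in> H" "b' = (b + s) mod p"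
      by (auto simp: fibre_def)
    moreover have "\<alpha> mod p = \<alpha>"
      using assms pw_less by auto
    ultimately show "\<exists>h\<in>H. (\<alpha>, b') = (1, b) \<otimes>\<^bsub>G\<^esub> h"
      by (intro bexI[of _ "(\<alpha>, s)"]) (auto simp: mult_G)
  qed
  then show ?thesis
    using assms p_gt_1 by (subst coset_eq_iff) (auto simp: carrier_G)
qed

text \<open>The quotient of the two elements is the translation by
  \<open>(b' - b) / \<alpha>\<close>. Dividing by \<open>\<alpha>\<close> does not affect
  membership, as the translations in \<open>H\<close> are either trivial or all of them.\<close>

lemma coset_eq_same_iff:
  assumes "\<alpha> \<in> range pw" "b < p" "b' < p"
  shows "(\<alpha>, b) <#\<^bsub>G\<^esub> H = (\<alpha>, b') <#\<^bsub>G\<^esub> H \<longleftrightarrow> b = b' \<or> full H"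
proof -
  obtain t where t: "\<alpha> = pw t"
    using assms by auto
  have "(\<exists>h\<in>H. (\<alpha>, b') = (\<alpha>, b) \<otimes>\<^bsub>G\<^esub> h) \<longleftrightarrow> (\<exists>s\<in>fibre H 1. b' = (b + \<alpha> * s) mod p)" (is "?l \<longleftrightarrow> ?r")
  proof
    assume ?l
    then obtain \<gamma> s where h: "(\<gamma>, s) \<in> H" "\<alpha> = \<alpha> * \<gamma> mod p" "b' = (b + \<alpha> * s) mod p"
      by (auto simp: mult_G)
    then have "(0 + pw t * \<gamma>) mod p = (0 + pw t * 1) mod p"
      using t pw_less by simp
    then have "\<gamma> = 1"
      using pw_mult_cancel[of 0 t \<gamma> 1] H_sub[OF h(1)] pw_less p_gt_1 by auto
    then show ?r
      using h by (auto simp: fibre_def)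
  next
    assume ?r
    then show ?l
      using t pw_less by (auto simp: fibre_def mult_G intro!: bexI)
  qed
  also have "\<dots> \<longleftrightarrow> b = b' \<or> full H"
  proof (cases "full H")
    case True
    obtain u where u: "pw u * pw t mod p = 1"
      using pw_inverse by blast
    let ?s = "pw u * (b' + (p - b)) mod p"
    have "(b + \<alpha> * ?s) mod p = (b + (pw u * pw t mod p) * (b' + (p - b))) mod p"
    proof -
      have "(b + \<alpha> * ?s) mod p = (b + \<alpha> * (pw u * (b' + (p - b)))) mod p"
        by (metis mod_add_right_eq mod_mult_right_eq)
      also have "\<alpha> * (pw u * (b' + (p - b))) = pw u * pw t * (b' + (p - b))"
        by (simp add: t)
      also have "(b + \<dots>) mod p = (b + (pw u * pw t mod p) * (b' + (p - b))) mod p"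
        by (metis mod_add_right_eq mod_mult_left_eq)
      finally show ?thesis .
    qed
    also have "\<dots> = b'"
      using assms u by simp
    finally have "b' = (b + \<alpha> * ?s) mod p"
      by simp
    moreover have "?s \<in> fibre H 1"
      using True full_iff p_gt_1 by simp
    ultimately show ?thesis
      using True by blast
  next
    case False
    then show ?thesis
      using assms by (auto simp: full_def)
  qed
  finally show ?thesis
    using assms by (subst coset_eq_iff) (auto simp: carrier_G)
qed

text \<open>Two elements of \<open>H\<close> over the same \<open>\<alpha>\<close> lie in the same
  coset, so they agree unless \<open>H\<close> is full. If \<open>H\<close> is full, its
  translations spread one point over the whole fibre.\<close>

lemma fibre_data_fibre:
  assumes "\<alpha> \<in> range pw"
  shows "fibre_data p (full H) (fibre H \<alpha>)"
proof (cases "fibre H \<alpha> = {}")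
  case True
  then show ?thesis by (simp add: fibre_data_def)
next
  case False
  then obtain s where s: "s \<in> fibre H \<alpha>"
    by auto
  have "s < p"
    using s H_sub by (auto simp: fibre_def)
  show ?thesis
  proof (cases "full H")
    case True
    have "t \<in> fibre H \<alpha>" if "t < p" for t
    proof -
      have "(t + (p - s)) mod p \<in> fibre H 1"
        using True full_iff p_gt_1 by simp
      from fibre_shift[OF s this] show ?thesis
        using that \<open>s < p\<close> by (simp add: mod_simps)
    qed
    then have "fibre H \<alpha> = {..<p}"
      using H_sub by (auto simp: fibre_def)
    then show ?thesis
      using True by (simp add: fibre_data_def)
  next
    case nfull: False
    have "s' = s" if "s' \<in> fibre H \<alpha>" for s'
    proof -
      have s': "s' < p"
        using that H_sub by (auto simp: fibre_def)
      have "(1, 0) <#\<^bsub>G\<^esub> H = (\<alpha>, u) <#\<^bsub>G\<^esub> H" if "u \<in> fibre H \<alpha>" "u < p" for u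
        by (subst coset_eq_one_iff) (use that assms p_gt_1 in \<open>auto intro!: bexI[of _ u]\<close>)
      from trans[OF this[OF that s', symmetric] this[OF s \<open>s < p\<close>]] show "s' = s"
        unfolding coset_eq_same_iff[OF assms s' \<open>s < p\<close>] using nfull by blast
    qed
    then have "fibre H \<alpha> = {s}"
      using s by blast
    then show ?thesis
      using nfull \<open>s < p\<close> by (auto simp: fibre_data_def)
  qed
qed

end

lemma coset_collision_iff:
  assumes "subgroup H G" "\<alpha> \<in> range pw" "snd s < p" "snd t < p"
  shows "(if fst s then \<alpha> else 1, snd s) <#\<^bsub>G\<^esub> H = (if fst t then \<alpha> else 1, snd t) <#\<^bsub>G\<^esub> H \<longleftrightarrow>
    coset_collision p (full H) (fibre H \<alpha>) s t"
  using coset_eq_same_iff[OF assms(1,2,3,4)] coset_eq_same_iff[OF assms(1) one_in_range_pw(1) assms(3,4)]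
    coset_eq_one_iff[OF assms(1,2,3,4)] coset_eq_one_iff[OF assms(1,2,4,3)]
  by (cases s; cases t) (auto simp: coset_collision_def)

end


section \<open>Subgroups are determined by few fibres\<close>

text \<open>These sets are the preimages in the naturals of the subgroups of the integers modulo
  \<open>q\<close>; the least positive element is the generator.\<close>

lemma periodic_submonoid_of_nat:
  fixes I :: "nat set"
  assumes "0 < q" "0 \<in> I" "\<And>t u. t \<in> I \<Longrightarrow> u \<in> I \<Longrightarrow> t + u \<in> I" "\<And>t. t + q \<in> I \<longleftrightarrow> t \<in> I"
  shows "\<exists>d>0. d dvd q \<and> I = {t. d dvd t}"
proof -
  define d where "d = (LEAST d. 0 < d \<and> d \<in> I)"
  have "q \<in> I"
    using assms(2) assms(4)[of 0] by simp
  then have d: "0 < d" "d \<in> I"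
    using LeastI[of "\<lambda>d. 0 < d \<and> d \<in> I" q] assms(1) by (auto simp: d_def)
  have mult: "k * t \<in> I" if "t \<in> I" for k t
    using that assms(2,3) by (induction k) auto
  have per: "t + k * q \<in> I \<longleftrightarrow> t \<in> I" for t k
  proof (induction k)
    case (Suc k)
    then show ?case
      using assms(4)[of "t + k * q"] by (simp add: add_ac)
  qed simp
  have "d dvd t" if "t \<in> I" for t
  proof -
    \<comment> \<open>Periodicity replaces subtraction: adding a multiple of \<open>d\<close>
      another \<open>q - 1\<close> times removes it modulo \<open>q\<close>.\<close>
    have "t + (t div d * (q - 1)) * d \<in> I"
      using that mult d assms(3) by blast
    also have "t + (t div d * (q - 1)) * d = t mod d + (t div d * d) * q"
    proof -
      have "t + (t div d * (q - 1)) * d = t mod d + (t div d * d + (t div d * d) * (q - 1))"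
        by (simp add: mult_ac)
      also have "t div d * d + (t div d * d) * (q - 1) = (t div d * d) * q"
        using assms(1) by (cases q) auto
      finally show ?thesis .
    qed
    finally have "t mod d \<in> I"
      by (simp only: per)
    moreover have "\<not> (0 < t mod d \<and> t mod d \<in> I)"
      using not_less_Least[of "t mod d" "\<lambda>d. 0 < d \<and> d \<in> I"] d(1) unfolding d_def[symmetric] by simp
    ultimately show ?thesis
      by auto
  qed
  moreover have "t \<in> I" if "d dvd t" for t
    using that mult[OF d(2)] by (auto simp: mult.commute)
  ultimately show ?thesis
    using d \<open>q \<in> I\<close> by blast
qed

text \<open>\<open>d dvd q div r ^ k\<close> means \<open>r ^ k dvd q div d\<close>, so
  \<open>q div d\<close> and \<open>q div d'\<close> have the same prime power divisors. In a cyclic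
  group of order \<open>q\<close> the condition says whether an element of order
  \<open>r ^ k\<close> lies in the subgroup of order \<open>q div d\<close>.\<close>

lemma divisor_eq_of_prime_power_codivisors:
  fixes q :: nat
  assumes "0 < q" "d dvd q" "d' dvd q"
    and "\<And>r k. prime r \<Longrightarrow> r ^ k dvd q \<Longrightarrow> d dvd q div r ^ k \<longleftrightarrow> d' dvd q div r ^ k"
  shows "d = d'"
proof -
  have iff: "d dvd q div r ^ k \<longleftrightarrow> r ^ k dvd q div d" if "r ^ k dvd q" "d dvd q" for r k d :: nat
    using that assms(1) by (metis div_dvd_div dvd_div_iff_mult dvd_div_eq_0_iff dvd_mult_imp_div dvd_0_left_iff mult.commute not_gr0)
  have "q div d dvd q div d'" if "d dvd q" "d' dvd q"
    and *: "\<And>r k. prime r \<Longrightarrow> r ^ k dvd q \<Longrightarrow> d dvd q div r ^ k \<Longrightarrow> d' dvd q div r ^ k" for d d'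
  proof (rule multiplicity_le_imp_dvd)
    show "q div d \<noteq> 0"
      using that assms(1) by (simp add: dvd_div_eq_0_iff)
    fix r :: nat assume r: "prime r"
    let ?k = "multiplicity r (q div d)"
    have k: "r ^ ?k dvd q div d"
      by (rule multiplicity_dvd)
    then have rq: "r ^ ?k dvd q"
      using that(1) by (metis dvd_div_mult_self dvd_mult2)
    have "r ^ ?k dvd q div d'"
      using iff[OF rq that(1)] iff[OF rq that(2)] * r rq k by blast
    moreover have "q div d' \<noteq> 0" "\<not> is_unit r"
      using that assms(1) r by (auto simp: dvd_div_eq_0_iff)
    ultimately show "?k \<le> multiplicity r (q div d')"
      by (intro multiplicity_geI) auto
  qed
  then have "q div d = q div d'"
    using assms by (intro dvd_antisym) blast+
  then show ?thesis
    using assms by (metis dvd_div_eq_cancel dvd_div_eq_iff dvd_div_mult_self mult_cancel_left dvd_div_eq_0_iff not_gr0)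
qed

context q_hedral
begin

text \<open>Every subgroup of the cyclic group of the \<open>pw t\<close> is generated by its elements in this set.\<close>

definition generators :: "nat set" where
  "generators = {pw (q div r ^ k) | r k. prime r \<and> r ^ k dvd q}"

lemma submonoid_eq_of_generators:
  assumes "D \<subseteq> range pw" "1 \<in> D" "\<And>\<alpha> \<beta>. \<alpha> \<in> D \<Longrightarrow> \<beta> \<in> D \<Longrightarrow> \<alpha> * \<beta> mod p \<in> D"
    and "D' \<subseteq> range pw" "1 \<in> D'" "\<And>\<alpha> \<beta>. \<alpha> \<in> D' \<Longrightarrow> \<beta> \<in> D' \<Longrightarrow> \<alpha> * \<beta> mod p \<in> D'"
    and "D \<inter> generators = D' \<inter> generators"
  shows "D = D'"
proof -
  have ex: "\<exists>d>0. d dvd q \<and> pw -` D = {t. d dvd t}"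
    if "D \<subseteq> range pw" "1 \<in> D" "\<And>\<alpha> \<beta>. \<alpha> \<in> D \<Longrightarrow> \<beta> \<in> D \<Longrightarrow> \<alpha> * \<beta> mod p \<in> D" for D
  proof (rule periodic_submonoid_of_nat[OF q_pos])
    show "0 \<in> pw -` D"
      using that by (simp add: pw_0)
    show "t + u \<in> pw -` D" if "t \<in> pw -` D" "u \<in> pw -` D" for t u
      using that \<open>\<And>\<alpha> \<beta>. \<alpha> \<in> D \<Longrightarrow> \<beta> \<in> D \<Longrightarrow> \<alpha> * \<beta> mod p \<in> D\<close> by (auto simp flip: pw_add)
    show "t + q \<in> pw -` D \<longleftrightarrow> t \<in> pw -` D" for t
      using pw_eq_iff[of "t + q" t] by (simp add: cong_def)
  qed
  obtain d where d: "0 < d" "d dvd q" "pw -` D = {t. d dvd t}"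
    using ex assms by metis
  obtain d' where d': "0 < d'" "d' dvd q" "pw -` D' = {t. d' dvd t}"
    using ex assms by metis
  have "d = d'"
  proof (rule divisor_eq_of_prime_power_codivisors[OF q_pos d(2) d'(2)])
    fix r k :: nat assume "prime r" "r ^ k dvd q"
    then have "pw (q div r ^ k) \<in> generators"
      by (auto simp: generators_def)
    then have "q div r ^ k \<in> pw -` D \<longleftrightarrow> q div r ^ k \<in> pw -` D'"
      using assms(7) by auto
    then show "d dvd q div r ^ k \<longleftrightarrow> d' dvd q div r ^ k"
      unfolding d d' by simp
  qed
  then have "pw -` D = pw -` D'"
    using d d' by simp
  then show ?thesis
    using assms by (metis image_vimage_eq inf.absorb1)
qed

lemma one_in_generators: "1 \<in> generators"
  unfolding generators_def using pw_q two_is_prime_nat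
  by (intro CollectI exI[of _ 2] exI[of _ 0]) simp

lemma generators_subset: "generators \<subseteq> range pw"
  by (auto simp: generators_def)

text \<open>A positive number below \<open>2 ^ n\<close> has at most \<open>n\<close> distinct prime
  factors, with exponents below \<open>n\<close>. The exponent 0 gives the element 1 for every
  prime, which accounts for the summand 1.\<close>

lemma generators_bound: "finite generators \<and> card generators \<le> n * n + 1"
proof -
  have q_less: "q < 2 ^ n"
    using dvd_imp_le[OF q] p_gt_1 p_less by simp
  have "2 ^ card (prime_factors q) \<le> (\<Prod>r\<in>prime_factors q. r ^ multiplicity r q)"
    unfolding prod_constant[symmetric]
  proof (rule prod_mono)
    fix r assume "r \<in> prime_factors q"
    then have "prime r" "0 < multiplicity r q"
      by (auto simp: prime_factors_multiplicity)
    then have "2 \<le> r"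
      using prime_ge_2_nat by blast
    moreover have "r ^ 1 \<le> r ^ multiplicity r q"
      by (rule power_increasing) (use \<open>2 \<le> r\<close> \<open>0 < multiplicity r q\<close> in auto)
    ultimately show "0 \<le> (2 :: nat) \<and> 2 \<le> r ^ multiplicity r q"
      by simp
  qed
  also have "\<dots> = q"
    using prime_factorization_nat[OF q_pos] by simp
  finally have "2 ^ card (prime_factors q) < (2 :: nat) ^ n"
    using q_less by (rule le_less_trans)
  then have card: "card (prime_factors q) \<le> n"
    by simp
  have sub: "generators \<subseteq> insert 1 ((\<lambda>(r, k). pw (q div r ^ k)) ` (prime_factors q \<times> {..<n}))"
  proof
    fix \<alpha> assume "\<alpha> \<in> generators"
    then obtain r k where r: "\<alpha> = pw (q div r ^ k)" "prime r" "r ^ k dvd q"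
      by (auto simp: generators_def)
    show "\<alpha> \<in> insert 1 ((\<lambda>(r, k). pw (q div r ^ k)) ` (prime_factors q \<times> {..<n}))"
    proof (cases "k = 0")
      case True
      then show ?thesis
        using r pw_q by simp
    next
      case False
      have "2 ^ k \<le> r ^ k"
        using r prime_ge_2_nat by (intro power_mono) auto
      also have "\<dots> \<le> q"
        using r q_pos dvd_imp_le by auto
      finally have "(2 :: nat) ^ k < 2 ^ n"
        using q_less by (rule le_less_trans)
      then have "k < n"
        by simp
      moreover have "r dvd q"
        using r False by (metis dvd_power dvd_trans gr0I)
      ultimately show ?thesis
        using r q_pos by (auto simp: prime_factors_dvd)
    qed
  qed
  have fin: "finite ((\<lambda>(r, k). pw (q div r ^ k)) ` (prime_factors q \<times> {..<n}))"
    by simp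
  have "card ((\<lambda>(r, k). pw (q div r ^ k)) ` (prime_factors q \<times> {..<n})) \<le> card (prime_factors q) * n"
    using card_image_le[of "prime_factors q \<times> {..<n}"] by simp
  also have "\<dots> \<le> n * n"
    using card by simp
  finally have "card (insert 1 ((\<lambda>(r, k). pw (q div r ^ k)) ` (prime_factors q \<times> {..<n}))) \<le> n * n + 1"
    using card_insert_le_m1 fin by (simp add: card_insert_if)
  then show ?thesis
    using card_mono[OF _ sub] finite_subset[OF sub] fin by auto
qed

text \<open>Equal projections do not suffice, as the second components could still differ. But the
  projection of \<open>H \<inter> H'\<close> is also determined at the generators, so
  \<open>H\<close> and \<open>H'\<close> share an element over every \<open>\<alpha>\<close> of the
  projection, and two fibres of the same kind that meet are equal.\<close>

lemma subgroup_eq_of_fibres: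
  assumes "subgroup H G" "subgroup H' G"
    and eq: "\<And>\<alpha>. \<alpha> \<in> generators \<Longrightarrow> fibre H \<alpha> = fibre H' \<alpha>"
  shows "H = H'"
proof -
  have mono: "fst ` H \<subseteq> range pw" "1 \<in> fst ` H" "\<alpha> \<in> fst ` H \<Longrightarrow> \<beta> \<in> fst ` H \<Longrightarrow> \<alpha> * \<beta> mod p \<in> fst ` H"
    if H: "subgroup H G" for H \<alpha> \<beta>
  proof -
    show "fst ` H \<subseteq> range pw"
      using H_sub[OF H] by auto
    show "1 \<in> fst ` H"
      using H_one[OF H] by (metis fst_conv image_eqI)
    show "\<alpha> * \<beta> mod p \<in> fst ` H" if mem: "\<alpha> \<in> fst ` H" "\<beta> \<in> fst ` H"
    proof -
      obtain s t where "(\<alpha>, s) \<in> H" "(\<beta>, t) \<in> H"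
        using mem by auto
      from H_mult[OF H this] show ?thesis
        by (metis fst_conv image_eqI)
    qed
  qed
  have I: "subgroup (H \<inter> H') G"
    using group.subgroups_Inter_pair[OF group_G] assms by blast
  have gen: "\<alpha> \<in> fst ` H \<longleftrightarrow> \<alpha> \<in> fst ` H'" "\<alpha> \<in> fst ` (H \<inter> H') \<longleftrightarrow> \<alpha> \<in> fst ` H"
    if "\<alpha> \<in> generators" for \<alpha>
    using eq[OF that] by (auto simp: fibre_def set_eq_iff image_iff)
  have "fst ` (H \<inter> H') = fst ` H"
    using gen(2) by (intro submonoid_eq_of_generators[OF mono[OF I] mono[OF assms(1)]]) auto
  moreover have "fst ` H = fst ` H'"
    using gen(1) by (intro submonoid_eq_of_generators[OF mono[OF assms(1)] mono[OF assms(2)]]) auto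
  ultimately have fst: "fst ` (H \<inter> H') = fst ` H" "fst ` H = fst ` H'"
    by auto
  have "full H = full H'"
    using eq[OF one_in_generators] by (simp add: full_def)
  have "fibre H \<alpha> = fibre H' \<alpha>" for \<alpha>
  proof (cases "\<alpha> \<in> fst ` H")
    case True
    then have "\<alpha> \<in> fst ` (H \<inter> H')"
      by (simp only: fst)
    then obtain s where s: "s \<in> fibre H \<alpha>" "s \<in> fibre H' \<alpha>"
      by (auto simp: fibre_def)
    have "\<alpha> \<in> range pw"
      using mono(1)[OF assms(1)] True by auto
    then have "fibre_data p (full H) (fibre H \<alpha>)" "fibre_data p (full H) (fibre H' \<alpha>)"
      using fibre_data_fibre[OF assms(1)] fibre_data_fibre[OF assms(2)] \<open>full H = full H'\<close> by simp_all
    then show ?thesis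
      using s by (auto simp: fibre_data_def split: if_splits)
  next
    case False
    moreover from this have "\<alpha> \<notin> fst ` H'"
      unfolding fst(2) .
    ultimately show ?thesis
      by (force simp: fibre_def)
  qed
  then show ?thesis
    by (auto simp: fibre_def set_eq_iff)
qed

text \<open>A subgroup is encoded by its fibres over the generators, each of them empty, everything
  or one of \<open>p\<close> points.\<close>

lemma card_subgroups:
  "finite {H. subgroup H G} \<and> card {H. subgroup H G} \<le> (p + 2) ^ card generators"
proof -
  let ?V = "insert {} (insert {..<p} ((\<lambda>s. {s}) ` {..<p}))"
  let ?g = "\<lambda>H. restrict (fibre H) generators"
  have inj: "inj_on ?g {H. subgroup H G}"
    by (rule inj_onI) (metis (mono_tags) mem_Collect_eq restrict_apply' subgroup_eq_of_fibres)
  have V: "fibre H \<alpha> \<in> ?V" if "subgroup H G" "\<alpha> \<in> generators" for H \<alpha>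
  proof -
    have "\<alpha> \<in> range pw"
      using that generators_subset by auto
    from fibre_data_fibre[OF that(1) this] show ?thesis
      by (auto simp: fibre_data_def split: if_splits)
  qed
  have sub: "?g ` {H. subgroup H G} \<subseteq> generators \<rightarrow>\<^sub>E ?V"
  proof (intro image_subsetI PiE_I)
    fix H \<alpha> assume "H \<in> {H. subgroup H G}" "\<alpha> \<in> generators"
    then show "?g H \<alpha> \<in> ?V"
      using V[of H \<alpha>] by (simp only: restrict_apply' mem_Collect_eq)
  qed simp
  have fin: "finite (generators \<rightarrow>\<^sub>E ?V)"
    using generators_bound by (intro finite_PiE) auto
  have "card ((\<lambda>s. {s}) ` {..<p}) \<le> p"
    using card_image_le[of "{..<p}" "\<lambda>s. {s}"] by simp
  then have "card ?V \<le> p + 2"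
    by (simp add: card_insert_if)
  then have "card (generators \<rightarrow>\<^sub>E ?V) \<le> (p + 2) ^ card generators"
    using generators_bound by (simp add: card_PiE power_mono del: card_insert_disjoint)
  then show ?thesis
    using card_mono[OF fin sub] finite_subset[OF sub fin] finite_imageD[OF _ inj] card_image[OF inj]
    by auto
qed

end


section \<open>Maximum likelihood estimation\<close>

lemma event_prob_parallel:
  assumes wf: "\<forall>cs \<in> set css. \<forall>c \<in> set cs. wf_instr B l m c" and coh: "\<forall>cs \<in> set css. coherent cs"
  shows "event_prob (Circuit (length css * B) (parallel B css)) F E =
    (\<Sum>x | length x = length css * B \<and> E ([], x).
      \<Prod>j<length css. (cmod (run F (css ! j) [] (initial_state B) (take B (drop (j * B) x))))\<^sup>2)"
proof -
  have "filter is_Measure (parallel B css) = []"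
    using coherent_parallel[OF coh] by (auto simp: coherent_def filter_empty_conv)
  then have "event_prob (Circuit (length css * B) (parallel B css)) F E =
    (\<Sum>r | fst r = [] \<and> length (snd r) = length css * B \<and> E r.
      (cmod (run F (parallel B css) (fst r) (initial_state (length css * B)) (snd r)))\<^sup>2)"
    unfolding event_prob_def outcomes_def outcome_prob_def
    by (intro sum.cong) (auto simp: case_prod_unfold)
  also have "\<dots> = (\<Sum>x | length x = length css * B \<and> E ([], x).
      (cmod (run F (parallel B css) [] (initial_state (length css * B)) x))\<^sup>2)"
    by (rule sum.reindex_bij_witness[of _ "\<lambda>x. ([], x)" snd]) auto
  also have "\<dots> = (\<Sum>x | length x = length css * B \<and> E ([], x).
      \<Prod>j<length css. (cmod (run F (css ! j) [] (initial_state B) (take B (drop (j * B) x))))\<^sup>2)"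
    by (intro sum.cong refl) (simp add: run_parallel[OF wf coh] prod_power_distrib flip: prod_norm)
  finally show ?thesis .
qed

lemma prod_sqrt: "(\<Prod>j\<in>A. sqrt (f j)) = sqrt (\<Prod>j\<in>A. f j)"
  by (induction A rule: infinite_finite_induct) (auto simp: real_sqrt_mult)

text \<open>
  On an outcome where the estimate differs from \<open>H\<close>, some \<open>H'\<close> has at least the likelihood of \<open>H\<close>,
  so the square root of the likelihood ratio is at least 1. Its expectation factorizes over the
  independent blocks.
\<close>

lemma maximum_likelihood_success:
  fixes P :: "nat \<Rightarrow> bool list \<Rightarrow> real" and D :: "'h \<Rightarrow> nat \<Rightarrow> 'r \<Rightarrow> real"
    and \<delta> :: real and T B :: nat and \<rho> :: "bool list \<Rightarrow> 'r"
  defines "lik \<equiv> \<lambda>H x. \<Prod>j<T. D H j (\<rho> (take B (drop (j * B) x)))"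
  assumes fin: "finite \<H>" "finite S" and H: "H \<in> \<H>"
    and P: "\<And>j x. 0 \<le> P j x" and D: "\<And>H j r. H \<in> \<H> \<Longrightarrow> j < T \<Longrightarrow> 0 \<le> D H j r"
    and \<rho>: "\<And>x. length x = B \<Longrightarrow> \<rho> x \<in> S"
    and marginal: "\<And>j r. j < T \<Longrightarrow> r \<in> S \<Longrightarrow> (\<Sum>x | length x = B \<and> \<rho> x = r. P j x) = D H j r"
    and total: "\<And>j. j < T \<Longrightarrow> (\<Sum>r\<in>S. D H j r) = 1"
    and est: "\<And>x. est x \<in> \<H>" "\<And>x H'. H' \<in> \<H> \<Longrightarrow> lik H' x \<le> lik (est x) x"
    and \<delta>: "\<And>H'. H' \<in> \<H> \<Longrightarrow> H' \<noteq> H \<Longrightarrow> (\<Prod>j<T. \<Sum>r\<in>S. sqrt (D H j r * D H' j r)) \<le> \<delta>" "0 \<le> \<delta>"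
  shows "1 - card \<H> * \<delta> \<le> (\<Sum>x | length x = T * B \<and> est x = H. \<Prod>j<T. P j (take B (drop (j * B) x)))"
proof -
  let ?ch = "\<lambda>j x. take B (drop (j * B) x)"
  let ?X = "{x :: bool list. length x = T * B}"
  let ?pr = "\<lambda>x. \<Prod>j<T. P j (?ch j x)"
  have finX: "finite ?X"
    by (rule finite_bool_lists)
  have push: "(\<Sum>x | length x = B. P j x * g (\<rho> x)) = (\<Sum>r\<in>S. D H j r * g r)" if "j < T" for j g
  proof -
    have "(\<Sum>x | length x = B. P j x * g (\<rho> x)) = (\<Sum>r\<in>S. \<Sum>x | x \<in> {x. length x = B} \<and> \<rho> x = r. P j x * g (\<rho> x))"
      using \<rho> by (intro sum.group[symmetric] fin finite_bool_lists) auto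
    also have "\<dots> = (\<Sum>r\<in>S. D H j r * g r)"
      using marginal[OF that] by (intro sum.cong refl) (simp add: sum_distrib_right[symmetric] cong: conj_cong)
    finally show ?thesis .
  qed
  have "(\<Sum>x\<in>?X. ?pr x) = 1"
    using push[of _ "\<lambda>_. 1"] total by (simp add: sum_prod_chunks)
  moreover have "(\<Sum>x\<in>?X. ?pr x) = (\<Sum>x | length x = T * B \<and> est x = H. ?pr x) + (\<Sum>x | length x = T * B \<and> est x \<noteq> H. ?pr x)"
    using finX by (subst sum.union_disjoint[symmetric]) (auto intro!: sum.cong elim: rev_finite_subset)
  moreover have "(\<Sum>x | length x = T * B \<and> est x \<noteq> H. ?pr x) \<le> card \<H> * \<delta>"
  proof -
    let ?q = "\<lambda>H' x. \<Prod>j<T. P j (?ch j x) * sqrt (D H' j (\<rho> (?ch j x)) / D H j (\<rho> (?ch j x)))"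
    have q0: "0 \<le> ?q H' x" if "H' \<in> \<H>" for H' x
      using P D H that by (intro prod_nonneg mult_nonneg_nonneg) auto
    have le: "?pr x \<le> ?q (est x) x" if "length x = T * B" "est x \<noteq> H" for x
    proof (cases "\<exists>j<T. P j (?ch j x) = 0")
      case True
      then have "?pr x = 0"
        by (intro prod_zero) auto
      with q0[OF est(1), of x x] show ?thesis
        by (simp only:)
    next
      case False
      \<comment> \<open>Where \<open>P\<close> is positive, so is \<open>D H\<close>; the likelihood
        ratio is then a genuine quotient, not a division by 0.\<close>
      have pos: "0 < D H j (\<rho> (?ch j x))" if j: "j < T" for j
      proof -
        have len: "length (?ch j x) = B"
        proof -
          have "Suc j * B \<le> T * B"
            using j by (intro mult_le_mono1) simp
          then show ?thesis
            using \<open>length x = T * B\<close> by simp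
        qed
        have "0 < P j (?ch j x)"
          using False j P[of j "?ch j x"] by (auto simp: less_le)
        also have "\<dots> \<le> (\<Sum>y | length y = B \<and> \<rho> y = \<rho> (?ch j x). P j y)"
          using len P finite_subset[OF _ finite_bool_lists[of B]] by (intro member_le_sum) auto
        also have "\<dots> = D H j (\<rho> (?ch j x))"
          using j \<rho>[OF len] by (rule marginal)
        finally show ?thesis .
      qed
      have "0 < lik H x"
        unfolding lik_def using pos by (intro prod_pos) auto
      moreover have "lik H x \<le> lik (est x) x"
        by (rule est(2)[OF H])
      ultimately have "1 \<le> sqrt (lik (est x) x / lik H x)"
        by simp
      then have "?pr x * 1 \<le> ?pr x * sqrt (lik (est x) x / lik H x)"
        using P by (intro mult_left_mono prod_nonneg) auto
      also have "\<dots> = ?q (est x) x"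
        by (simp add: lik_def prod.distrib prod_sqrt prod_dividef)
      finally show ?thesis by simp
    qed
    have "(\<Sum>x | length x = T * B \<and> est x \<noteq> H. ?pr x) \<le> (\<Sum>x | length x = T * B \<and> est x \<noteq> H. \<Sum>H'\<in>\<H> - {H}. ?q H' x)"
    proof (rule sum_mono)
      fix x assume "x \<in> {x. length x = T * B \<and> est x \<noteq> H}"
      then have "?pr x \<le> ?q (est x) x" "est x \<in> \<H> - {H}"
        using le est by auto
      moreover have "?q (est x) x \<le> (\<Sum>H'\<in>\<H> - {H}. ?q H' x)"
        using calculation(2) fin q0 by (intro member_le_sum) auto
      ultimately show "?pr x \<le> (\<Sum>H'\<in>\<H> - {H}. ?q H' x)"
        by linarith
    qed
    \<comment> \<open>Extending the sum to all outcomes only adds nonnegative terms and lets it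
      factorize over the blocks.\<close>
    also have "\<dots> \<le> (\<Sum>x\<in>?X. \<Sum>H'\<in>\<H> - {H}. ?q H' x)"
      using q0 by (intro sum_mono2 finX sum_nonneg) auto
    also have "\<dots> = (\<Sum>H'\<in>\<H> - {H}. \<Sum>x\<in>?X. ?q H' x)"
      by (rule sum.swap)
    also have "\<dots> \<le> (\<Sum>H'\<in>\<H> - {H}. \<delta>)"
    proof (rule sum_mono)
      fix H' assume H': "H' \<in> \<H> - {H}"
      have D_sqrt: "D H j r * sqrt (D H' j r / D H j r) = sqrt (D H j r * D H' j r)" if "j < T" for j r
      proof -
        have "D H j r * sqrt (D H' j r / D H j r) = D H j r / sqrt (D H j r) * sqrt (D H' j r)"
          by (simp add: real_sqrt_divide)
        also have "D H j r / sqrt (D H j r) = sqrt (D H j r)"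
          using D[OF H that] by (rule real_div_sqrt)
        finally show ?thesis
          by (simp only: real_sqrt_mult)
      qed
      have "(\<Sum>x\<in>?X. ?q H' x) = (\<Prod>j<T. \<Sum>x | length x = B. P j x * sqrt (D H' j (\<rho> x) / D H j (\<rho> x)))"
        by (rule sum_prod_chunks)
      also have "\<dots> = (\<Prod>j<T. \<Sum>r\<in>S. sqrt (D H j r * D H' j r))"
      proof (rule prod.cong[OF refl])
        fix j assume "j \<in> {..<T}"
        then show "(\<Sum>x | length x = B. P j x * sqrt (D H' j (\<rho> x) / D H j (\<rho> x))) =
            (\<Sum>r\<in>S. sqrt (D H j r * D H' j r))"
          using push[of j "\<lambda>r. sqrt (D H' j r / D H j r)"] D_sqrt by simp
      qed
      finally have "(\<Sum>x\<in>?X. ?q H' x) = (\<Prod>j<T. \<Sum>r\<in>S. sqrt (D H j r * D H' j r))" .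
      then show "(\<Sum>x\<in>?X. ?q H' x) \<le> \<delta>"
        using \<delta>(1)[of H'] H' by simp
    qed
    also have "\<dots> \<le> card \<H> * \<delta>"
      using fin \<delta>(2) card_mono[of \<H> "\<H> - {H}"] by (simp add: mult_right_mono)
    finally show ?thesis .
  qed
  ultimately show ?thesis
    by linarith
qed

text \<open>Only the factor at \<open>y\<close> is known to be small, and it occurs once per round;
  all others are at most 1.\<close>

lemma prod_replicate_le:
  fixes g :: "'a \<Rightarrow> real" and k :: nat
  assumes "distinct xs" "\<And>x. x \<in> set xs \<Longrightarrow> 0 \<le> g x \<and> g x \<le> 1" "y \<in> set xs" "g y \<le> c"
  defines "zs \<equiv> concat (replicate k xs)"
  shows "(\<Prod>j<length zs. g (zs ! j)) \<le> c ^ k"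
proof -
  have "(\<Prod>j<length zs. g (zs ! j)) = prod_list (map g zs)"
    by (simp add: prod.list_conv_set_nth atLeast0LessThan)
  also have "\<dots> = prod_list (map g xs) ^ k"
    unfolding zs_def by (induction k) auto
  also have "prod_list (map g xs) = (\<Prod>x\<in>set xs. g x)"
    using assms(1) by (simp add: prod.distinct_set_conv_list)
  also have "\<dots> = g y * (\<Prod>x\<in>set xs - {y}. g x)"
    using assms(3) by (simp add: prod.remove)
  also have "\<dots> ^ k \<le> c ^ k"
  proof (rule power_mono)
    have "(\<Prod>x\<in>set xs - {y}. g x) \<le> 1" "0 \<le> (\<Prod>x\<in>set xs - {y}. g x)"
      using assms(2) by (auto intro: prod_le_1 prod_nonneg)
    then show "g y * (\<Prod>x\<in>set xs - {y}. g x) \<le> c" "0 \<le> g y * (\<Prod>x\<in>set xs - {y}. g x)"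
      using assms(2)[OF assms(3)] assms(4) by (auto intro: order_trans[OF mult_left_le])
  qed
  finally show ?thesis .
qed

text \<open>2048 factors halve the bound, as
  \<open>(1 - 1 / 2048) ^ 2048 \<le> exp (- 1) \<le> 1 / 2\<close>. Since
  \<open>c \<le> 2 ^ (s * (n + 1))\<close>, \<open>s * (n + 1)\<close> halvings absorb
  \<open>c\<close>, and \<open>n\<close> further ones leave \<open>1 / 2 ^ n\<close>.\<close>

lemma amplification_bound:
  assumes "p < 2 ^ n" "1 \<le> n" "c \<le> (p + 2) ^ s"
  shows "real c * (1 - 1 / 2048) ^ (2048 * (s * (n + 1) + n)) \<le> 1 / 2 ^ n"
proof -
  have "(1 - 1 / 2048 :: real) \<le> exp (- 1 / 2048)"
    using exp_ge_add_one_self[of "- 1 / 2048 :: real"] by simp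
  then have "(1 - 1 / 2048 :: real) ^ 2048 \<le> exp (- 1 / 2048) ^ 2048"
    by (intro power_mono) auto
  also have "\<dots> = exp (- 1)"
    by (simp flip: exp_of_nat_mult)
  also have "\<dots> \<le> (1 / 2 :: real)"
    using exp_ge_add_one_self[of "1 :: real"] by (simp add: exp_minus field_simps)
  finally have half: "(1 - 1 / 2048 :: real) ^ 2048 \<le> 1 / 2" .
  have "p + 2 \<le> 2 ^ (n + 1)"
    using assms(1) power_increasing[OF assms(2), of "2 :: nat"] by simp
  then have "(p + 2) ^ s \<le> (2 ^ (n + 1)) ^ s"
    by (intro power_mono) auto
  also have "(2 ^ (n + 1)) ^ s = (2 :: nat) ^ (s * (n + 1))"
    by (metis power_mult mult.commute)
  finally have "c \<le> 2 ^ (s * (n + 1))"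
    using assms(3) by (rule order_trans[rotated])
  then have "real c \<le> 2 ^ (s * (n + 1))"
    by (metis of_nat_le_iff of_nat_numeral of_nat_power)
  moreover have "((1 - 1 / 2048) ^ 2048) ^ (s * (n + 1) + n) \<le> (1 / 2 :: real) ^ (s * (n + 1) + n)"
    by (rule power_mono[OF half]) simp
  ultimately have "real c * ((1 - 1 / 2048) ^ 2048) ^ (s * (n + 1) + n) \<le>
      2 ^ (s * (n + 1)) * (1 / 2) ^ (s * (n + 1) + n)"
    by (intro mult_mono) auto
  also have "\<dots> = 1 / 2 ^ n"
    by (simp add: power_add power_divide)
  finally show ?thesis
    by (simp only: power_mult)
qed

section \<open>Well-formedness and size of the circuits\<close>

lemma wf_qft: "s + j \<le> k \<Longrightarrow> \<forall>c \<in> set (qft s j). wf_instr k l m c"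
  by (induction j) (auto simp: unitary_hadamard unitary_cphase)

lemma wf_load: "n \<le> c \<Longrightarrow> c < k \<Longrightarrow> \<forall>i \<in> set (load n c A). wf_instr k l m i"
  by (auto simp: load_def unitary_cflip)

lemma wf_coset_test:
  assumes "2 \<le> n" "unitary U"
  shows "\<forall>c \<in> set (coset_test n m U A). wf_instr (2 * n + 2 + m) (2 * n) m c"
  using wf_qft[of n "Suc n" "2 * n + 2 + m" "2 * n" m] wf_load[of n "2 * n + 1" "2 * n + 2 + m" A "2 * n" m] assms
  by (auto simp: coset_test_def prep_def unitary_hadamard simp del: qft.simps upt_Suc)

lemma coherent_coset_test: "coherent (coset_test n m U A)"
  unfolding coset_test_def
  by (simp only: coherent_simps coherent_prep coherent_load coherent_qft simp_thms)

lemma length_qft: "length (qft s j) \<le> j\<^sup>2"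
  by (induction j) (auto simp: power2_eq_square)

lemma length_coset_test: "2 \<le> n \<Longrightarrow> length (coset_test n m U A) \<le> 4 * (n + 1)\<^sup>2"
  using length_qft[of n "Suc n"]
  by (simp add: coset_test_def prep_def load_def power2_eq_square del: qft.simps)

section \<open>Reconstruction in a single group\<close>

lemma test_dist_cong:
  assumes "\<And>s t. snd s < L \<Longrightarrow> snd t < L \<Longrightarrow> coll s t = coll' s t"
  shows "test_dist n L coll r = test_dist n L coll' r"
  unfolding test_dist_def using assms by (cases r) (auto intro!: sum.cong arg_cong2[where f = "(/)"])

text \<open>The map sending an element to its coset of \<open>H\<close> takes the place of the
  oracle, so \<open>H\<close> may be any candidate subgroup.\<close>

lemma (in q_hedral) test_dist_fibre_nonneg:
  assumes "subgroup H G" "\<alpha> \<in> range pw" "L \<le> p"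
  shows "0 \<le> test_dist n L (coset_collision p (full H) (fibre H \<alpha>)) r"
proof -
  have "test_dist n L (coset_collision p (full H) (fibre H \<alpha>)) r =
    test_dist n L (\<lambda>s t. (if fst s then \<alpha> else 1, snd s) <#\<^bsub>G\<^esub> H = (if fst t then \<alpha> else 1, snd t) <#\<^bsub>G\<^esub> H) r"
    using assms by (intro test_dist_cong) (simp add: coset_collision_iff)
  then show ?thesis
    by (simp only: test_dist_nonneg)
qed

lemma (in q_hedral) reconstruction:
  assumes n: "n = floorlog 2 p"
  shows "\<exists>C R. circuit_size C \<le> 24576 * (n + 1) ^ 7 * (m + 1) \<and> wf_circuit (2 * n) m C \<and>
    (\<forall>r. subgroup (R r) G) \<and>
    (\<forall>H f F. hides G m f H \<and> implements G (affine_code p) (2 * n) m F f \<longrightarrow>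
      1 - 1 / 2 ^ n \<le> event_prob C F (\<lambda>r. R r = H))"
proof -
  have pn: "2 ^ (n - 1) \<le> p" "p < 2 ^ n"
    using floorlog_bounds[of p 2] p_gt_1 n by auto
  have n2: "2 \<le> n"
  proof (rule ccontr)
    assume "\<not> 2 \<le> n"
    then have "(2 :: nat) ^ n \<le> 2 ^ 1"
      by (intro power_increasing) auto
    then show False
      using pn p_gt_1 by simp
  qed
  then obtain k where k: "n = k + 2"
    using le_Suc_ex[of 2 n] by (auto simp: add.commute)
  \<comment> \<open>The larger of the lengths \<open>2 * 2 ^ k\<close> and \<open>3 * 2 ^ k\<close>
    that does not exceed \<open>p\<close>. As \<open>p < 4 * 2 ^ k\<close>, the quotient of
    \<open>p\<close> by it stays below \<open>3 / 2\<close>.\<close>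
  define K :: nat where "K = (if p < 3 * 2 ^ k then 2 else 3)"
  have K: "K = 2 \<or> K = 3" "0 < K" "K \<le> 4"
    by (auto simp: K_def)
  define L where "L = K * 2 ^ (n - 2)"
  have L: "L \<le> p" "2 * p < 3 * L" "2 ^ n \<le> 2 * L" "0 < L"
    using pn unfolding L_def K_def k by (auto simp: not_less)
  obtain U where U: "unitary U" "\<And>h l. U $ (h, l) $ (False, False) =
      (if 2 * of_bool h + of_bool l < K then 1 / sqrt K else 0)"
    using ex_unitary_uniform_column[OF K(1)] by blast
  obtain \<sigma>s where \<sigma>s: "set \<sigma>s = generators" "distinct \<sigma>s"
    using generators_bound finite_distinct_list by blast
  define s where "s = card generators"
  \<comment> \<open>Enough rounds for the number of subgroups, at most \<open>(p + 2) ^ s\<close>,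
    times the fidelity to drop to \<open>1 / 2 ^ n\<close>.\<close>
  define reps where "reps = 2048 * (s * (n + 1) + n)"
  define \<alpha>s where "\<alpha>s = concat (replicate reps \<sigma>s)"
  define T where "T = length \<alpha>s"
  define B where "B = 2 * n + 2 + m"
  define A where "A = (\<lambda>\<alpha> c :: bool. if c then \<alpha> else 1 :: nat)"
  define test where "test = (\<lambda>\<alpha>. coset_test n m U (A \<alpha>))"
  define css where "css = map test \<alpha>s"
  define C where "C = Circuit (T * B) (parallel B css)"
  define D where "D = (\<lambda>H \<alpha>. test_dist n L (coset_collision p (full H) (fibre H \<alpha>)))"
  define lik where "lik = (\<lambda>H x. \<Prod>j<T. D H (\<alpha>s ! j) (test_result n (take B (drop (j * B) x))))"
  define \<H> where "\<H> = {H. subgroup H G}"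
  \<comment> \<open>The likelihoods involve only candidate subgroups and the outcome, so the
    estimate does not depend on the oracle.\<close>
  define est where "est = (\<lambda>x. SOME H. H \<in> \<H> \<and> (\<forall>H'\<in>\<H>. lik H' x \<le> lik H x))"
  let ?S = "UNIV \<times> {..<2 ^ Suc n} :: (bool \<times> nat) set"
  have T: "T = reps * s"
    using \<sigma>s by (simp add: T_def \<alpha>s_def s_def length_concat sum_list_replicate distinct_card[symmetric])
  have \<alpha>: "\<alpha>s ! j \<in> generators" "\<alpha>s ! j \<in> range pw" if "j < T" for j
  proof -
    have "set \<alpha>s \<subseteq> generators"
      using \<sigma>s by (auto simp: \<alpha>s_def)
    then show "\<alpha>s ! j \<in> generators"
      using that nth_mem unfolding T_def by blast
    then show "\<alpha>s ! j \<in> range pw"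
      using generators_subset by auto
  qed
  have wf: "\<forall>cs \<in> set css. \<forall>c \<in> set cs. wf_instr B (2 * n) m c"
    using wf_coset_test[OF n2 U(1)] by (auto simp: css_def test_def B_def)
  have coh: "\<forall>cs \<in> set css. coherent cs"
    by (auto simp: css_def test_def coherent_coset_test)
  have len: "length css = T"
    by (simp add: css_def T_def)
  have \<H>: "finite \<H>" "card \<H> \<le> (p + 2) ^ s"
    using card_subgroups by (auto simp: \<H>_def s_def)
  have est: "est x \<in> \<H>" "\<And>H'. H' \<in> \<H> \<Longrightarrow> lik H' x \<le> lik (est x) x" for x
  proof -
    have "\<H> \<noteq> {}"
      using group.subgroup_self[OF group_G] by (auto simp: \<H>_def)
    then have "Max ((\<lambda>H. lik H x) ` \<H>) \<in> (\<lambda>H. lik H x) ` \<H>"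
      using \<H>(1) by (intro Max_in) auto
    then obtain H where "H \<in> \<H>" "lik H x = Max ((\<lambda>H. lik H x) ` \<H>)"
      by (elim imageE) metis
    then have "\<exists>H. H \<in> \<H> \<and> (\<forall>H'\<in>\<H>. lik H' x \<le> lik H x)"
      using \<H>(1) by auto
    from someI_ex[OF this] show "est x \<in> \<H>" "\<And>H'. H' \<in> \<H> \<Longrightarrow> lik H' x \<le> lik (est x) x"
      by (auto simp: est_def)
  qed
  have D0: "0 \<le> D H \<alpha> r" if "H \<in> \<H>" "\<alpha> \<in> generators" for H \<alpha> r
    using test_dist_fibre_nonneg[of H \<alpha> L r] that generators_subset L by (auto simp: D_def \<H>_def)
  have LN: "L \<le> 2 ^ Suc n"
    using L(1) pn by simp
  have D1: "(\<Sum>r\<in>?S. D H \<alpha> r) = 1" for H \<alpha>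
    unfolding D_def by (rule test_dist_total[OF L(4) LN])
  \<comment> \<open>Up to constants, \<open>s\<close> is at most \<open>(n + 1) ^ 2\<close>,
    \<open>reps\<close> at most \<open>(n + 1) ^ 3\<close>, and each block contributes at most
    \<open>(n + 1) ^ 2 * (m + 1)\<close>.\<close>
  have size: "circuit_size C \<le> 24576 * (n + 1) ^ 7 * (m + 1)"
  proof -
    let ?y = "n + 1"
    have "n * n + 1 \<le> ?y ^ 2"
      by (simp add: power2_eq_square)
    then have s: "s \<le> ?y ^ 2"
      using generators_bound unfolding s_def by linarith
    have "s * ?y + n \<le> ?y ^ 2 * ?y + ?y ^ 2 * ?y"
    proof (intro add_mono mult_right_mono s)
      have "n * 1 \<le> ?y * (?y * ?y)"
        by (intro mult_mono) auto
      then show "n \<le> ?y ^ 2 * ?y"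
        by (simp add: power2_eq_square)
    qed simp
    then have "reps \<le> 4096 * ?y ^ 3"
      by (simp add: reps_def power2_eq_square power3_eq_cube)
    then have "T \<le> 4096 * ?y ^ 3 * ?y ^ 2"
      unfolding T using s by (intro mult_mono) auto
    also have "\<dots> = 4096 * ?y ^ 5"
      by (simp flip: power_add)
    finally have T': "T \<le> 4096 * ?y ^ 5" .
    have "\<forall>cs\<in>set css. length cs \<le> 4 * ?y ^ 2"
      using length_coset_test[OF n2] by (auto simp: css_def test_def)
    then have "length (parallel B css) \<le> T * (4 * ?y ^ 2)"
      using length_parallel[of css] len by metis
    then have "circuit_size C \<le> T * (B + 4 * ?y ^ 2)"
      by (simp add: C_def circuit_size_def distrib_left)
    also have "B + 4 * ?y ^ 2 \<le> 6 * ?y ^ 2 * (m + 1)"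
    proof -
      have "2 * ?y \<le> 2 * ?y ^ 2" "m \<le> ?y ^ 2 * m"
        by (simp_all add: power2_eq_square)
      moreover have "B = 2 * ?y + m"
        by (simp add: B_def)
      moreover have "6 * ?y ^ 2 * (m + 1) = 6 * (?y ^ 2 * m) + 6 * ?y ^ 2"
        by (simp add: distrib_left)
      ultimately show ?thesis
        by linarith
    qed
    then have "T * (B + 4 * ?y ^ 2) \<le> 4096 * ?y ^ 5 * (6 * ?y ^ 2 * (m + 1))"
      using T' by (intro mult_mono) auto
    also have "\<dots> = 24576 * (?y ^ 5 * ?y ^ 2) * (m + 1)"
      by (simp only: mult_ac)
    also have "?y ^ 5 * ?y ^ 2 = ?y ^ 7"
      by (simp flip: power_add)
    finally show ?thesis .
  qed
  have wfC: "wf_circuit (2 * n) m C"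
    using wf_parallel[OF wf] len by (auto simp: wf_circuit_def C_def)
  have success: "1 - 1 / 2 ^ n \<le> event_prob C F (\<lambda>r. est (snd r) = H)"
    if hides: "hides G m f H" and impl: "implements G (affine_code p) (2 * n) m F f" for H f F
  proof -
    have H: "subgroup H G"
      using hides by (simp add: hides_def)
    have F: "length (F z) = m" if "length z = 2 * n" for z
      using impl that by (simp add: implements_def)
    have code: "F (enc n \<beta> b) = f (\<beta>, b)" if "(\<beta>, b) \<in> carrier G" for \<beta> b
      using impl that by (auto simp: implements_def affine_code_def enc_def n)
    define P where "P = (\<lambda>j x. (cmod (run F (css ! j) [] (initial_state B) x))\<^sup>2)"
    have marginal: "(\<Sum>x | length x = B \<and> test_result n x = r. P j x) = D H (\<alpha>s ! j) r"
      if "j < T" "r \<in> ?S" for j r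
    proof -
      let ?\<alpha> = "\<alpha>s ! j"
      have "css ! j = coset_test n m U (A ?\<alpha>)"
        using that by (simp add: css_def test_def T_def)
      then have "(\<Sum>x | length x = B \<and> test_result n x = r. P j x) =
        test_dist n L (\<lambda>s t. F (enc n (A ?\<alpha> (fst s)) (snd s)) = F (enc n (A ?\<alpha> (fst t)) (snd t))) r"
        using coset_test_marginal[OF n2 K(2,3) U(2) F, where r = r and A = "A ?\<alpha>"] that by (auto simp: P_def B_def L_def)
      also have "\<dots> = D H ?\<alpha> r"
        unfolding D_def
      proof (rule test_dist_cong)
        fix s t :: "bool \<times> nat" assume st: "snd s < L" "snd t < L"
        have car: "(A ?\<alpha> (fst u), snd u) \<in> carrier G" if "snd u < L" for u :: "bool \<times> nat"
          using that L(1) \<alpha>[OF \<open>j < T\<close>] by (simp add: carrier_G A_def)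
        have "F (enc n (A ?\<alpha> (fst s)) (snd s)) = F (enc n (A ?\<alpha> (fst t)) (snd t)) \<longleftrightarrow>
          (A ?\<alpha> (fst s), snd s) <#\<^bsub>G\<^esub> H = (A ?\<alpha> (fst t), snd t) <#\<^bsub>G\<^esub> H"
          using hides car[OF st(1)] car[OF st(2)] by (simp add: code hides_def)
        also have "\<dots> \<longleftrightarrow> coset_collision p (full H) (fibre H ?\<alpha>) s t"
          unfolding A_def using coset_collision_iff[OF H \<alpha>(2)[OF \<open>j < T\<close>]] st L(1) by simp
        finally show "F (enc n (A ?\<alpha> (fst s)) (snd s)) = F (enc n (A ?\<alpha> (fst t)) (snd t)) \<longleftrightarrow>
          coset_collision p (full H) (fibre H ?\<alpha>) s t" .
      qed
      finally show ?thesis .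
    qed
    have affinity: "(\<Prod>j<T. \<Sum>r\<in>?S. sqrt (D H (\<alpha>s ! j) r * D H' (\<alpha>s ! j) r)) \<le> (1 - 1 / 2048) ^ reps"
      if H': "H' \<in> \<H>" "H' \<noteq> H" for H'
    proof -
      let ?g = "\<lambda>\<alpha>. \<Sum>r\<in>?S. sqrt (D H \<alpha> r * D H' \<alpha> r)"
      have Hs: "H \<in> \<H>" "subgroup H' G"
        using H H' by (auto simp: \<H>_def)
      \<comment> \<open>One generator with different fibres suffices, since its test recurs in every
        round.\<close>
      obtain \<alpha> where \<alpha>': "\<alpha> \<in> generators" "fibre H \<alpha> \<noteq> fibre H' \<alpha>"
        using subgroup_eq_of_fibres[OF H Hs(2)] H'(2) by blast
      have "?g \<alpha> \<le> 1 - 1 / 2048"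
      proof (rule test_dist_separation[OF n2 L(1,2) pn(2) L(3)])
        show "fibre_data p (full H) (fibre H \<alpha>)" "fibre_data p (full H') (fibre H' \<alpha>)"
          using fibre_data_fibre H Hs \<alpha>' generators_subset by auto
      qed (use \<alpha>' D0 Hs H' in \<open>auto simp: D_def\<close>)
      moreover have "0 \<le> ?g \<beta> \<and> ?g \<beta> \<le> 1" if "\<beta> \<in> generators" for \<beta>
      proof -
        have "?g \<beta> \<le> (\<Sum>r\<in>?S. (D H \<beta> r + D H' \<beta> r) / 2)"
          using D0 Hs H' that by (intro sum_mono arith_geo_mean_sqrt) auto
        also have "\<dots> = 1"
          by (simp only: D1 sum.distrib flip: sum_divide_distrib) simp
        finally show ?thesis
          using D0 Hs H' that by (auto intro!: sum_nonneg)
      qed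
      ultimately show ?thesis
        using prod_replicate_le[of \<sigma>s ?g \<alpha> "1 - 1 / 2048" reps] \<sigma>s \<alpha>' unfolding T_def \<alpha>s_def by auto
    qed
    have "1 - card \<H> * (1 - 1 / 2048) ^ reps \<le>
      (\<Sum>x | length x = T * B \<and> est x = H. \<Prod>j<T. P j (take B (drop (j * B) x)))"
    proof (rule maximum_likelihood_success[where D = "\<lambda>H j. D H (\<alpha>s ! j)" and S = ?S and \<rho> = "test_result n"])
      show "est x \<in> \<H>" for x
        by (rule est)
      show "(\<Prod>j<T. D H' (\<alpha>s ! j) (test_result n (take B (drop (j * B) x)))) \<le>
        (\<Prod>j<T. D (est x) (\<alpha>s ! j) (test_result n (take B (drop (j * B) x))))" if "H' \<in> \<H>" for x H'
        using est(2)[OF that] by (simp only: lik_def)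
      show "test_result n x \<in> ?S" for x
        using readout_less[of n x] by (simp add: test_result_def)
    qed (use \<H> H D0 D1 \<alpha> marginal affinity in \<open>auto simp: P_def \<H>_def\<close>)
    also have "\<dots> = event_prob C F (\<lambda>r. est (snd r) = H)"
      using event_prob_parallel[OF wf coh, of F "\<lambda>r. est (snd r) = H"] unfolding len C_def P_def by simp
    finally show ?thesis
      using amplification_bound[OF pn(2) _ \<H>(2)] n2 unfolding reps_def by linarith
  qed
  show ?thesis
    using size wfC est(1) success
    by (intro exI[of _ C] exI[of _ "\<lambda>r. est (snd r)"]) (auto simp: \<H>_def)
qed


section \<open>Families of q-hedral groups\<close>

lemma (in q_hedral) card_carrier_bounds: "p \<le> card (carrier G)" "card (carrier G) \<le> p\<^sup>2"
proof -
  have sub: "range pw \<subseteq> {..<p}"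
    using pw_less by auto
  then have "card (range pw) \<le> p" "0 < card (range pw)"
    using card_mono[OF _ sub] finite_subset[OF sub] by (auto simp: card_gt_0_iff)
  then show "p \<le> card (carrier G)" "card (carrier G) \<le> p\<^sup>2"
    by (auto simp: carrier_G card_cartesian_product power2_eq_square)
qed

text \<open>The group order lies between \<open>p\<close> and \<open>p ^ 2\<close>: the lower bound
  makes \<open>n\<close> logarithmic in it, the upper bound turns the error \<open>1 / 2 ^ n\<close>
  into a rate in the group order.\<close>

lemma (in q_hedral) floorlog_bounds_card:
  assumes n: "n = floorlog 2 p"
  shows "real n \<le> log 2 (card (carrier G)) + 1" "1 / 2 ^ n \<le> 1 / sqrt (card (carrier G))"
proof -
  have pn: "2 ^ (n - 1) \<le> p" "p < 2 ^ n"
    using floorlog_bounds[of p 2] p_gt_1 n by auto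
  have "2 ^ (n - 1) \<le> card (carrier G)"
    using pn card_carrier_bounds by linarith
  then have "real (2 ^ (n - 1)) \<le> real (card (carrier G))"
    by (simp only: of_nat_le_iff)
  then have "real (n - 1) \<le> log 2 (card (carrier G))"
    by (intro le_log_of_power) auto
  then show "real n \<le> log 2 (card (carrier G)) + 1"
    by linarith
  have "card (carrier G) \<le> (2 ^ n)\<^sup>2"
    using card_carrier_bounds(2) power_mono[of p "2 ^ n" 2] pn by linarith
  then have "real (card (carrier G)) \<le> (2 ^ n)\<^sup>2"
    by (metis of_nat_le_iff of_nat_numeral of_nat_power)
  then have "sqrt (card (carrier G)) \<le> 2 ^ n"
    by (intro real_le_lsqrt) auto
  moreover have "0 < card (carrier G)"
    using card_carrier_bounds(1) p_gt_1 by linarith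
  ultimately show "1 / 2 ^ n \<le> 1 / sqrt (card (carrier G))"
    by (intro divide_left_mono) auto
qed

text \<open>The index set is left open, so that the pairs \<open>(p, q)\<close> and the primes alone
  are both instances.\<close>

lemma info_reconstructible_q_hedral_family:
  assumes I: "\<And>i. i \<in> I \<Longrightarrow> prime (p i) \<and> q i dvd p i - 1 \<and> a i \<in> totatives (p i) \<and> ord (p i) (a i) = q i"
    and G: "\<And>i. i \<in> I \<Longrightarrow> G i = q_hedral_group (p i) (q i) (a i)"
    and code: "\<And>i. i \<in> I \<Longrightarrow> code i = affine_code (p i)" "\<And>i. i \<in> I \<Longrightarrow> l i = affine_code_length (p i)"
  shows "info_reconstructible I G code l"
  unfolding info_reconstructible_def
proof (intro allI impI)
  fix m assume "polylog_bounded I G m"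
  then obtain M where M: "\<And>i. i \<in> I \<Longrightarrow> real (m i) \<le> poly M (log 2 (card (carrier (G i))))"
    by (auto simp: polylog_bounded_def)
  let ?n = "\<lambda>i. floorlog 2 (p i)"
  have hedral: "q_hedral (p i) (q i) (a i) (?n i)" if "i \<in> I" for i
    using I[OF that] floorlog_bounds[of "p i" 2] prime_gt_0_nat by unfold_locales auto
  let ?ok = "\<lambda>i C R. circuit_size C \<le> 24576 * (?n i + 1) ^ 7 * (m i + 1) \<and> wf_circuit (l i) (m i) C \<and>
    (\<forall>r. subgroup (R r) (G i)) \<and>
    (\<forall>H f F. hides (G i) (m i) f H \<and> implements (G i) (code i) (l i) (m i) F f \<longrightarrow>
      1 - 1 / 2 ^ ?n i \<le> event_prob C F (\<lambda>r. R r = H))"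
  have "\<exists>C R. ?ok i C R" if "i \<in> I" for i
    using q_hedral.reconstruction[OF hedral[OF that] refl, of "m i"]
    unfolding G[OF that] code(1)[OF that] code(2)[OF that] affine_code_length_def .
  then obtain C R where CR: "\<And>i. i \<in> I \<Longrightarrow> ?ok i (C i) (R i)"
    by metis
  have poly: "polylog_bounded I G (\<lambda>i. circuit_size (C i))"
    unfolding polylog_bounded_def
  proof (intro exI[of _ "[:24576:] * [:2, 1:] ^ 7 * (M + 1)"] ballI)
    fix i assume i: "i \<in> I"
    let ?X = "log 2 (card (carrier (G i)))"
    have "real (?n i) + 1 \<le> 2 + ?X"
      using q_hedral.floorlog_bounds_card(1)[OF hedral[OF i] refl] unfolding G[OF i] by linarith
    then have "(real (?n i) + 1) ^ 7 * (real (m i) + 1) \<le> (2 + ?X) ^ 7 * (poly M ?X + 1)"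
      using M[OF i] by (intro mult_mono power_mono) auto
    moreover have "real (circuit_size (C i)) \<le> real (24576 * (?n i + 1) ^ 7 * (m i + 1))"
      using CR[OF i] by (simp only: of_nat_le_iff)
    moreover have "real (24576 * (?n i + 1) ^ 7 * (m i + 1)) = 24576 * ((real (?n i) + 1) ^ 7 * (real (m i) + 1))"
      by (simp add: algebra_simps)
    moreover have "poly ([:24576:] * [:2, 1:] ^ 7 * (M + 1)) ?X = 24576 * ((2 + ?X) ^ 7 * (poly M ?X + 1))"
      by simp
    ultimately show "real (circuit_size (C i)) \<le> poly ([:24576:] * [:2, 1:] ^ 7 * (M + 1)) ?X"
      by linarith
  qed
  have lim: "(\<lambda>k. 1 / sqrt (real k)) \<longlonglongrightarrow> 0"
    by (rule real_tendsto_divide_at_top[OF tendsto_const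
        filterlim_compose[OF sqrt_at_top filterlim_real_sequentially]])
  have "1 - 1 / sqrt (card (carrier (G i))) \<le> event_prob (C i) F (\<lambda>r. R i r = H)"
    if "i \<in> I" "hides (G i) (m i) f H" "implements (G i) (code i) (l i) (m i) F f" for i H f F
  proof -
    have "1 - 1 / 2 ^ ?n i \<le> event_prob (C i) F (\<lambda>r. R i r = H)"
      using CR that by blast
    moreover have "1 / 2 ^ ?n i \<le> 1 / sqrt (card (carrier (G i)))"
      using q_hedral.floorlog_bounds_card(2)[OF hedral[OF that(1)] refl] unfolding G[OF that(1)] .
    ultimately show ?thesis
      by linarith
  qed
  then show "\<exists>C R \<epsilon>. polylog_bounded I G (\<lambda>i. circuit_size (C i)) \<and> \<epsilon> \<longlonglongrightarrow> 0 \<and>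
    (\<forall>i\<in>I. wf_circuit (l i) (m i) (C i) \<and> (\<forall>r. subgroup (R i r) (G i)) \<and>
      (\<forall>H f F. hides (G i) (m i) f H \<and> implements (G i) (code i) (l i) (m i) F f \<longrightarrow>
        1 - \<epsilon> (card (carrier (G i))) \<le> event_prob (C i) F (\<lambda>r. R i r = H)))"
    using poly lim CR by (intro exI[of _ C] exI[of _ R] exI[of _ "\<lambda>k. 1 / sqrt (real k)"]) blast
qed

text \<open>An element of order \<open>p - 1\<close> is a primitive root: its \<open>p - 1\<close>
  distinct powers exhaust the nonzero residues.\<close>

lemma affine_group_eq_q_hedral_group:
  assumes "prime p" "a \<in> totatives p" "ord p a = p - 1"
  shows "affine_group p = q_hedral_group p (p - 1) a"
proof -
  interpret q_hedral p "p - 1" a "floorlog 2 p"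
    using assms floorlog_bounds[of p 2] prime_gt_0_nat by unfold_locales auto
  have "inj_on pw {..<p - 1}"
    by (rule inj_onI) (simp add: pw_eq_iff cong_def)
  then have "card (pw ` {..<p - 1}) = card {0<..<p}"
    by (simp add: card_image)
  moreover have "pw ` {..<p - 1} \<subseteq> {0<..<p}"
  proof -
    have "pw t \<noteq> 0" for t
      using pw_inverse[of t] by (metis mod_0 mult_0_right zero_neq_one)
    then show ?thesis
      using pw_less by auto
  qed
  ultimately have "pw ` {..<p - 1} = {0<..<p}"
    by (intro card_subset_eq) auto
  then show ?thesis
    using assms(1) by (simp add: affine_group_def q_hedral_group_def totatives_prime pw_def[abs_def])
qed

theorem theorem5:
  fixes a :: "nat \<Rightarrow> nat \<Rightarrow> nat"
  assumes "\<And>p q. prime p \<Longrightarrow> q dvd p - 1 \<Longrightarrow> a p q \<in> totatives p \<and> ord p (a p q) = q"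
  shows "info_reconstructible {(p, q). prime p \<and> q dvd p - 1}
           (\<lambda>(p, q). q_hedral_group p q (a p q))
           (\<lambda>(p, q). affine_code p) (\<lambda>(p, q). affine_code_length p)
       \<and> info_reconstructible {p. prime p} affine_group affine_code affine_code_length"
proof
  show "info_reconstructible {(p, q). prime p \<and> q dvd p - 1}
      (\<lambda>(p, q). q_hedral_group p q (a p q)) (\<lambda>(p, q). affine_code p) (\<lambda>(p, q). affine_code_length p)"
    using assms by (intro info_reconstructible_q_hedral_family[where p = fst and q = snd and a = "\<lambda>(p, q). a p q"]) auto
  show "info_reconstructible {p. prime p} affine_group affine_code affine_code_length"
  proof (rule info_reconstructible_q_hedral_family[where p = "\<lambda>p. p" and q = "\<lambda>p. p - 1" and a = "\<lambda>p. a p (p - 1)"])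
    fix p :: nat assume "p \<in> {p. prime p}"
    then have "prime p"
      by simp
    with assms[OF this dvd_refl] show "prime p \<and> p - 1 dvd p - 1 \<and> a p (p - 1) \<in> totatives p \<and> ord p (a p (p - 1)) = p - 1"
      by simp
    then show "affine_group p = q_hedral_group p (p - 1) (a p (p - 1))"
      by (intro affine_group_eq_q_hedral_group) blast+
  qed (rule refl)+
qed

end
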